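(* Let $\pi$ be a doubling Borel probability measure on $\mathbb R^d$ with compact support $K$. Then a typical measure $\mu\in\mathcal P(K)$ satisfies, for any $q\in\mathbb R$, $$\overline{\dim}^{q}_{*,\pi,B}(\mu)=\tau_{\pi,\mathrm{loc}}(q)\qquad\text{and}\qquad \overline{\dim}^{*,q}_{\pi,B}(\mu)=\tau_{\pi,\mathrm{loc,max}}(q).$$
   Context: $\mathcal P(K)$ is the set of Borel probability measures on $K$, endowed with the weak topology. A property holds for a typical measure of $\mathcal P(K)$ if it is satisfied by all elements of some dense $G_\delta$ subset of $\mathcal P(K)$. $B(x,r)$ is the open ball of centre $x$ and radius $r$ in $\mathbb R^d$. A measure $\pi$ on $\mathbb R^d$ is doubling if there is $C>0$ with $\sup_{x\in\operatorname{supp}(\pi)}\sup_{r>0}\frac{\pi(B(x,2r))}{\pi(B(x,r))}\le C$. For $E\subset K$, $r>0$ and $q\in\mathbb R$ let $$\mathbf N_\pi^q(E,r)=\inf\sum_i\pi\big(B(x_i,r)\big)^q,$$ the infimum being over all at most countable families of balls $(B(x_i,r))_i$ with centres $x_i\in K$ covering $E$. The upper covering multifractal box dimension of $E$ of order $q$ with respect to $\pi$ is $$\overline{\dim}_{\pi,B}^q(E)=\limsup_{r\to0^+}\frac{\log\mathbf N_\pi^q(E,r)}{-\log r}.$$ For $\mu\in\mathcal P(K)$, the small and big upper multifractal box dimensions of $\mu$ of order $q$ with respect to $\pi$ are $$\overline{\dim}^{q}_{*,\pi,B}(\mu)=\inf_{\mu(E)>0}\overline{\dim}_{\pi,B}^q(E),\qquad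 \overline{\dim}^{*,q}_{\pi,B}(\mu)=\lim_{\varepsilon\to0^+}\inf_{\mu(E)>1-\varepsilon}\overline{\dim}_{\pi,B}^q(E),$$ where $E$ ranges over Borel subsets of $K$. For $E\subset K$ put $\overline{\dim}_{\pi,B,\mathrm{loc}}^q(E)=\inf_{x\in E}\inf_{r>0}\overline{\dim}_{\pi,B}^q\big(E\cap B(x,r)\big)$. The local upper moment scaling and the maximal local upper moment scaling of $\pi$ are $$\tau_{\pi,\mathrm{loc}}(q)=\overline{\dim}_{\pi,B,\mathrm{loc}}^q(K),\qquad \tau_{\pi,\mathrm{loc,max}}(q)=\sup_{y\in K,\ \rho>0}\overline{\dim}_{\pi,B,\mathrm{loc}}^q\big(K\cap B(y,\rho)\big).$$ *)

theory Defs
  imports "HOL-Probability.Probability"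
begin

definition msupp :: "'a::topological_space measure \<Rightarrow> 'a set"
  where "msupp \<pi> = {x. \<forall>U. open U \<and> x \<in> U \<longrightarrow> 0 < emeasure \<pi> U}"

text \<open>For finite \<open>\<pi>\<close>, balls centred in the support have positive mass, so no quotient below has denominator 0
  or \<open>\<infinity>\<close>.\<close>

definition doubling :: "'a::metric_space measure \<Rightarrow> bool"
  where "doubling \<pi> \<longleftrightarrow> (\<exists>C::real. C > 0 \<and>
    (SUP x\<in>msupp \<pi>. SUP r\<in>{0<..}. emeasure \<pi> (ball x (2 * r)) / emeasure \<pi> (ball x r)) \<le> ennreal C)"

text \<open>A Borel probability measure on \<open>K\<close> has underlying space \<open>K\<close> and the Borel subsets of \<open>K\<close>
  as its measurable sets. The weak topology is the coarsest one for which
  \<open>\<mu> \<mapsto> \<integral> f d\<mu>\<close> is continuous for every bounded continuous \<open>f\<close> on \<open>K\<close>.\<close>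

definition prob_measures_on :: "'a::topological_space set \<Rightarrow> 'a measure set"
  where "prob_measures_on K = space (prob_algebra (restrict_space borel K))"

definition weak_topology_on :: "'a::topological_space set \<Rightarrow> 'a measure topology"
  where "weak_topology_on K = topology_generated_by
    {{\<mu> \<in> prob_measures_on K. (\<integral>x. f x \<partial>\<mu>) \<in> U} | (f :: 'a \<Rightarrow> real) U.
       continuous_on K f \<and> bounded (f ` K) \<and> open U}"

definition typical :: "'a topology \<Rightarrow> ('a \<Rightarrow> bool) \<Rightarrow> bool"
  where "typical X P \<longleftrightarrow>
    (\<exists>G. gdelta_in X G \<and> X closure_of G = topspace X \<and> (\<forall>x\<in>G. P x))"

definition ln_ennreal :: "ennreal \<Rightarrow> ereal"
  where "ln_ennreal a =
    (if a = 0 then -\<infinity> else if a = \<infinity> then \<infinity> else ereal (ln (enn2real a)))"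

text \<open>An at most countable family of centres is a function \<open>x\<close> on an index set \<open>I\<close> of naturals;
  the family is allowed to be finite or empty. For finite \<open>\<pi>\<close> the masses are real, and they are positive because the
  centres lie in the support, so \<open>powr\<close> is the usual power also for \<open>q \<le> 0\<close>.\<close>

definition covering_sum :: "'a::metric_space measure \<Rightarrow> real \<Rightarrow> 'a set \<Rightarrow> real \<Rightarrow> ennreal"
  where "covering_sum \<pi> q E r =
    Inf {(\<Sum>\<^sub>\<infinity>i\<in>I. ennreal (measure \<pi> (ball (x i) r) powr q)) | (I :: nat set) (x :: nat \<Rightarrow> 'a).
           x ` I \<subseteq> msupp \<pi> \<and> E \<subseteq> (\<Union>i\<in>I. ball (x i) r)}"

definition upper_box_dim :: "'a::metric_space measure \<Rightarrow> real \<Rightarrow> 'a set \<Rightarrow> ereal"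
  where "upper_box_dim \<pi> q E =
    Limsup (at_right 0) (\<lambda>r::real. ln_ennreal (covering_sum \<pi> q E r) / ereal (- ln r))"

definition small_upper_dim :: "'a::metric_space measure \<Rightarrow> real \<Rightarrow> 'a measure \<Rightarrow> ereal"
  where "small_upper_dim \<pi> q \<mu> =
    (INF E\<in>{E \<in> sets \<mu>. measure \<mu> E > 0}. upper_box_dim \<pi> q E)"

definition big_upper_dim :: "'a::metric_space measure \<Rightarrow> real \<Rightarrow> 'a measure \<Rightarrow> ereal"
  where "big_upper_dim \<pi> q \<mu> =
    Lim (at_right 0) (\<lambda>\<epsilon>::real. INF E\<in>{E \<in> sets \<mu>. measure \<mu> E > 1 - \<epsilon>}. upper_box_dim \<pi> q E)"

definition local_upper_box_dim :: "'a::metric_space measure \<Rightarrow> real \<Rightarrow> 'a set \<Rightarrow> ereal"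
  where "local_upper_box_dim \<pi> q E =
    (INF x\<in>E. INF r\<in>{0<..}. upper_box_dim \<pi> q (E \<inter> ball x r))"

definition tau_loc :: "'a::metric_space measure \<Rightarrow> real \<Rightarrow> ereal"
  where "tau_loc \<pi> q = local_upper_box_dim \<pi> q (msupp \<pi>)"

definition tau_loc_max :: "'a::metric_space measure \<Rightarrow> real \<Rightarrow> ereal"
  where "tau_loc_max \<pi> q =
    (SUP y\<in>msupp \<pi>. SUP \<rho>\<in>{0<..}. local_upper_box_dim \<pi> q (msupp \<pi> \<inter> ball y \<rho>))"

end

theory Submission
  imports Defs
begin

text \<open>
  The four quantities are controlled by three kinds of conditions on \<open>\<mu>\<close>, each of which holds on a set with dense
  interior in the weak topology.

  \<^item> \<open>\<mu>\<close> charges a given open set that meets \<open>K\<close>. For a measure with full support, the pieces \<open>K \<inter> ball x r\<close> compete in the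
    infimum that defines the small dimension, which is therefore at most \<open>tau_loc\<close>.
  \<^item> \<open>\<mu>\<close> gives mass more than \<open>1 - \<epsilon>\<close> to a given open set that is dense in \<open>K\<close>. For \<open>t\<close> above \<open>tau_loc_max\<close>, the points
    with a neighbourhood of dimension below \<open>t\<close> form such a set (\<open>low_region\<close>); finitely many of these
    neighbourhoods carry most of \<open>\<mu>\<close>, so the big dimension is at most \<open>t\<close>.
  \<^item> \<open>spread\<close>: if every ball around every point of \<open>U \<inter> K\<close> cuts out a piece of \<open>K\<close> of dimension above \<open>t\<close>, then sets with
    mass more than \<open>\<epsilon>\<close> in \<open>U\<close> have covering sums above \<open>r powr - t\<close> at some scale \<open>r < \<epsilon>\<close>. Sets of positive mass in \<open>U\<close> then have
    dimension at least \<open>t\<close>. With \<open>U = UNIV\<close> this bounds the small dimension from below, and with \<open>U\<close> inside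
    the ball that nearly attains the supremum in \<open>tau_loc_max\<close> it bounds the big one, because a set of measure
    close to 1 must meet \<open>U\<close> in positive mass.

  The heart is the density of the third condition (\<open>local_spread_pmf\<close>, \<open>dense_interior_spread\<close>). A measure is first replaced by one with
  finite support (\<open>finite_net_refinement\<close>). Each atom near \<open>U\<close> is then split over a maximal \<open>3 r\<close>-separated set of nearby points \<open>x\<close>, with weights proportional to
  \<open>measure \<pi> (ball x (3 * r)) powr q\<close>. By separation, a ball of radius \<open>r\<close> reaches at most one of these
  points, and by doubling it contributes a comparable amount to a covering sum
  (\<open>covering_sum_ge_separated\<close>). Hence covering a fixed proportion of the weights costs a fixed proportion of the covering sum of
  the whole piece, at a scale where the latter exceeds a power with exponent \<open>- t'\<close> for some \<open>t' > t\<close>. All this survives small weak perturbations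
  (\<open>discrete_on_open_nbhd\<close>).

  Countably many conditions suffice. Sets \<open>U\<close> are taken from a countable basis, the levels \<open>t\<close> and orders \<open>q\<close> are rational, and the equalities extend
  to all real \<open>q\<close> since ball masses are bounded below by a power of the radius, which makes all dimensions
  Lipschitz in \<open>q\<close> with the same constant (\<open>upper_box_dim_Lipschitz\<close>). The intersection is dense by the Baire category theorem:
  the space of probability measures on \<open>K\<close> is compact and Hausdorff. Its compactness comes from Tychonoff's
  theorem and the Riesz representation theorem, which is proved here by Daniell's outer measure and
  Caratheodory's construction.
\<close>

section \<open>Covering sums and upper box dimensions\<close>

lemma ennreal_less_add: "a < top \<Longrightarrow> 0 < e \<Longrightarrow> a < a + ennreal e"
  by (cases a) (auto simp flip: ennreal_plus simp: ennreal_less_iff)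

lemma ennreal_summable_on [simp]: "(f :: 'i \<Rightarrow> ennreal) summable_on I"
  by (rule nonneg_summable_on_complete) simp

lemma sum_le_infsum_ennreal:
  fixes f :: "'i \<Rightarrow> ennreal"
  assumes "finite F" "F \<subseteq> I"
  shows "sum f F \<le> infsum f I"
proof -
  have "infsum f F \<le> infsum f I"
    by (rule infsum_mono_neutral) (use assms in auto)
  then show ?thesis using assms by simp
qed

lemma ln_ennreal_quotient_less_iff:
  fixes r t :: real
  assumes "0 < r" "r < 1"
  shows "ln_ennreal a / ereal (- ln r) < ereal t \<longleftrightarrow> a < ennreal (r powr - t)"
proof -
  have l: "- ln r > 0" using assms by simp
  show ?thesis
  proof (cases a)
    case (real x)
    then show ?thesis
    proof (cases "x = 0")
      case True
      then show ?thesis using real l assms by (auto simp: ln_ennreal_def)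
    next
      case False
      hence x: "x > 0" using real by simp
      have "ln_ennreal a / ereal (- ln r) = ereal (ln x / (- ln r))"
        using real x l by (auto simp: ln_ennreal_def)
      moreover have "ln x / (- ln r) < t \<longleftrightarrow> ln x < t * (- ln r)"
        using l by (rule pos_divide_less_eq)
      moreover have "ln x < t * (- ln r) \<longleftrightarrow> x < r powr - t"
      proof -
        have "x < r powr - t \<longleftrightarrow> ln x < ln (r powr - t)"
          using x assms by (subst ln_less_cancel_iff) auto
        also have "ln (r powr - t) = t * (- ln r)" using assms by (simp add: ln_powr)
        finally show ?thesis by simp
      qed
      ultimately show ?thesis using real x by (simp add: ennreal_less_iff)
    qed
  next
    case top
    then show ?thesis using l by (simp add: ln_ennreal_def)
  qed
qed

lemma ln_ennreal_quotient_greater_iff: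
  fixes r t :: real
  assumes "0 < r" "r < 1"
  shows "ereal t < ln_ennreal a / ereal (- ln r) \<longleftrightarrow> ennreal (r powr - t) < a"
proof -
  have l: "- ln r > 0" using assms by simp
  show ?thesis
  proof (cases a)
    case (real x)
    then show ?thesis
    proof (cases "x = 0")
      case True
      then show ?thesis using real l assms by (auto simp: ln_ennreal_def)
    next
      case False
      hence x: "x > 0" using real by simp
      have "ln_ennreal a / ereal (- ln r) = ereal (ln x / (- ln r))"
        using real x l by (auto simp: ln_ennreal_def)
      moreover have "t < ln x / (- ln r) \<longleftrightarrow> t * (- ln r) < ln x"
        using l by (rule pos_less_divide_eq)
      moreover have "t * (- ln r) < ln x \<longleftrightarrow> r powr - t < x"
      proof -
        have "r powr - t < x \<longleftrightarrow> ln (r powr - t) < ln x"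
          using x assms by (subst ln_less_cancel_iff) auto
        also have "ln (r powr - t) = t * (- ln r)" using assms by (simp add: ln_powr)
        finally show ?thesis by simp
      qed
      ultimately show ?thesis using real x by (simp add: ennreal_less_iff)
    qed
  next
    case top
    then show ?thesis using l by (simp add: ln_ennreal_def)
  qed
qed

lemma eventually_at_right_0_unit: "eventually (\<lambda>r::real. 0 < r \<and> r < 1) (at_right 0)"
  by (rule eventually_at_right_field[THEN iffD2]) (auto intro!: exI[of _ 1])

text \<open>All arguments below compare covering sums with pure powers of the radius. This lemma and the
  following ones translate such comparisons to and from the upper box dimension.\<close>

lemma upper_box_dim_less_imp:
  assumes "upper_box_dim \<pi> q E < ereal t"
  shows "\<forall>\<^sub>F r in at_right 0. covering_sum \<pi> q E r < ennreal (r powr - t)"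
proof -
  have "\<forall>\<^sub>F r in at_right 0. ln_ennreal (covering_sum \<pi> q E r) / ereal (- ln r) < ereal t"
    using assms unfolding upper_box_dim_def by (rule Limsup_lessD)
  then show ?thesis using eventually_at_right_0_unit
    by eventually_elim (auto simp: ln_ennreal_quotient_less_iff)
qed

lemma upper_box_dim_greater_imp:
  assumes "ereal t < upper_box_dim \<pi> q E"
  shows "\<exists>\<^sub>F r in at_right 0. ennreal (r powr - t) < covering_sum \<pi> q E r"
proof (rule ccontr)
  assume "\<not> ?thesis"
  hence "\<forall>\<^sub>F r in at_right 0. \<not> ennreal (r powr - t) < covering_sum \<pi> q E r"
    by (simp add: frequently_def)
  hence "\<forall>\<^sub>F r in at_right 0. ln_ennreal (covering_sum \<pi> q E r) / ereal (- ln r) \<le> ereal t"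
    using eventually_at_right_0_unit
    by eventually_elim (auto simp: ln_ennreal_quotient_greater_iff not_less[symmetric])
  hence "upper_box_dim \<pi> q E \<le> ereal t" unfolding upper_box_dim_def by (rule Limsup_bounded)
  with assms show False by simp
qed

lemma upper_box_dim_geI:
  assumes "\<exists>\<^sub>F r in at_right 0. ennreal (r powr - t) \<le> covering_sum \<pi> q E r"
  shows "ereal t \<le> upper_box_dim \<pi> q E"
proof (rule ccontr)
  assume "\<not> ?thesis"
  hence "\<forall>\<^sub>F r in at_right 0. covering_sum \<pi> q E r < ennreal (r powr - t)"
    by (intro upper_box_dim_less_imp) simp
  with assms show False
    by (auto simp: frequently_def not_le[symmetric])
qed

lemma eventually_const_powr_less:
  fixes C s t :: real
  assumes "s < t"
  shows "\<forall>\<^sub>F r in at_right 0. C * r powr - s < r powr - t"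
proof -
  have "((\<lambda>r::real. C * r powr (t - s)) \<longlongrightarrow> C * 0) (at_right 0)"
    using assms by (intro tendsto_mult tendsto_const tendsto_zero_powrI[where b = "t - s"])
      (auto intro!: tendsto_eq_intros simp: eventually_at_right_less eventually_mono[OF eventually_at_right_less])
  hence "\<forall>\<^sub>F r in at_right 0. C * r powr (t - s) < 1"
    by (rule order_tendstoD) simp
  then show ?thesis using eventually_at_right_0_unit
  proof eventually_elim
    case (elim r)
    have "C * r powr - s = C * r powr (t - s) * r powr - t"
      using elim by (simp add: powr_add[symmetric])
    also have "\<dots> < 1 * r powr - t" using elim by (intro mult_strict_right_mono) auto
    finally show ?case by simp
  qed
qed

text \<open>Constant factors disappear after taking logarithms.\<close>

lemma upper_box_dim_leI:
  assumes "\<forall>\<^sub>F r in at_right 0. covering_sum \<pi> q E r \<le> ennreal (C * r powr - t)"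
  shows "upper_box_dim \<pi> q E \<le> ereal t"
proof (rule ccontr)
  assume "\<not> ?thesis"
  then obtain t' where t': "ereal t < ereal t'" "ereal t' < upper_box_dim \<pi> q E"
    by (metis ereal_dense2 not_le)
  have "\<exists>\<^sub>F r in at_right 0. ennreal (r powr - t') < covering_sum \<pi> q E r"
    by (rule upper_box_dim_greater_imp[OF t'(2)])
  moreover have "\<forall>\<^sub>F r in at_right 0. covering_sum \<pi> q E r \<le> ennreal (r powr - t')"
    using assms eventually_const_powr_less[of t t' C, OF t'(1)[unfolded less_ereal.simps]]
  proof eventually_elim
    case (elim r)
    then show ?case by (meson ennreal_leI less_imp_le order_trans)
  qed
  ultimately show False
    by (auto simp: frequently_def not_le[symmetric])
qed

lemma covering_sum_le:
  fixes I :: "nat set"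
  assumes "x ` I \<subseteq> msupp \<pi>" "E \<subseteq> (\<Union>i\<in>I. ball (x i) r)"
  shows "covering_sum \<pi> q E r \<le> (\<Sum>\<^sub>\<infinity>i\<in>I. ennreal (measure \<pi> (ball (x i) r) powr q))"
  unfolding covering_sum_def by (rule Inf_lower) (use assms in blast)

lemma covering_sum_mono:
  assumes "E \<subseteq> F" shows "covering_sum \<pi> q E r \<le> covering_sum \<pi> q F r"
  unfolding covering_sum_def[of \<pi> q F]
proof (rule Inf_greatest, clarify)
  fix I :: "nat set" and x :: "nat \<Rightarrow> 'a"
  assume "x ` I \<subseteq> msupp \<pi>" "F \<subseteq> (\<Union>i\<in>I. ball (x i) r)"
  then show "covering_sum \<pi> q E r \<le> (\<Sum>\<^sub>\<infinity>i\<in>I. ennreal (measure \<pi> (ball (x i) r) powr q))"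
    using assms by (intro covering_sum_le) auto
qed

lemma upper_box_dim_mono:
  assumes "E \<subseteq> F" shows "upper_box_dim \<pi> q E \<le> upper_box_dim \<pi> q F"
proof (rule ccontr)
  assume "\<not> ?thesis"
  then obtain t where t: "upper_box_dim \<pi> q F < ereal t" "ereal t < upper_box_dim \<pi> q E"
    by (metis ereal_dense2 not_le)
  have "\<forall>\<^sub>F r in at_right 0. covering_sum \<pi> q E r \<le> ennreal (1 * r powr - t)"
    using upper_box_dim_less_imp[OF t(1)]
    by eventually_elim (use covering_sum_mono[OF assms] in \<open>fastforce intro: order_trans less_imp_le\<close>)
  from upper_box_dim_leI[OF this] t(2) show False by simp
qed

lemma covering_sum_le_finite:
  assumes "finite S" "S \<subseteq> msupp \<pi>" "E \<subseteq> (\<Union>x\<in>S. ball x r)"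
  shows "covering_sum \<pi> q E r \<le> ennreal (\<Sum>x\<in>S. measure \<pi> (ball x r) powr q)"
proof -
  obtain x where x: "bij_betw x {..<card S} S"
    using ex_bij_betw_nat_finite[OF assms(1)] by (auto simp: atLeast0LessThan)
  have im: "x ` {..<card S} = S" using x by (simp add: bij_betw_def)
  have "covering_sum \<pi> q E r \<le> (\<Sum>\<^sub>\<infinity>i\<in>{..<card S}. ennreal (measure \<pi> (ball (x i) r) powr q))"
  proof (rule covering_sum_le)
    show "E \<subseteq> (\<Union>i<card S. ball (x i) r)"
    proof
      fix e assume "e \<in> E"
      then obtain y where "y \<in> x ` {..<card S}" "e \<in> ball y r" using assms(3) im by blast
      then show "e \<in> (\<Union>i<card S. ball (x i) r)" by blast
    qed
  qed (use assms(2) im in simp)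
  also have "\<dots> = (\<Sum>i<card S. ennreal (measure \<pi> (ball (x i) r) powr q))" by simp
  also have "\<dots> = (\<Sum>y\<in>S. ennreal (measure \<pi> (ball y r) powr q))"
    by (rule sum.reindex_bij_betw[OF x])
  also have "\<dots> = ennreal (\<Sum>y\<in>S. measure \<pi> (ball y r) powr q)" by simp
  finally show ?thesis .
qed

lemma covering_sum_empty [simp]: "covering_sum \<pi> q {} r = 0"
  using covering_sum_le_finite[of "{}" \<pi> "{}" r q] by simp

lemma covering_sum_lessE:
  assumes "covering_sum \<pi> q E r < a"
  obtains I :: "nat set" and x where "x ` I \<subseteq> msupp \<pi>" "E \<subseteq> (\<Union>i\<in>I. ball (x i) r)"
    "(\<Sum>\<^sub>\<infinity>i\<in>I. ennreal (measure \<pi> (ball (x i) r) powr q)) < a"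
  using assms unfolding covering_sum_def Inf_less_iff by blast

text \<open>Families of centres are indexed by sets of naturals. Two families are merged by moving one to the even and
  the other to the odd indices.\<close>

lemma covering_sum_Un: "covering_sum \<pi> q (E \<union> F) r \<le> covering_sum \<pi> q E r + covering_sum \<pi> q F r"
proof (rule ennreal_le_epsilon)
  fix e :: real assume fin: "covering_sum \<pi> q E r + covering_sum \<pi> q F r < top" and e: "0 < e"
  let ?m = "\<lambda>y. ennreal (measure \<pi> (ball y r) powr q)"
  have "covering_sum \<pi> q E r < covering_sum \<pi> q E r + ennreal (e/2)"
    using fin e by (intro ennreal_less_add) (auto simp: less_top[symmetric] ennreal_add_eq_top)
  then obtain I :: "nat set" and x where I: "x ` I \<subseteq> msupp \<pi>" "E \<subseteq> (\<Union>i\<in>I. ball (x i) r)"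
    "(\<Sum>\<^sub>\<infinity>i\<in>I. ?m (x i)) < covering_sum \<pi> q E r + ennreal (e/2)"
    by (rule covering_sum_lessE)
  have "covering_sum \<pi> q F r < covering_sum \<pi> q F r + ennreal (e/2)"
    using fin e by (intro ennreal_less_add) (auto simp: less_top[symmetric] ennreal_add_eq_top)
  then obtain J :: "nat set" and y where J: "y ` J \<subseteq> msupp \<pi>" "F \<subseteq> (\<Union>i\<in>J. ball (y i) r)"
    "(\<Sum>\<^sub>\<infinity>i\<in>J. ?m (y i)) < covering_sum \<pi> q F r + ennreal (e/2)"
    by (rule covering_sum_lessE)
  define z where "z n = (if even n then x (n div 2) else y (n div 2))" for n
  define I' where "I' = (\<lambda>n. 2 * n) ` I"
  define J' where "J' = (\<lambda>n. 2 * n + 1) ` J"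
  have zI: "z ` I' = x ` I" and zJ: "z ` J' = y ` J"
    unfolding I'_def J'_def image_image by (simp_all add: z_def)
  have U: "(\<Union>n\<in>I' \<union> J'. ball (z n) r) = (\<Union>n\<in>I. ball (x n) r) \<union> (\<Union>n\<in>J. ball (y n) r)"
    by (auto simp: I'_def J'_def z_def)
  have "covering_sum \<pi> q (E \<union> F) r \<le> (\<Sum>\<^sub>\<infinity>n\<in>I' \<union> J'. ?m (z n))"
    by (rule covering_sum_le) (use I J U in \<open>auto simp: image_Un zI zJ\<close>)
  also have "\<dots> = (\<Sum>\<^sub>\<infinity>n\<in>I'. ?m (z n)) + (\<Sum>\<^sub>\<infinity>n\<in>J'. ?m (z n))"
    by (intro infsum_Un_disjoint) (auto simp: I'_def J'_def, presburger)
  also have "(\<Sum>\<^sub>\<infinity>n\<in>I'. ?m (z n)) = (\<Sum>\<^sub>\<infinity>i\<in>I. ?m (x i))"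
    unfolding I'_def by (subst infsum_reindex) (auto simp: inj_on_def z_def o_def)
  also have "(\<Sum>\<^sub>\<infinity>n\<in>J'. ?m (z n)) = (\<Sum>\<^sub>\<infinity>i\<in>J. ?m (y i))"
    unfolding J'_def by (subst infsum_reindex) (auto simp: inj_on_def z_def o_def)
  also have "(\<Sum>\<^sub>\<infinity>i\<in>I. ?m (x i)) + (\<Sum>\<^sub>\<infinity>i\<in>J. ?m (y i))
      \<le> (covering_sum \<pi> q E r + ennreal (e/2)) + (covering_sum \<pi> q F r + ennreal (e/2))"
    using I(3) J(3) by (intro add_mono less_imp_le)
  also have "\<dots> = covering_sum \<pi> q E r + covering_sum \<pi> q F r + (ennreal (e/2) + ennreal (e/2))"
    by (simp add: ac_simps)
  also have "ennreal (e/2) + ennreal (e/2) = ennreal e"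
    using e by (subst ennreal_plus[symmetric]) auto
  finally show "covering_sum \<pi> q (E \<union> F) r \<le> covering_sum \<pi> q E r + covering_sum \<pi> q F r + ennreal e" .
qed

text \<open>The number of sets is a constant factor in the covering sums.\<close>

lemma upper_box_dim_UN_le:
  assumes "finite I" "\<And>i. i \<in> I \<Longrightarrow> upper_box_dim \<pi> q (A i) < ereal t"
  shows "upper_box_dim \<pi> q (\<Union>i\<in>I. A i) \<le> ereal t"
proof (rule upper_box_dim_leI)
  have N: "covering_sum \<pi> q (\<Union>i\<in>I. A i) r \<le> (\<Sum>i\<in>I. covering_sum \<pi> q (A i) r)" for r
    using assms(1)
  proof induction
    case (insert i I)
    have "covering_sum \<pi> q (\<Union>i\<in>insert i I. A i) r \<le> covering_sum \<pi> q (A i) r + covering_sum \<pi> q (\<Union>i\<in>I. A i) r"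
      using covering_sum_Un[of \<pi> q "A i"] by simp
    also have "\<dots> \<le> (\<Sum>i\<in>insert i I. covering_sum \<pi> q (A i) r)"
      using insert by (simp add: add_left_mono)
    finally show ?case .
  qed simp
  have "\<forall>\<^sub>F r in at_right 0. \<forall>i\<in>I. covering_sum \<pi> q (A i) r < ennreal (r powr - t)"
    using assms by (intro eventually_ball_finite ballI upper_box_dim_less_imp)
  then show "\<forall>\<^sub>F r in at_right 0. covering_sum \<pi> q (\<Union>i\<in>I. A i) r \<le> ennreal (real (card I) * r powr - t)"
  proof eventually_elim
    case (elim r)
    note N[of r]
    also have "(\<Sum>i\<in>I. covering_sum \<pi> q (A i) r) \<le> (\<Sum>i\<in>I. ennreal (r powr - t))"
      using elim by (intro sum_mono less_imp_le) auto
    also have "\<dots> = ennreal (real (card I) * r powr - t)"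
      by (simp add: ennreal_of_nat_eq_real_of_nat ennreal_mult')
    finally show ?case .
  qed
qed

lemma infsum_cmult_le_ennreal:
  fixes f :: "'i \<Rightarrow> ennreal"
  shows "(\<Sum>\<^sub>\<infinity>i\<in>I. c * f i) \<le> c * infsum f I"
proof (rule infsum_le_finite_sums)
  fix F assume F: "finite F" "F \<subseteq> I"
  have "(\<Sum>i\<in>F. c * f i) = c * sum f F" by (simp add: sum_distrib_left)
  also have "\<dots> \<le> c * infsum f I"
    using F by (intro mult_left_mono sum_le_infsum_ennreal) auto
  finally show "(\<Sum>i\<in>F. c * f i) \<le> c * infsum f I" .
qed simp

text \<open>If balls of radius \<open>r\<close> have mass between \<open>c r\<^sup>s\<close> and 1, changing the exponent by \<open>h\<close> changes
  every summand by a factor of at most \<open>(c r\<^sup>s) powr - \<bar>h\<bar>\<close>.\<close>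

lemma upper_box_dim_Lipschitz:
  assumes c: "c > 0" and "prob_space \<pi>"
    and mass: "\<And>x r. x \<in> msupp \<pi> \<Longrightarrow> 0 < r \<Longrightarrow> r < 1 \<Longrightarrow> c * r powr s \<le> measure \<pi> (ball x r)"
  shows "upper_box_dim \<pi> q' E \<le> upper_box_dim \<pi> q E + ereal (s * \<bar>q' - q\<bar>)"
proof -
  interpret prob_space \<pi> by fact
  let ?h = "\<bar>q' - q\<bar>"
  have cs: "covering_sum \<pi> q' E r \<le> ennreal ((c * r powr s) powr - ?h) * a"
    if r: "0 < r" "r < 1" and a: "covering_sum \<pi> q E r < a" for r a
  proof -
    obtain I :: "nat set" and x where I: "x ` I \<subseteq> msupp \<pi>" "E \<subseteq> (\<Union>i\<in>I. ball (x i) r)"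
      "(\<Sum>\<^sub>\<infinity>i\<in>I. ennreal (measure \<pi> (ball (x i) r) powr q)) < a"
      using a by (rule covering_sum_lessE)
    let ?k = "(c * r powr s) powr - ?h"
    have "ennreal (measure \<pi> (ball (x i) r) powr q') \<le> ennreal ?k * ennreal (measure \<pi> (ball (x i) r) powr q)"
      if "i \<in> I" for i
    proof -
      let ?m = "measure \<pi> (ball (x i) r)"
      have m: "c * r powr s \<le> ?m" "?m \<le> 1" and pos: "0 < c * r powr s"
        using mass[of "x i" r] r c I(1) that by auto
      have "?m powr (q' - q) \<le> ?m powr - ?h"
        using m pos by (intro powr_mono') auto
      also have "\<dots> \<le> ?k" using m pos by (intro powr_mono2') auto
      finally have "?m powr (q' - q) * ?m powr q \<le> ?k * ?m powr q" by (rule mult_right_mono) simp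
      then show ?thesis by (simp add: powr_add[symmetric] ennreal_mult[symmetric] ennreal_leI)
    qed
    hence "(\<Sum>\<^sub>\<infinity>i\<in>I. ennreal (measure \<pi> (ball (x i) r) powr q'))
       \<le> (\<Sum>\<^sub>\<infinity>i\<in>I. ennreal ?k * ennreal (measure \<pi> (ball (x i) r) powr q))"
      by (intro infsum_mono) auto
    also have "\<dots> \<le> ennreal ?k * (\<Sum>\<^sub>\<infinity>i\<in>I. ennreal (measure \<pi> (ball (x i) r) powr q))"
      by (rule infsum_cmult_le_ennreal)
    also have "\<dots> \<le> ennreal ?k * a" using I(3) by (intro mult_left_mono) auto
    finally show ?thesis using covering_sum_le[OF I(1,2), of q'] by (rule order_trans[rotated])
  qed
  show ?thesis
  proof (rule ccontr)
    assume "\<not> ?thesis"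
    hence "upper_box_dim \<pi> q E < upper_box_dim \<pi> q' E - ereal (s * ?h)"
      by (simp add: ereal_less_minus_iff not_le)
    then obtain t where t: "upper_box_dim \<pi> q E < ereal t" "ereal t < upper_box_dim \<pi> q' E - ereal (s * ?h)"
      by (metis ereal_dense2)
    have "\<forall>\<^sub>F r in at_right 0. covering_sum \<pi> q' E r \<le> ennreal (c powr - ?h * r powr - (t + s * ?h))"
      using upper_box_dim_less_imp[OF t(1)] eventually_at_right_0_unit
    proof eventually_elim
      case (elim r)
      have "covering_sum \<pi> q' E r \<le> ennreal ((c * r powr s) powr - ?h) * ennreal (r powr - t)"
        using elim by (intro cs) auto
      also have "\<dots> = ennreal ((c * r powr s) powr - ?h * r powr - t)"
        by (simp add: ennreal_mult)
      also have "(c * r powr s) powr - ?h * r powr - t = c powr - ?h * r powr - (t + s * ?h)"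
        using c elim by (simp add: powr_mult powr_powr powr_add[symmetric] algebra_simps)
      finally show ?case .
    qed
    hence "upper_box_dim \<pi> q' E \<le> ereal (t + s * ?h)" by (rule upper_box_dim_leI)
    with t(2) show False by (simp add: ereal_less_minus_iff)
  qed
qed

section \<open>Probability measures on a compact set\<close>

lemma prob_measures_onD:
  assumes "\<mu> \<in> prob_measures_on K"
  shows "prob_space \<mu>" "sets \<mu> = sets (restrict_space borel K)" "space \<mu> = K"
  using assms sets_eq_imp_space_eq[of \<mu> "restrict_space borel K"]
  by (auto simp: prob_measures_on_def space_prob_algebra space_restrict_space)

lemma sets_prob_measures_on_iff:
  "\<mu> \<in> prob_measures_on K \<Longrightarrow> A \<in> sets \<mu> \<longleftrightarrow> (\<exists>B\<in>sets borel. A = B \<inter> K)"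
  by (auto simp: prob_measures_onD sets_restrict_space)

lemma continuous_on_compact_imp_integrable:
  fixes f :: "'a::metric_space \<Rightarrow> real"
  assumes "compact K" "\<mu> \<in> prob_measures_on K" "continuous_on K f"
  shows "integrable \<mu> f"
proof -
  interpret prob_space \<mu> by (rule prob_measures_onD[OF assms(2)])
  obtain M where "\<And>x. x \<in> K \<Longrightarrow> \<bar>f x\<bar> \<le> M"
    using compact_imp_bounded[OF compact_continuous_image[OF assms(3,1)]] by (auto simp: bounded_iff)
  moreover have "f \<in> borel_measurable \<mu>"
    using borel_measurable_continuous_on_restrict[OF assms(3)] prob_measures_onD(2)[OF assms(2)]
    by (simp cong: measurable_cong_sets)
  ultimately show ?thesis
    by (intro integrable_const_bound[of _ M]) (auto simp: prob_measures_onD(3)[OF assms(2)] intro!: AE_I2)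
qed

section \<open>Riesz representation of positive functionals\<close>

text \<open>The functions are truncated multiples of the distance to \<open>- U\<close>. The case \<open>U = UNIV\<close> is separate because
  \<open>infdist x {} = 0\<close>. They start with 0, so their increments telescope to the indicator.\<close>

lemma open_indicator_approximation:
  fixes U :: "'a::metric_space set"
  assumes "open U"
  obtains \<phi> :: "nat \<Rightarrow> 'a \<Rightarrow> real" where
    "\<And>k. continuous_on UNIV (\<phi> k)" "\<And>k x. 0 \<le> \<phi> k x" "\<And>k x. \<phi> k x \<le> 1" "\<And>k x. x \<notin> U \<Longrightarrow> \<phi> k x = 0"
    "\<And>k x. \<phi> k x \<le> \<phi> (Suc k) x" "\<And>x. \<phi> 0 x = 0" "\<And>x. (\<lambda>k. \<phi> k x) \<longlonglongrightarrow> indicator U x"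
proof (cases "U = UNIV")
  case True
  show thesis
  proof (rule that[of "\<lambda>k x. if k = 0 then 0 else 1"])
    show "(\<lambda>k::nat. if k = 0 then 0 else 1::real) \<longlonglongrightarrow> indicator U x" for x
      using True by (intro tendsto_eventually eventually_sequentiallyI[of 1]) auto
  qed (use True in auto)
next
  case False
  show thesis
  proof (rule that[of "\<lambda>k x. min 1 (real k * infdist x (- U))"])
    fix x
    show "(\<lambda>k. min 1 (real k * infdist x (- U))) \<longlonglongrightarrow> indicator U x"
    proof (cases "x \<in> U")
      case True
      have "infdist x (- U) > 0"
        using assms False True by (intro infdist_pos_not_in_closed) (auto simp: closed_Compl)
      then obtain N where N: "1 < real N * infdist x (- U)" using reals_Archimedean3 by blast
      have "min 1 (real k * infdist x (- U)) = 1" if "k \<ge> N" for k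
        using N mult_right_mono[of "real N" "real k" "infdist x (- U)"] that infdist_nonneg[of x "- U"] by auto
      then show ?thesis using True by (intro tendsto_eventually eventually_sequentiallyI[of N]) auto
    qed auto
    show "min 1 (real k * infdist x (- U)) \<le> min 1 (real (Suc k) * infdist x (- U))" for k
      using infdist_nonneg[of x "- U"] by (intro min.mono mult_right_mono) auto
  qed (auto intro!: continuous_intros simp: infdist_nonneg)
qed

text \<open>A nonnegative number is cut into slices of height 1; applied to a function, each slice majorizes the indicator
  of a superlevel set.\<close>

lemma sum_unit_slices:
  fixes y :: real
  assumes "0 \<le> y"
  shows "(\<Sum>i<N. max 0 (min 1 (y - real i))) = min y (real N)"
  using assms by (induction N) auto

text \<open>The functional is a total function on \<open>'a \<Rightarrow> real\<close>, while linearity and positivity are asked for functions continuous on \<open>K\<close>.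
  Its values on these depend only on the restriction to \<open>K\<close>, by monotonicity.\<close>

locale positive_functional =
  fixes K :: "'a::metric_space set" and L :: "('a \<Rightarrow> real) \<Rightarrow> real"
  assumes K: "compact K"
    and add: "\<And>f g. continuous_on K f \<Longrightarrow> continuous_on K g \<Longrightarrow> L (\<lambda>x. f x + g x) = L f + L g"
    and scale: "\<And>c f. continuous_on K f \<Longrightarrow> L (\<lambda>x. c * f x) = c * L f"
    and pos: "\<And>f. continuous_on K f \<Longrightarrow> (\<And>x. x \<in> K \<Longrightarrow> 0 \<le> f x) \<Longrightarrow> 0 \<le> L f"
    and one: "L (\<lambda>_. 1) = 1"
begin

lemma mono:
  assumes "continuous_on K f" "continuous_on K g" "\<And>x. x \<in> K \<Longrightarrow> f x \<le> g x"
  shows "L f \<le> L g"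
proof -
  have c: "continuous_on K (\<lambda>x. (-1) * f x)" using assms by (intro continuous_intros)
  have "0 \<le> L (\<lambda>x. g x + (-1) * f x)"
    using assms by (intro pos) (auto intro!: continuous_intros)
  also have "\<dots> = L g + (-1) * L f" using add[OF assms(2) c] scale[OF assms(1), of "-1"] by simp
  finally show ?thesis by simp
qed

lemma zero: "L (\<lambda>_. 0) = 0"
  using scale[of "\<lambda>_. 1" 0] by simp

lemma sum:
  assumes "\<And>i. i < (N::nat) \<Longrightarrow> continuous_on K (f i)"
  shows "L (\<lambda>x. \<Sum>i<N. f i x) = (\<Sum>i<N. L (f i))"
  using assms
proof (induction N)
  case (Suc N)
  have "L (\<lambda>x. (\<Sum>i<N. f i x) + f N x) = L (\<lambda>x. \<Sum>i<N. f i x) + L (f N)"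
    using Suc.prems by (intro add) (auto intro!: continuous_intros)
  then show ?case using Suc by simp
qed (simp add: zero)

definition majorant :: "'a set \<Rightarrow> (nat \<Rightarrow> 'a \<Rightarrow> real) \<Rightarrow> bool" where
  "majorant A F \<longleftrightarrow> (\<forall>n. continuous_on K (F n) \<and> (\<forall>x\<in>K. 0 \<le> F n x)) \<and> (\<forall>x\<in>A. 1 \<le> (\<Sum>n. ennreal (F n x)))"

text \<open>The Daniell outer measure of the functional.\<close>

definition outer :: "'a set \<Rightarrow> ennreal" where
  "outer A = (INF F\<in>Collect (majorant A). \<Sum>n. ennreal (L (F n)))"

lemma outer_le: "majorant A F \<Longrightarrow> outer A \<le> (\<Sum>n. ennreal (L (F n)))"
  unfolding outer_def by (rule INF_lower) simp

lemma outer_le_functional: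
  assumes f: "continuous_on K f" "\<And>x. x \<in> K \<Longrightarrow> 0 \<le> f x" "\<And>x. x \<in> A \<Longrightarrow> 1 \<le> f x"
  shows "outer A \<le> ennreal (L f)"
proof -
  define F where "F n = (if n = (0::nat) then f else (\<lambda>_. 0))" for n
  have "(\<Sum>n. ennreal (F n x)) = ennreal (f x)" for x
    by (subst suminf_finite[of "{0::nat}"]) (auto simp: F_def)
  hence "majorant A F"
    using f by (auto simp: majorant_def F_def intro!: continuous_intros)
  hence "outer A \<le> (\<Sum>n. ennreal (L (F n)))" by (rule outer_le)
  also have "\<dots> = ennreal (L f)"
    by (subst suminf_finite[of "{0::nat}"]) (auto simp: F_def zero)
  finally show ?thesis .
qed

lemma outer_le_double_sum:
  assumes "\<And>i n. continuous_on K (G i n)" "\<And>i n x. x \<in> K \<Longrightarrow> 0 \<le> G i n x"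
    and "\<And>x. x \<in> A \<Longrightarrow> 1 \<le> (\<Sum>i. \<Sum>n. ennreal (G i n x))"
  shows "outer A \<le> (\<Sum>i. \<Sum>n. ennreal (L (G i n)))"
proof -
  define F where "F k = G (fst (prod_decode k)) (snd (prod_decode k))" for k
  have "(\<Sum>k. ennreal (F k x)) = (\<Sum>i. \<Sum>n. ennreal (G i n x))" for x
    unfolding F_def using suminf_ennreal_2dimen[of "\<lambda>i. \<Sum>n. ennreal (G i n x)" "\<lambda>(i, n). ennreal (G i n x)"]
    by (simp add: case_prod_beta)
  hence "majorant A F" using assms unfolding majorant_def F_def by auto
  hence "outer A \<le> (\<Sum>k. ennreal (L (F k)))" by (rule outer_le)
  also have "\<dots> = (\<Sum>i. \<Sum>n. ennreal (L (G i n)))"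
    unfolding F_def using suminf_ennreal_2dimen[of "\<lambda>i. \<Sum>n. ennreal (L (G i n))" "\<lambda>(i, n). ennreal (L (G i n))"]
    by (simp add: case_prod_beta)
  finally show ?thesis .
qed

lemma outer_measure_space_outer: "outer_measure_space (Pow K) outer"
  unfolding outer_measure_space_def
proof (intro conjI)
  have "outer {} \<le> 0" using outer_le_functional[of "\<lambda>_. 0" "{}"] zero by simp
  then show "positive (Pow K) outer" by (simp add: positive_def)
  show "increasing (Pow K) outer"
    unfolding increasing_def
  proof (intro ballI impI)
    fix A B :: "'a set" assume "A \<subseteq> B"
    then show "outer A \<le> outer B"
      unfolding outer_def majorant_def by (intro INF_superset_mono Collect_mono) blast+
  qed
  show "countably_subadditive (Pow K) outer"
    unfolding countably_subadditive_def
  proof (intro allI impI)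
    fix A :: "nat \<Rightarrow> 'a set" assume A: "range A \<subseteq> Pow K"
    show "outer (\<Union>i. A i) \<le> (\<Sum>i. outer (A i))"
    proof (rule ennreal_le_epsilon)
      fix e :: real assume fin: "(\<Sum>i. outer (A i)) < top" and e: "0 < e"
      have "\<exists>F. majorant (A i) F \<and> (\<Sum>n. ennreal (L (F n))) < outer (A i) + ennreal (e * (1/2) ^ Suc i)" for i
      proof -
        have "outer (A i) < top"
          using fin ennreal_suminf_lessD by blast
        hence "outer (A i) < outer (A i) + ennreal (e * (1/2) ^ Suc i)"
          using e by (intro ennreal_less_add) simp_all
        then show ?thesis unfolding outer_def[of "A i"] INF_less_iff by auto
      qed
      then obtain F where F: "\<And>i. majorant (A i) (F i)"
        "\<And>i. (\<Sum>n. ennreal (L (F i n))) < outer (A i) + ennreal (e * (1/2) ^ Suc i)" by metis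
      have "outer (\<Union>i. A i) \<le> (\<Sum>i. \<Sum>n. ennreal (L (F i n)))"
      proof (rule outer_le_double_sum)
        fix x assume "x \<in> (\<Union>i. A i)"
        then obtain i where "x \<in> A i" by blast
        hence "1 \<le> (\<Sum>n. ennreal (F i n x))" using F(1) by (auto simp: majorant_def)
        also have "\<dots> = (\<Sum>j\<in>{i}. \<Sum>n. ennreal (F j n x))" by simp
        also have "\<dots> \<le> (\<Sum>j. \<Sum>n. ennreal (F j n x))" by (intro sum_le_suminf) auto
        finally show "1 \<le> (\<Sum>j. \<Sum>n. ennreal (F j n x))" .
      qed (use F(1) in \<open>auto simp: majorant_def\<close>)
      also have "\<dots> \<le> (\<Sum>i. outer (A i) + ennreal (e * (1/2) ^ Suc i))"
        using F(2) by (intro suminf_le less_imp_le) auto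
      also have "\<dots> = (\<Sum>i. outer (A i)) + (\<Sum>i. ennreal (e * (1/2) ^ Suc i))"
        by (subst suminf_add) auto
      also have "(\<Sum>i. ennreal (e * (1/2) ^ Suc i)) = ennreal e"
        using e sums_mult[OF power_half_series, of e] by (intro suminf_ennreal_eq) auto
      finally show "outer (\<Union>i. A i) \<le> (\<Sum>i. outer (A i)) + ennreal e" .
    qed
  qed
qed

text \<open>Splitting a majorant of \<open>A\<close> by an increasing sequence of continuous functions with limit the indicator
  of \<open>U\<close> gives majorants of both \<open>A \<inter> U\<close> and \<open>A - U\<close>.\<close>

lemma open_in_lambda_system:
  assumes U: "open U"
  shows "U \<inter> K \<in> lambda_system K (Pow K) outer"
proof -
  interpret sigma_algebra K "Pow K" by (rule sigma_algebra_Pow)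
  have split: "outer (A \<inter> U) + outer (A - U) \<le> outer A" if A: "A \<subseteq> K" for A
    unfolding outer_def[of A]
  proof (rule INF_greatest)
    fix F assume "F \<in> Collect (majorant A)"
    hence F: "\<And>n. continuous_on K (F n)" "\<And>n x. x \<in> K \<Longrightarrow> 0 \<le> F n x" "\<And>x. x \<in> A \<Longrightarrow> 1 \<le> (\<Sum>n. ennreal (F n x))"
      by (auto simp: majorant_def)
    obtain \<phi> :: "nat \<Rightarrow> 'a \<Rightarrow> real" where
      \<phi>: "\<And>k. continuous_on UNIV (\<phi> k)" "\<And>k x. 0 \<le> \<phi> k x" "\<And>k x. \<phi> k x \<le> 1" "\<And>k x. x \<notin> U \<Longrightarrow> \<phi> k x = 0"
        "\<And>k x. \<phi> k x \<le> \<phi> (Suc k) x" "\<And>x. \<phi> 0 x = 0" "\<And>x. (\<lambda>k. \<phi> k x) \<longlonglongrightarrow> indicator U x"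
      using open_indicator_approximation[OF U] by metis
    have c: "continuous_on K (\<phi> k)" for k by (rule continuous_on_subset[OF \<phi>(1)]) simp
    have Lnn: "0 \<le> L (\<lambda>x. F n x * \<phi> k x)" for n k
      using F \<phi> c by (intro pos) (auto intro!: continuous_intros)
    define G where "G k n x = F n x * (\<phi> (Suc k) x - \<phi> k x)" for k n x
    have Gc: "continuous_on K (G k n)" for k n unfolding G_def using F c by (intro continuous_intros)
    have Gnn: "0 \<le> G k n x" if "x \<in> K" for k n x using F(2) \<phi>(5) that by (simp add: G_def)
    have inner: "outer (A \<inter> U) \<le> (\<Sum>k. \<Sum>n. ennreal (L (G k n)))"
    proof (rule outer_le_double_sum)
      fix x assume x: "x \<in> A \<inter> U"
      have "(\<lambda>k. \<phi> (Suc k) x - \<phi> k x) sums (1 - 0)"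
        using telescope_sums[OF \<phi>(7)[of x]] x \<phi>(6) by simp
      hence "1 = (\<Sum>k. ennreal (\<phi> (Suc k) x - \<phi> k x))"
        using \<phi>(5) by (subst suminf_ennreal_eq) auto
      also have "\<dots> = (\<Sum>k. ennreal (\<phi> (Suc k) x - \<phi> k x) * 1)" by simp
      also have "\<dots> \<le> (\<Sum>k. ennreal (\<phi> (Suc k) x - \<phi> k x) * (\<Sum>n. ennreal (F n x)))"
        using F(3) x by (intro suminf_le mult_left_mono) auto
      also have "\<dots> = (\<Sum>k. \<Sum>n. ennreal (\<phi> (Suc k) x - \<phi> k x) * ennreal (F n x))" by simp
      also have "\<dots> = (\<Sum>k. \<Sum>n. ennreal (G k n x))"
        using F(2) \<phi>(5) x A unfolding G_def by (subst ennreal_mult[symmetric]) (auto simp: mult.commute)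
      finally show "1 \<le> (\<Sum>k. \<Sum>n. ennreal (G k n x))" .
    qed (use Gc Gnn in auto)
    have partial: "(\<Sum>k<N. \<Sum>n. ennreal (L (G k n))) = (\<Sum>n. ennreal (L (\<lambda>x. F n x * \<phi> N x)))" for N
    proof (induction N)
      case 0
      then show ?case using \<phi>(6) by (simp add: zero)
    next
      case (Suc N)
      have eq: "L (\<lambda>x. F n x * \<phi> N x) + L (G N n) = L (\<lambda>x. F n x * \<phi> (Suc N) x)" for n
      proof -
        have "L (\<lambda>x. F n x * \<phi> N x + G N n x) = L (\<lambda>x. F n x * \<phi> N x) + L (G N n)"
          using F c Gc by (intro add continuous_intros) auto
        moreover have "(\<lambda>x. F n x * \<phi> N x + G N n x) = (\<lambda>x. F n x * \<phi> (Suc N) x)"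
          by (simp add: G_def algebra_simps)
        ultimately show ?thesis by simp
      qed
      have "(\<Sum>k<Suc N. \<Sum>n. ennreal (L (G k n)))
          = (\<Sum>n. ennreal (L (\<lambda>x. F n x * \<phi> N x)) + ennreal (L (G N n)))"
        using Suc by (simp add: suminf_add)
      also have "\<dots> = (\<Sum>n. ennreal (L (\<lambda>x. F n x * \<phi> (Suc N) x)))"
        using Lnn pos[OF Gc Gnn] by (subst ennreal_plus[symmetric]) (auto simp: eq)
      finally show ?case .
    qed
    have "(\<Sum>k. \<Sum>n. ennreal (L (G k n))) + outer (A - U) \<le> (\<Sum>n. ennreal (L (F n)))"
    proof (rule ennreal_suminf_bound_add)
      fix N
      have "outer (A - U) \<le> (\<Sum>n. ennreal (L (\<lambda>x. F n x * (1 - \<phi> N x))))"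
        by (rule outer_le) (use F \<phi> c in \<open>auto simp: majorant_def intro!: continuous_intros mult_nonneg_nonneg\<close>)
      hence "(\<Sum>k<N. \<Sum>n. ennreal (L (G k n))) + outer (A - U)
        \<le> (\<Sum>n. ennreal (L (\<lambda>x. F n x * \<phi> N x))) + (\<Sum>n. ennreal (L (\<lambda>x. F n x * (1 - \<phi> N x))))"
        unfolding partial by (rule add_left_mono)
      also have "\<dots> = (\<Sum>n. ennreal (L (\<lambda>x. F n x * \<phi> N x)) + ennreal (L (\<lambda>x. F n x * (1 - \<phi> N x))))"
        by (subst suminf_add) auto
      also have "\<dots> = (\<Sum>n. ennreal (L (F n)))"
      proof (rule suminf_cong)
        fix n
        have "0 \<le> L (\<lambda>x. F n x * (1 - \<phi> N x))"
          using F \<phi> c by (intro pos) (auto intro!: continuous_intros mult_nonneg_nonneg)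
        moreover have "L (\<lambda>x. F n x * \<phi> N x + F n x * (1 - \<phi> N x))
            = L (\<lambda>x. F n x * \<phi> N x) + L (\<lambda>x. F n x * (1 - \<phi> N x))"
          using F c by (intro add continuous_intros) auto
        moreover have "(\<lambda>x. F n x * \<phi> N x + F n x * (1 - \<phi> N x)) = F n" by (simp add: algebra_simps)
        ultimately show "ennreal (L (\<lambda>x. F n x * \<phi> N x)) + ennreal (L (\<lambda>x. F n x * (1 - \<phi> N x))) = ennreal (L (F n))"
          using Lnn by (subst ennreal_plus[symmetric]) auto
      qed
      finally show "(\<Sum>k<N. \<Sum>n. ennreal (L (G k n))) + outer (A - U) \<le> (\<Sum>n. ennreal (L (F n)))" .
    qed
    with inner show "outer (A \<inter> U) + outer (A - U) \<le> (\<Sum>n. ennreal (L (F n)))"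
      by (meson add_right_mono order_trans)
  qed
  have sub: "subadditive (Pow K) outer"
    using outer_measure_space_outer countably_subadditive_subadditive by (auto simp: outer_measure_space_def)
  show ?thesis
    unfolding lambda_system_eq
  proof (intro CollectI conjI ballI)
    fix A assume "A \<in> Pow K"
    hence A: "A \<subseteq> K" by simp
    have "outer A \<le> outer (A \<inter> U) + outer (A - U)"
      using subadditiveD[OF sub, of "A \<inter> U" "A - U"] A by (auto simp: Int_Diff_Un)
    with split[OF A] have "outer (A \<inter> U) + outer (A - U) = outer A" by simp
    moreover have "A \<inter> (U \<inter> K) = A \<inter> U" "A - U \<inter> K = A - U" using A by auto
    ultimately show "outer (A \<inter> (U \<inter> K)) + outer (A - U \<inter> K) = outer A" by simp
  qed auto
qed

text \<open>As in Dini's theorem, compactness turns a pointwise infinite majorant of 1 into a finite one, up to \<open>e\<close>.\<close>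

lemma outer_space: "outer K = 1"
proof (rule antisym)
  show "outer K \<le> 1" using outer_le_functional[of "\<lambda>_. 1" K] one by simp
  show "1 \<le> outer K"
    unfolding outer_def
  proof (rule INF_greatest)
    fix F assume "F \<in> Collect (majorant K)"
    hence F: "\<And>n. continuous_on K (F n)" "\<And>n x. x \<in> K \<Longrightarrow> 0 \<le> F n x" "\<And>x. x \<in> K \<Longrightarrow> 1 \<le> (\<Sum>n. ennreal (F n x))"
      by (auto simp: majorant_def)
    have Lnn: "0 \<le> L (F n)" for n using F by (intro pos) auto
    have approx: "ennreal (1 - e) \<le> (\<Sum>n. ennreal (L (F n)))" if e: "0 < e" "e < 1" for e
    proof -
      \<comment> \<open>By compactness, some finite partial sum already exceeds \<open>1 - e\<close> everywhere on \<open>K\<close>.\<close>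
      have "\<exists>N. \<forall>x\<in>K. 1 - e \<le> (\<Sum>n<N. F n x)"
      proof (rule ccontr)
        assume "\<not> ?thesis"
        then obtain x where x: "\<And>N. x N \<in> K" "\<And>N. (\<Sum>n<N. F n (x N)) < 1 - e"
          by (metis not_le)
        obtain l r where l: "l \<in> K" "strict_mono r" "(x \<circ> r) \<longlonglongrightarrow> l"
          using K x(1) unfolding compact_def by metis
        have "(\<Sum>n<M. F n l) \<le> 1 - e" for M
        proof (rule LIMSEQ_le_const2)
          have "continuous_on K (\<lambda>y. \<Sum>n<M. F n y)" using F by (intro continuous_intros)
          hence "((\<lambda>y. \<Sum>n<M. F n y) \<circ> (x \<circ> r)) \<longlonglongrightarrow> (\<Sum>n<M. F n l)"
            using l x(1) unfolding continuous_on_sequentially by fastforce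
          then show "(\<lambda>k. \<Sum>n<M. F n (x (r k))) \<longlonglongrightarrow> (\<Sum>n<M. F n l)" by (simp add: o_def)
          have "(\<Sum>n<M. F n (x (r k))) \<le> 1 - e" if "k \<ge> M" for k
          proof -
            have "M \<le> r k" using that seq_suble[OF l(2), of k] by simp
            hence "(\<Sum>n<M. F n (x (r k))) \<le> (\<Sum>n<r k. F n (x (r k)))"
              using F(2) x(1) by (intro sum_mono2) auto
            with x(2)[of "r k"] show ?thesis by simp
          qed
          then show "\<exists>N. \<forall>k\<ge>N. (\<Sum>n<M. F n (x (r k))) \<le> 1 - e" by blast
        qed
        hence "(\<Sum>n<M. ennreal (F n l)) \<le> ennreal (1 - e)" for M
          using F(2) l(1) by (simp add: sum_ennreal ennreal_leI)
        hence "(\<Sum>n. ennreal (F n l)) \<le> ennreal (1 - e)"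
          by (intro suminf_le_const) auto
        with F(3)[OF l(1)] have "1 \<le> ennreal (1 - e)" by (rule order_trans)
        with e show False by simp
      qed
      then obtain N where N: "\<And>x. x \<in> K \<Longrightarrow> 1 - e \<le> (\<Sum>n<N. F n x)" by blast
      have "1 - e = L (\<lambda>x. (1 - e) * 1)" using scale[of "\<lambda>_. 1" "1 - e"] one by simp
      also have "\<dots> \<le> L (\<lambda>x. \<Sum>n<N. F n x)" using F N by (intro mono continuous_intros) auto
      also have "\<dots> = (\<Sum>n<N. L (F n))" using F by (intro sum) auto
      finally have "ennreal (1 - e) \<le> ennreal (\<Sum>n<N. L (F n))" by (rule ennreal_leI)
      also have "\<dots> = (\<Sum>n<N. ennreal (L (F n)))" using Lnn by simp
      also have "\<dots> \<le> (\<Sum>n. ennreal (L (F n)))" by (intro sum_le_suminf) auto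
      finally show ?thesis .
    qed
    show "1 \<le> (\<Sum>n. ennreal (L (F n)))"
    proof (rule ennreal_le_epsilon)
      fix e :: real assume "0 < e"
      show "1 \<le> (\<Sum>n. ennreal (L (F n))) + ennreal e"
      proof (cases "e < 1")
        case True
        have "1 = ennreal (1 - e) + ennreal e" using True \<open>0 < e\<close> by (subst ennreal_plus[symmetric]) auto
        also have "\<dots> \<le> (\<Sum>n. ennreal (L (F n))) + ennreal e"
          using approx True \<open>0 < e\<close> by (intro add_right_mono) auto
        finally show ?thesis .
      next
        case False
        hence "ennreal 1 \<le> ennreal e" by (intro ennreal_leI) simp
        then show ?thesis by (simp add: add_increasing)
      qed
    qed
  qed
qed

definition rep :: "'a measure" where
  "rep = measure_of K (sets (restrict_space borel K)) outer"

lemma sets_subset_lambda_system: "sets (restrict_space borel K) \<subseteq> lambda_system K (Pow K) outer"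
proof
  interpret sigma_algebra K "Pow K" by (rule sigma_algebra_Pow)
  interpret Lam: sigma_algebra K "lambda_system K (Pow K) outer"
    using caratheodory_lemma[OF outer_measure_space_outer] by (simp add: measure_space_def)
  fix A assume "A \<in> sets (restrict_space borel K)"
  then obtain B where B: "B \<in> sets borel" "A = K \<inter> B" by (auto simp: sets_restrict_space)
  have "B \<in> sigma_sets UNIV {S. open S}" using B by (simp add: borel_def)
  hence "K \<inter> B \<in> lambda_system K (Pow K) outer"
  proof induction
    case (Basic U)
    then show ?case using open_in_lambda_system[of U] by (simp add: Int_commute)
  next
    case (Compl B)
    then have "K - K \<inter> B \<in> lambda_system K (Pow K) outer" by (intro Lam.compl_sets)
    moreover have "K - K \<inter> B = K \<inter> (UNIV - B)" by auto
    ultimately show ?case by simp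
  next
    case (Union B)
    then have "(\<Union>i. K \<inter> B i) \<in> lambda_system K (Pow K) outer" by (intro Lam.countable_UN) auto
    then show ?case by simp
  qed simp
  with B show "A \<in> lambda_system K (Pow K) outer" by simp
qed

lemma sets_rep: "sets rep = sets (restrict_space borel K)" and space_rep: "space rep = K"
proof -
  have *: "sets (restrict_space borel K) \<subseteq> Pow K"
    using sets.space_closed[of "restrict_space borel K"] by (simp add: space_restrict_space)
  show "space rep = K" unfolding rep_def by (rule space_measure_of[OF *])
  have "sigma_sets K (sets (restrict_space borel K)) = sets (restrict_space borel K)"
    using sets.sigma_sets_eq[of "restrict_space borel K"] by (simp add: space_restrict_space)
  then show "sets rep = sets (restrict_space borel K)" unfolding rep_def using sets_measure_of[OF *] by simp
qed

lemma emeasure_rep: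
  assumes "A \<in> sets (restrict_space borel K)" shows "emeasure rep A = outer A"
proof -
  interpret sigma_algebra K "Pow K" by (rule sigma_algebra_Pow)
  have ms: "measure_space K (lambda_system K (Pow K) outer) outer"
    by (rule caratheodory_lemma[OF outer_measure_space_outer])
  show ?thesis
    unfolding rep_def
  proof (rule emeasure_measure_of_sigma[OF _ _ _ assms])
    show "sigma_algebra K (sets (restrict_space borel K))"
      using sets.sigma_algebra_axioms[of "restrict_space borel K"] by (simp add: space_restrict_space)
    show "positive (sets (restrict_space borel K)) outer"
      using outer_measure_space_outer by (simp add: outer_measure_space_def positive_def)
    show "countably_additive (sets (restrict_space borel K)) outer"
      using ms sets_subset_lambda_system sets.countable_UN
      unfolding measure_space_def countably_additive_def by blast
  qed
qed

lemma rep_in_prob_measures_on: "rep \<in> prob_measures_on K"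
proof -
  have "K \<in> sets (restrict_space borel K)"
    using sets.top[of "restrict_space borel K"] by (simp add: space_restrict_space)
  hence "emeasure rep (space rep) = 1" using emeasure_rep outer_space space_rep by simp
  hence "prob_space rep" by (rule prob_spaceI)
  then show ?thesis unfolding prob_measures_on_def space_prob_algebra using sets_rep by simp
qed

text \<open>Cut \<open>N * g\<close> into unit slices. The slice number \<open>i\<close> majorizes the indicator of the set where \<open>N * g \<ge> i + 1\<close>, so it
  bounds the measure of this set. Replacing \<open>N * g\<close> by the sum of these indicators loses at most 1, which
  is negligible after division by \<open>N\<close>.\<close>

lemma integral_rep_le:
  assumes g: "continuous_on K g" and g01: "\<And>x. x \<in> K \<Longrightarrow> 0 \<le> g x" "\<And>x. x \<in> K \<Longrightarrow> g x \<le> 1"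
  shows "(\<integral>x. g x \<partial>rep) \<le> L g"
proof -
  interpret prob_space rep by (rule prob_measures_onD[OF rep_in_prob_measures_on])
  have ig: "integrable rep g" by (rule continuous_on_compact_imp_integrable[OF K rep_in_prob_measures_on g])
  note meas = borel_measurable_integrable[OF ig]
  have bound: "real N * (\<integral>x. g x \<partial>rep) \<le> 1 + real N * L g" for N
  proof -
    let ?y = "\<lambda>x. real N * g x"
    define A where "A i = {x \<in> K. real i + 1 \<le> ?y x}" for i :: nat
    have A: "A i \<in> sets rep" for i
    proof -
      have "{x \<in> space rep. real i + 1 \<le> ?y x} \<in> sets rep" using meas by measurable
      then show ?thesis by (simp add: A_def space_rep)
    qed
    have slice: "continuous_on K (\<lambda>x. max 0 (min 1 (?y x - real i)))" for i :: nat
      using g by (intro continuous_intros)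
    have mA: "measure rep (A i) \<le> L (\<lambda>x. max 0 (min 1 (?y x - real i)))" for i
    proof -
      have "emeasure rep (A i) \<le> ennreal (L (\<lambda>x. max 0 (min 1 (?y x - real i))))"
        unfolding emeasure_rep[OF A[unfolded sets_rep]] by (rule outer_le_functional[OF slice]) (auto simp: A_def)
      moreover have "0 \<le> L (\<lambda>x. max 0 (min 1 (?y x - real i)))" by (rule pos[OF slice]) simp
      ultimately show ?thesis by (simp add: emeasure_eq_measure)
    qed
    have pw: "?y x \<le> 1 + (\<Sum>i<N. indicator (A i) x)" if x: "x \<in> K" for x
    proof (cases "?y x \<le> 1")
      case True
      moreover have "0 \<le> (\<Sum>i<N. indicator (A i) x :: real)" by (intro sum_nonneg) simp
      ultimately show ?thesis by simp
    next
      case False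
      have "?y x - 1 = (\<Sum>i<N. max 0 (min 1 ((?y x - 1) - real i)))"
        using False g01[OF x] mult_left_mono[of "g x" 1 "real N"] by (subst sum_unit_slices) auto
      also have "\<dots> \<le> (\<Sum>i<N. indicator (A i) x)"
        using x by (intro sum_mono) (auto simp: A_def indicator_def)
      finally show ?thesis by simp
    qed
    have "real N * (\<integral>x. g x \<partial>rep) = (\<integral>x. ?y x \<partial>rep)" by simp
    also have "\<dots> \<le> (\<integral>x. 1 + (\<Sum>i<N. indicator (A i) x) \<partial>rep)"
      using ig A pw by (intro integral_mono) (auto simp: space_rep less_top[symmetric] intro!: integrable_real_indicator)
    also have "\<dots> = 1 + (\<Sum>i<N. measure rep (A i))"
    proof -
      have ind: "integrable rep (indicator (A i) :: 'a \<Rightarrow> real)" for i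
        using A by (intro integrable_real_indicator) (auto simp: less_top[symmetric])
      have "(\<integral>x. 1 + (\<Sum>i<N. indicator (A i) x) \<partial>rep) = (\<integral>x. 1 \<partial>rep) + (\<integral>x. (\<Sum>i<N. indicat_real (A i) x) \<partial>rep)"
        using ind by (intro Bochner_Integration.integral_add Bochner_Integration.integrable_sum) auto
      also have "(\<integral>x. (\<Sum>i<N. indicat_real (A i) x) \<partial>rep) = (\<Sum>i<N. \<integral>x. indicator (A i) x \<partial>rep)"
        using ind by (intro Bochner_Integration.integral_sum) auto
      finally show ?thesis using A sets.sets_into_space[OF A] by (simp add: prob_space Int_absorb2)
    qed
    also have "\<dots> \<le> 1 + (\<Sum>i<N. L (\<lambda>x. max 0 (min 1 (?y x - real i))))"
      using mA by (intro add_left_mono sum_mono)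
    also have "(\<Sum>i<N. L (\<lambda>x. max 0 (min 1 (?y x - real i)))) = L (\<lambda>x. \<Sum>i<N. max 0 (min 1 (?y x - real i)))"
      using slice by (intro sum[symmetric])
    also have "\<dots> \<le> L ?y"
      using g g01 slice by (intro mono continuous_intros) (auto simp: sum_unit_slices)
    also have "\<dots> = real N * L g" by (rule scale[OF g])
    finally show ?thesis by simp
  qed
  show ?thesis
  proof (rule ccontr)
    assume "\<not> ?thesis"
    hence "0 < (\<integral>x. g x \<partial>rep) - L g" by simp
    then obtain N where "1 < real N * ((\<integral>x. g x \<partial>rep) - L g)" using reals_Archimedean3 by blast
    with bound[of N] show False by (simp add: algebra_simps)
  qed
qed

text \<open>After rescaling \<open>f\<close> to values between 0 and 1, the inequality for \<open>g\<close> and for \<open>1 - g\<close> gives equality.\<close>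

lemma integral_rep:
  assumes f: "continuous_on K f"
  shows "(\<integral>x. f x \<partial>rep) = L f"
proof -
  interpret prob_space rep by (rule prob_measures_onD[OF rep_in_prob_measures_on])
  have "bounded (f ` K)" using compact_continuous_image[OF f K] by (rule compact_imp_bounded)
  then obtain M where M: "M > 0" "\<And>x. x \<in> K \<Longrightarrow> \<bar>f x\<bar> \<le> M"
    by (auto simp: bounded_pos)
  have int: "integrable rep f" by (rule continuous_on_compact_imp_integrable[OF K rep_in_prob_measures_on f])
  define g where "g x = 1 / (2 * M) * f x + 1 / 2" for x
  have g: "continuous_on K g" unfolding g_def using f by (intro continuous_intros)
  have g01: "0 \<le> g x" "g x \<le> 1" if "x \<in> K" for x
    using M(2)[OF that] M(1) by (auto simp: g_def field_simps abs_le_iff)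
  have ig: "(\<integral>x. g x \<partial>rep) = 1 / (2 * M) * (\<integral>x. f x \<partial>rep) + 1 / 2"
    unfolding g_def using int by (simp add: prob_space)
  have intg: "integrable rep g" unfolding g_def using int by simp
  have half: "L (\<lambda>_. 1 / 2) = 1 / 2" using scale[of "\<lambda>_. 1" "1/2"] one by simp
  have Lg: "L g = 1 / (2 * M) * L f + 1 / 2"
    unfolding g_def using f by (subst add) (auto intro!: continuous_intros simp: scale half simp del: times_divide_eq_left)
  have "(\<integral>x. g x \<partial>rep) \<le> L g" by (rule integral_rep_le[OF g]) (use g01 in auto)
  moreover have "(\<integral>x. 1 - g x \<partial>rep) \<le> L (\<lambda>x. 1 - g x)"
    by (rule integral_rep_le) (use g g01 in \<open>auto intro!: continuous_intros\<close>)
  moreover have "(\<integral>x. 1 - g x \<partial>rep) = 1 - (\<integral>x. g x \<partial>rep)" using intg by (simp add: prob_space)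
  moreover have "L (\<lambda>x. 1 - g x) = 1 - L g"
    using add[of "\<lambda>_. 1" "\<lambda>x. (-1) * g x"] scale[OF g, of "-1"] g one by (auto intro!: continuous_intros)
  ultimately have "(\<integral>x. g x \<partial>rep) = L g" by simp
  then show ?thesis using M(1) by (simp add: ig Lg)
qed

end

theorem Riesz_representation_compact:
  fixes K :: "'a::metric_space set"
  assumes "positive_functional K L"
  obtains \<mu> where "\<mu> \<in> prob_measures_on K" "\<And>f. continuous_on K f \<Longrightarrow> (\<integral>x. f x \<partial>\<mu>) = L f"
  using positive_functional.rep_in_prob_measures_on[OF assms] positive_functional.integral_rep[OF assms] by blast

section \<open>The weak topology is compact and Hausdorff\<close>

lemma topspace_weak_topology_on: "topspace (weak_topology_on K) = prob_measures_on K"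
proof -
  have "{\<mu> \<in> prob_measures_on K. (\<integral>x. (0::real) \<partial>\<mu>) \<in> UNIV} \<in>
    {{\<mu> \<in> prob_measures_on K. (\<integral>x. f x \<partial>\<mu>) \<in> U} | (f :: 'a \<Rightarrow> real) U.
       continuous_on K f \<and> bounded (f ` K) \<and> open U}"
    by (intro CollectI exI[of _ "\<lambda>_. 0"] exI[of _ UNIV]) (auto intro: finite_imp_bounded simp: image_constant_conv)
  then show ?thesis unfolding weak_topology_on_def topology_generated_by_topspace by auto
qed

lemma openin_weak_topology_integral:
  fixes f :: "'a::metric_space \<Rightarrow> real"
  assumes "compact K" "continuous_on K f" "open U"
  shows "openin (weak_topology_on K) {\<mu> \<in> prob_measures_on K. (\<integral>x. f x \<partial>\<mu>) \<in> U}"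
  unfolding weak_topology_on_def using assms compact_imp_bounded[OF compact_continuous_image[OF assms(2,1)]]
  by (intro topology_generated_by_Basis CollectI exI[of _ f] exI[of _ U] conjI refl)

lemma open_measure_approximation:
  fixes U K :: "'a::metric_space set"
  assumes U: "open U" and K: "compact K"
  shows "\<exists>\<phi> :: nat \<Rightarrow> 'a \<Rightarrow> real. (\<forall>k. continuous_on K (\<phi> k)) \<and>
    (\<forall>\<mu>\<in>prob_measures_on K. (\<forall>k. (\<integral>x. \<phi> k x \<partial>\<mu>) \<le> measure \<mu> (U \<inter> K)) \<and>
      (\<lambda>k. \<integral>x. \<phi> k x \<partial>\<mu>) \<longlonglongrightarrow> measure \<mu> (U \<inter> K))"
proof -
  obtain \<phi> :: "nat \<Rightarrow> 'a \<Rightarrow> real" where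
    \<phi>: "\<And>k. continuous_on UNIV (\<phi> k)" "\<And>k x. 0 \<le> \<phi> k x" "\<And>k x. \<phi> k x \<le> 1" "\<And>k x. x \<notin> U \<Longrightarrow> \<phi> k x = 0"
      "\<And>x. (\<lambda>k. \<phi> k x) \<longlonglongrightarrow> indicator U x"
    using open_indicator_approximation[OF U] by metis
  have c: "continuous_on K (\<phi> k)" for k by (rule continuous_on_subset[OF \<phi>(1)]) simp
  show ?thesis
  proof (intro exI[of _ \<phi>] conjI allI ballI c)
    fix \<mu> assume \<mu>: "\<mu> \<in> prob_measures_on K"
    interpret prob_space \<mu> by (rule prob_measures_onD[OF \<mu>])
    have UK: "U \<inter> K \<in> sets \<mu>"
      unfolding sets_prob_measures_on_iff[OF \<mu>] using U by (intro bexI[of _ U]) auto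
    have ind: "(\<integral>x. indicat_real (U \<inter> K) x \<partial>\<mu>) = measure \<mu> (U \<inter> K)"
      using sets.sets_into_space[OF UK] by (simp add: Int_absorb2)
    have int: "integrable \<mu> (\<phi> k)" for k by (rule continuous_on_compact_imp_integrable[OF K \<mu> c])
    have intU: "integrable \<mu> (indicat_real (U \<inter> K))"
      using UK by (intro integrable_real_indicator) (auto simp: less_top[symmetric])
    show "(\<integral>x. \<phi> k x \<partial>\<mu>) \<le> measure \<mu> (U \<inter> K)" for k
      unfolding ind[symmetric] using \<phi>(3,4) int intU
      by (intro integral_mono) (auto simp: prob_measures_onD(3)[OF \<mu>] indicator_def)
    show "(\<lambda>k. \<integral>x. \<phi> k x \<partial>\<mu>) \<longlonglongrightarrow> measure \<mu> (U \<inter> K)"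
      unfolding ind[symmetric]
    proof (rule integral_dominated_convergence[where w = "\<lambda>_. 1"])
      show "AE x in \<mu>. (\<lambda>k. \<phi> k x) \<longlonglongrightarrow> indicat_real (U \<inter> K) x"
      proof (rule AE_I2)
        fix x assume "x \<in> space \<mu>"
        hence "indicat_real (U \<inter> K) x = indicator U x"
          using prob_measures_onD(3)[OF \<mu>] by (simp add: indicator_def)
        then show "(\<lambda>k. \<phi> k x) \<longlonglongrightarrow> indicat_real (U \<inter> K) x" using \<phi>(5)[of x] by simp
      qed
    qed (use \<phi> int intU in \<open>auto intro!: borel_measurable_integrable\<close>)
  qed
qed

text \<open>The mass of an open set is the supremum of the integrals of continuous minorants of its indicator, hence
  lower semicontinuous.\<close>

lemma openin_weak_topology_measure_greater:
  fixes U K :: "'a::metric_space set"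
  assumes "compact K" "open U"
  shows "openin (weak_topology_on K) {\<mu> \<in> prob_measures_on K. a < measure \<mu> (U \<inter> K)}"
proof -
  obtain \<phi> :: "nat \<Rightarrow> 'a \<Rightarrow> real" where \<phi>: "\<And>k. continuous_on K (\<phi> k)"
    "\<And>\<mu> k. \<mu> \<in> prob_measures_on K \<Longrightarrow> (\<integral>x. \<phi> k x \<partial>\<mu>) \<le> measure \<mu> (U \<inter> K)"
    "\<And>\<mu>. \<mu> \<in> prob_measures_on K \<Longrightarrow> (\<lambda>k. \<integral>x. \<phi> k x \<partial>\<mu>) \<longlonglongrightarrow> measure \<mu> (U \<inter> K)"
    using open_measure_approximation[OF assms(2) assms(1)] by blast
  have eq: "{\<mu> \<in> prob_measures_on K. a < measure \<mu> (U \<inter> K)} =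
    (\<Union>k. {\<mu> \<in> prob_measures_on K. (\<integral>x. \<phi> k x \<partial>\<mu>) \<in> {a<..}})"
  proof (intro set_eqI iffI)
    fix \<mu> assume "\<mu> \<in> {\<mu> \<in> prob_measures_on K. a < measure \<mu> (U \<inter> K)}"
    hence \<mu>: "\<mu> \<in> prob_measures_on K" "a < measure \<mu> (U \<inter> K)" by auto
    have "\<forall>\<^sub>F k in sequentially. a < (\<integral>x. \<phi> k x \<partial>\<mu>)"
      by (rule order_tendstoD(1)[OF \<phi>(3)[OF \<mu>(1)] \<mu>(2)])
    then obtain k where "a < (\<integral>x. \<phi> k x \<partial>\<mu>)" by (auto simp: eventually_sequentially)
    with \<mu> show "\<mu> \<in> (\<Union>k. {\<mu> \<in> prob_measures_on K. (\<integral>x. \<phi> k x \<partial>\<mu>) \<in> {a<..}})" by auto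
  next
    fix \<mu> assume "\<mu> \<in> (\<Union>k. {\<mu> \<in> prob_measures_on K. (\<integral>x. \<phi> k x \<partial>\<mu>) \<in> {a<..}})"
    then obtain k where "\<mu> \<in> prob_measures_on K" "a < (\<integral>x. \<phi> k x \<partial>\<mu>)" by auto
    with \<phi>(2)[of \<mu> k] show "\<mu> \<in> {\<mu> \<in> prob_measures_on K. a < measure \<mu> (U \<inter> K)}"
      by auto
  qed
  have *: "openin (weak_topology_on K) {\<mu> \<in> prob_measures_on K. (\<integral>x. \<phi> k x \<partial>\<mu>) \<in> {a<..}}" for k
    by (rule openin_weak_topology_integral[OF assms(1) \<phi>(1)]) simp
  show ?thesis unfolding eq by (rule openin_Union) (use * in blast)
qed

text \<open>Open sets generate the Borel sets, and their masses are limits of integrals of continuous functions.\<close>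

lemma prob_measures_on_eqI:
  fixes K :: "'a::metric_space set"
  assumes "compact K" and \<mu>: "\<mu> \<in> prob_measures_on K" and \<nu>: "\<nu> \<in> prob_measures_on K"
    and eq: "\<And>f :: 'a \<Rightarrow> real. continuous_on K f \<Longrightarrow> (\<integral>x. f x \<partial>\<mu>) = (\<integral>x. f x \<partial>\<nu>)"
  shows "\<mu> = \<nu>"
proof -
  have m: "measure \<mu> (U \<inter> K) = measure \<nu> (U \<inter> K)" if U: "open U" for U
  proof -
    obtain \<phi> :: "nat \<Rightarrow> 'a \<Rightarrow> real" where \<phi>: "\<And>k. continuous_on K (\<phi> k)"
      "\<And>\<mu> k. \<mu> \<in> prob_measures_on K \<Longrightarrow> (\<integral>x. \<phi> k x \<partial>\<mu>) \<le> measure \<mu> (U \<inter> K)"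
      "\<And>\<mu>. \<mu> \<in> prob_measures_on K \<Longrightarrow> (\<lambda>k. \<integral>x. \<phi> k x \<partial>\<mu>) \<longlonglongrightarrow> measure \<mu> (U \<inter> K)"
      using open_measure_approximation[OF U assms(1)] by blast
    have "(\<lambda>k. \<integral>x. \<phi> k x \<partial>\<mu>) = (\<lambda>k. \<integral>x. \<phi> k x \<partial>\<nu>)" using eq \<phi>(1) by auto
    then show ?thesis
      using LIMSEQ_unique[OF \<phi>(3)[OF \<mu>]] \<phi>(3)[OF \<nu>] by simp
  qed
  interpret \<mu>: prob_space \<mu> by (rule prob_measures_onD[OF \<mu>])
  interpret \<nu>: prob_space \<nu> by (rule prob_measures_onD[OF \<nu>])
  let ?E = "{U \<inter> K |U. open U}"
  have gen: "sets (restrict_space borel K) = sigma_sets K ?E"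
  proof -
    have "K \<in> sigma_sets UNIV {S. open S}"
      using borel_closed[OF compact_imp_closed[OF assms(1)]] by (simp add: borel_def)
    hence "sets (restrict_space borel K) = sigma_sets K ((\<inter>) K ` {S. open S})"
      using sigma_sets_Int[of K UNIV "{S. open S}"] by (simp add: sets_restrict_space borel_def)
    also have "(\<inter>) K ` {S. open S} = ?E" by auto
    finally show ?thesis .
  qed
  show ?thesis
  proof (rule measure_eqI_generator_eq[where E = ?E and \<Omega> = K and A = "\<lambda>_. K"])
    show "Int_stable ?E"
    proof (rule Int_stableI, clarify)
      fix U V :: "'a set" assume "open U" "open V"
      then show "\<exists>W. U \<inter> K \<inter> (V \<inter> K) = W \<inter> K \<and> open W" by (intro exI[of _ "U \<inter> V"]) auto
    qed
    show "emeasure \<mu> X = emeasure \<nu> X" if "X \<in> ?E" for X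
      using that m by (auto simp: \<mu>.emeasure_eq_measure \<nu>.emeasure_eq_measure)
    show "sets \<mu> = sigma_sets K ?E" "sets \<nu> = sigma_sets K ?E"
      using gen prob_measures_onD(2) \<mu> \<nu> by auto
    show "range (\<lambda>_. K) \<subseteq> ?E" by (auto intro!: exI[of _ UNIV])
  qed auto
qed

text \<open>Through its integrals, a probability measure on \<open>K\<close> is a point of a product of compact intervals. By the Riesz
  representation theorem the image consists of all points that depend linearly on the integrand, which is a
  closed condition.\<close>

lemma weak_topology_on_compact_Hausdorff:
  fixes K :: "'a::metric_space set"
  assumes K: "compact K" "K \<noteq> {}"
  shows "compact_space (weak_topology_on K)" "Hausdorff_space (weak_topology_on K)"
proof -
  define C where "C = {f :: 'a \<Rightarrow> real. continuous_on K f}"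
  define T where "T = product_topology (\<lambda>f. top_of_set {Inf (f ` K)..Sup (f ` K)}) C"
  have bdd: "bdd_below (f ` K)" "bdd_above (f ` K)" if "f \<in> C" for f
    using compact_imp_bounded[OF compact_continuous_image[OF _ K(1)], of f] that
    by (auto simp: C_def intro: bounded_imp_bdd_below bounded_imp_bdd_above)
  have Cops: "(\<lambda>x. f x + g x) \<in> C" "(\<lambda>x. c * f x) \<in> C" if "f \<in> C" "g \<in> C" for f g c
    using that by (auto simp: C_def intro!: continuous_intros)
  define e where "e \<mu> = (\<lambda>f\<in>C. \<integral>x. f x \<partial>\<mu>)" for \<mu> :: "'a measure"
  define S1 where "S1 f g = {v \<in> topspace T. v (\<lambda>x. f x + g x) = v f + v g}" for f g
  define S2 where "S2 c f = {v \<in> topspace T. v (\<lambda>x. c * f x) = c * v f}" for c f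
  define S where "S = (\<Inter>f\<in>C. \<Inter>g\<in>C. S1 f g) \<inter> (\<Inter>c. \<Inter>f\<in>C. S2 c f)"
  have proj: "continuous_map T euclideanreal (\<lambda>v. v f)" if "f \<in> C" for f
    using continuous_map_product_projection[OF that, of "\<lambda>f. top_of_set {Inf (f ` K)..Sup (f ` K)}"]
    unfolding T_def by (rule continuous_map_into_fulltopology)
  have one: "(\<lambda>_. 1) \<in> C" by (simp add: C_def)
  have S1: "closedin T (S1 f g)" if "f \<in> C" "g \<in> C" for f g
    unfolding S1_def using proj Cops that
    by (intro closedin_continuous_maps_eq[where Y = euclideanreal] continuous_map_add) auto
  have S2: "closedin T (S2 c f)" if "f \<in> C" for c f
    unfolding S2_def using proj Cops that
    by (intro closedin_continuous_maps_eq[where Y = euclideanreal] continuous_map_real_mult_left) auto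
  have closedS: "closedin T S"
    unfolding S_def using one S1 S2 by (intro closedin_Int closedin_INT) auto
  have ST: "S \<subseteq> topspace T" by (rule closedin_subset[OF closedS])
  have compactT: "compact_space T"
    unfolding T_def by (simp add: compact_space_product_topology compact_space_subtopology)
  have HausdorffT: "Hausdorff_space T"
    unfolding T_def by (simp add: Hausdorff_space_product_topology Hausdorff_space_subtopology)
  have eS: "e \<mu> \<in> S" if \<mu>: "\<mu> \<in> prob_measures_on K" for \<mu>
  proof -
    interpret prob_space \<mu> by (rule prob_measures_onD[OF \<mu>])
    have int: "integrable \<mu> f" if "f \<in> C" for f
      using continuous_on_compact_imp_integrable[OF K(1) \<mu>] that by (simp add: C_def)
    have "(\<integral>x. f x \<partial>\<mu>) \<in> {Inf (f ` K)..Sup (f ` K)}" if f: "f \<in> C" for f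
    proof -
      have "(\<integral>x. Inf (f ` K) \<partial>\<mu>) \<le> (\<integral>x. f x \<partial>\<mu>)"
        using int[OF f] bdd[OF f] by (intro integral_mono) (auto simp: prob_measures_onD(3)[OF \<mu>] intro: cInf_lower)
      moreover have "(\<integral>x. f x \<partial>\<mu>) \<le> (\<integral>x. Sup (f ` K) \<partial>\<mu>)"
        using int[OF f] bdd[OF f] by (intro integral_mono) (auto simp: prob_measures_onD(3)[OF \<mu>] intro: cSup_upper)
      ultimately show ?thesis by (simp add: prob_space)
    qed
    hence "e \<mu> \<in> topspace T" by (auto simp: T_def e_def)
    then show ?thesis using Cops int by (auto simp: S_def S1_def S2_def e_def)
  qed
  have surj: "\<exists>\<mu>\<in>prob_measures_on K. e \<mu> = v" if v: "v \<in> S" for v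
  proof -
    have vT: "v \<in> extensional C" "\<And>f. f \<in> C \<Longrightarrow> Inf (f ` K) \<le> v f" "\<And>f. f \<in> C \<Longrightarrow> v f \<le> Sup (f ` K)"
      using subsetD[OF ST v] by (auto simp: T_def PiE_iff)
    have "positive_functional K v"
    proof
      show "v (\<lambda>x. f x + g x) = v f + v g" if "continuous_on K f" "continuous_on K g" for f g
        using v that by (auto simp: S_def S1_def C_def)
      show "v (\<lambda>x. c * f x) = c * v f" if "continuous_on K f" for c f
        using v that by (auto simp: S_def S2_def C_def)
      show "0 \<le> v f" if "continuous_on K f" "\<And>x. x \<in> K \<Longrightarrow> 0 \<le> f x" for f
      proof -
        have "0 \<le> Inf (f ` K)" using that K(2) by (intro cInf_greatest) auto
        with vT(2)[of f] that(1) show ?thesis by (simp add: C_def)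
      qed
      show "v (\<lambda>_. 1) = 1" using vT(2,3)[of "\<lambda>_. 1"] K(2) by (simp add: C_def)
    qed (rule K(1))
    then obtain \<mu> where \<mu>: "\<mu> \<in> prob_measures_on K" "\<And>f. continuous_on K f \<Longrightarrow> (\<integral>x. f x \<partial>\<mu>) = v f"
      by (rule Riesz_representation_compact) blast
    have "e \<mu> = v"
      using \<mu>(2) vT(1) by (auto simp: e_def C_def fun_eq_iff extensional_def)
    with \<mu>(1) show ?thesis by blast
  qed
  have inj: "\<mu> = \<nu>" if "\<mu> \<in> prob_measures_on K" "\<nu> \<in> prob_measures_on K" "e \<mu> = e \<nu>" for \<mu> \<nu>
  proof (rule prob_measures_on_eqI[OF K(1) that(1,2)])
    fix f :: "'a \<Rightarrow> real" assume "continuous_on K f"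
    with fun_cong[OF that(3), of f] show "(\<integral>x. f x \<partial>\<mu>) = (\<integral>x. f x \<partial>\<nu>)" by (simp add: e_def C_def)
  qed
  define g where "g v = (THE \<mu>. \<mu> \<in> prob_measures_on K \<and> e \<mu> = v)" for v
  have ge: "g (e \<mu>) = \<mu>" if "\<mu> \<in> prob_measures_on K" for \<mu>
    unfolding g_def using that inj by (intro the_equality) auto
  have gS: "g v \<in> prob_measures_on K" "e (g v) = v" if "v \<in> S" for v
    using surj[OF that] ge by auto
  have topS: "topspace (subtopology T S) = S" using closedin_subset[OF closedS] by auto
  have "continuous_map (weak_topology_on K) (subtopology T S) e"
  proof (rule continuous_map_into_subtopology)
    show "continuous_map (weak_topology_on K) T e"
      unfolding T_def continuous_map_componentwise
    proof (intro conjI ballI)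
      show "e ` topspace (weak_topology_on K) \<subseteq> extensional C" by (auto simp: e_def)
      fix f assume f: "f \<in> C"
      have "continuous_map (weak_topology_on K) euclideanreal (\<lambda>\<mu>. e \<mu> f)"
        unfolding continuous_map_def using f openin_weak_topology_integral[OF K(1), of f]
        by (auto simp: e_def C_def topspace_weak_topology_on)
      moreover have "(\<lambda>\<mu>. e \<mu> f) \<in> topspace (weak_topology_on K) \<rightarrow> {Inf (f ` K)..Sup (f ` K)}"
      proof
        fix \<mu> assume "\<mu> \<in> topspace (weak_topology_on K)"
        hence "e \<mu> \<in> topspace T" using eS ST by (auto simp: topspace_weak_topology_on)
        then show "e \<mu> f \<in> {Inf (f ` K)..Sup (f ` K)}"
          using f unfolding T_def topspace_product_topology by (simp add: PiE_iff)
      qed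
      ultimately show "continuous_map (weak_topology_on K) (top_of_set {Inf (f ` K)..Sup (f ` K)}) (\<lambda>\<mu>. e \<mu> f)"
        by (rule continuous_map_into_subtopology)
    qed
  qed (use eS in \<open>auto simp: topspace_weak_topology_on\<close>)
  moreover have "continuous_map (subtopology T S) (weak_topology_on K) g"
    unfolding weak_topology_on_def
  proof (rule continuous_on_generated_topo)
    fix W assume "W \<in> {{\<mu> \<in> prob_measures_on K. (\<integral>x. f x \<partial>\<mu>) \<in> U} |f U.
         continuous_on K f \<and> bounded (f ` K) \<and> open (U :: real set)}"
    then obtain f U where W: "W = {\<mu> \<in> prob_measures_on K. (\<integral>x. f x \<partial>\<mu>) \<in> U}" "f \<in> C" "open U"
      by (auto simp: C_def)
    have "openin (subtopology T S) {v \<in> topspace (subtopology T S). v f \<in> U}"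
      using W proj[of f] by (intro openin_continuous_map_preimage[where Y = euclideanreal] continuous_map_from_subtopology) auto
    moreover have "(\<integral>x. f x \<partial>(g v)) = v f" if "v \<in> S" for v
      using fun_cong[OF gS(2)[OF that], of f] W(2) by (simp add: e_def)
    hence "{v \<in> topspace (subtopology T S). v f \<in> U} = g -` W \<inter> topspace (subtopology T S)"
      using gS(1) unfolding topS W(1) by auto
    ultimately show "openin (subtopology T S) (g -` W \<inter> topspace (subtopology T S))" by simp
  next
    have "\<Union> {{\<mu> \<in> prob_measures_on K. (\<integral>x. f x \<partial>\<mu>) \<in> U} |f U.
         continuous_on K f \<and> bounded (f ` K) \<and> open (U :: real set)} = prob_measures_on K"
      using topspace_weak_topology_on[of K] unfolding weak_topology_on_def topology_generated_by_topspace .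
    then show "g ` topspace (subtopology T S) \<subseteq> \<Union> {{\<mu> \<in> prob_measures_on K. (\<integral>x. f x \<partial>\<mu>) \<in> U} |f U.
         continuous_on K f \<and> bounded (f ` K) \<and> open (U :: real set)}"
      using gS(1) unfolding topS by auto
  qed
  ultimately have "homeomorphic_maps (weak_topology_on K) (subtopology T S) e g"
    unfolding homeomorphic_maps_def topS topspace_weak_topology_on using ge gS by auto
  hence hom: "weak_topology_on K homeomorphic_space subtopology T S"
    unfolding homeomorphic_space_def by blast
  have "compact_space (subtopology T S)"
    by (intro compact_space_subtopology closedin_compact_space compactT closedS)
  with homeomorphic_compact_space[OF hom] show "compact_space (weak_topology_on K)" by simp
  show "Hausdorff_space (weak_topology_on K)"
    using homeomorphic_Hausdorff_space[OF hom] Hausdorff_space_subtopology[OF HausdorffT] by simp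
qed

text \<open>The intersection is dense by the Baire category theorem for compact Hausdorff spaces.\<close>

lemma typical_countable_INT:
  fixes K :: "'a::metric_space set"
  assumes "compact K" "K \<noteq> {}" and "countable I"
    and W: "\<And>i. i \<in> I \<Longrightarrow> openin (weak_topology_on K) (W i)"
           "\<And>i. i \<in> I \<Longrightarrow> weak_topology_on K closure_of W i = prob_measures_on K"
    and P: "\<And>\<mu>. \<mu> \<in> prob_measures_on K \<Longrightarrow> (\<And>i. i \<in> I \<Longrightarrow> \<mu> \<in> W i) \<Longrightarrow> P \<mu>"
  shows "typical (weak_topology_on K) P"
  unfolding typical_def
proof (intro exI conjI ballI)
  let ?X = "weak_topology_on K" and ?G = "insert (topspace (weak_topology_on K)) (W ` I)"
  show "gdelta_in ?X (\<Inter>?G)"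
    using assms(3) W(1) by (intro gdelta_in_Inter) (auto intro: open_imp_gdelta_in)
  show "?X closure_of \<Inter>?G = topspace ?X"
    using weak_topology_on_compact_Hausdorff[OF assms(1,2)] assms(3) W
    by (intro Baire_category disjI2 conjI compact_imp_locally_compact_space compact_Hausdorff_imp_regular_space)
       (auto simp: topspace_weak_topology_on closure_of_topspace[of ?X, unfolded topspace_weak_topology_on]
         openin_topspace[of ?X, unfolded topspace_weak_topology_on])
  show "P \<mu>" if "\<mu> \<in> \<Inter>?G" for \<mu>
    using that by (intro P) (auto simp: topspace_weak_topology_on)
qed

section \<open>Finitely supported measures near a given measure\<close>

text \<open>The value chosen outside \<open>K\<close> makes the map total into \<open>K\<close>, as measurability requires.\<close>

definition discrete_on :: "'a::topological_space set \<Rightarrow> 'a pmf \<Rightarrow> 'a measure" where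
  "discrete_on K p = distr (measure_pmf p) (restrict_space borel K) (\<lambda>x. if x \<in> K then x else (SOME k. k \<in> K))"

context
  fixes K :: "'a::metric_space set" and p :: "'a pmf"
  assumes p: "set_pmf p \<subseteq> K"
begin

lemma discrete_on_measurable:
  "(\<lambda>x. if x \<in> K then x else (SOME k. k \<in> K)) \<in> measurable (measure_pmf p) (restrict_space borel K)"
proof -
  have "K \<noteq> {}" using p set_pmf_not_empty by fast
  then show ?thesis by (auto simp: measurable_def space_restrict_space some_in_eq)
qed

lemma discrete_on_in_prob_measures_on: "discrete_on K p \<in> prob_measures_on K"
  unfolding prob_measures_on_def space_prob_algebra discrete_on_def
  using measure_pmf.prob_space_distr[OF discrete_on_measurable] by simp

lemma measure_discrete_on:
  assumes "A \<in> sets (discrete_on K p)"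
  shows "measure (discrete_on K p) A = measure_pmf.prob p A"
proof -
  have "measure (discrete_on K p) A = measure_pmf.prob p ((\<lambda>x. if x \<in> K then x else (SOME k. k \<in> K)) -` A \<inter> space (measure_pmf p))"
    unfolding discrete_on_def using assms
    by (intro measure_distr[OF discrete_on_measurable]) (simp add: discrete_on_def)
  also have "\<dots> = measure_pmf.prob p A"
    using p by (intro measure_pmf.finite_measure_eq_AE) (auto simp: AE_measure_pmf_iff)
  finally show ?thesis .
qed

lemma integral_discrete_on:
  fixes f :: "'a \<Rightarrow> real"
  assumes "continuous_on K f"
  shows "(\<integral>x. f x \<partial>(discrete_on K p)) = measure_pmf.expectation p f"
proof -
  have "(\<integral>x. f x \<partial>(discrete_on K p)) = measure_pmf.expectation p (\<lambda>x. f (if x \<in> K then x else (SOME k. k \<in> K)))"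
    unfolding discrete_on_def
    by (rule integral_distr[OF discrete_on_measurable borel_measurable_continuous_on_restrict[OF assms]])
  also have "\<dots> = measure_pmf.expectation p f"
    using p by (intro integral_cong_AE) (auto simp: AE_measure_pmf_iff)
  finally show ?thesis .
qed

end

lemma ex_pmf_finite:
  assumes "finite Y" "\<And>y. y \<in> Y \<Longrightarrow> 0 \<le> w y" "(\<Sum>y\<in>Y. w y) = (1::real)"
  shows "\<exists>p. set_pmf p \<subseteq> Y \<and> (\<forall>y\<in>Y. pmf p y = w y)"
proof -
  define f where "f y = (if y \<in> Y then w y else 0)" for y
  have nn: "0 \<le> f y" for y using assms by (simp add: f_def)
  have "(\<integral>\<^sup>+ y. ennreal (f y) \<partial>count_space UNIV) = (\<Sum>y\<in>Y. ennreal (f y))"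
    using assms(1) by (intro nn_integral_count_space'[symmetric, THEN sym]) (auto simp: f_def)
  also have "\<dots> = 1" using assms(2,3) by (subst sum_ennreal) (auto simp: f_def)
  finally have p: "pmf (embed_pmf f) y = f y" for y using nn by (intro pmf_embed_pmf) auto
  show ?thesis
  proof (intro exI[of _ "embed_pmf f"] conjI)
    show "set_pmf (embed_pmf f) \<subseteq> Y" by (auto simp: set_pmf_eq p f_def)
  qed (simp add: p f_def)
qed

lemma pmf_expectation_near:
  fixes f :: "'a \<Rightarrow> real"
  assumes "finite (set_pmf p)" "\<And>x. x \<in> set_pmf p \<Longrightarrow> \<bar>f x - c\<bar> \<le> e"
  shows "\<bar>measure_pmf.expectation p f - c\<bar> \<le> e"
proof -
  have int: "integrable (measure_pmf p) g" for g :: "'a \<Rightarrow> real"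
    using assms(1) by (rule integrable_measure_pmf_finite)
  have "measure_pmf.expectation p f - c = measure_pmf.expectation p (\<lambda>x. f x - c)"
    using int by simp
  also have "\<bar>\<dots>\<bar> \<le> measure_pmf.expectation p (\<lambda>x. \<bar>f x - c\<bar>)" by (rule integral_abs_bound)
  also have "\<dots> \<le> measure_pmf.expectation p (\<lambda>x. e)"
    using int assms(2) by (intro integral_mono_AE) (auto simp: AE_measure_pmf_iff)
  finally show ?thesis by simp
qed

lemma weak_topology_on_basic_nbhd:
  fixes K :: "'a::topological_space set"
  assumes "openin (weak_topology_on K) W" "\<mu> \<in> W"
  shows "\<exists>(F :: ('a \<Rightarrow> real) set) e. finite F \<and> (\<forall>f\<in>F. continuous_on K f) \<and> e > 0 \<and>
    (\<forall>\<nu>\<in>prob_measures_on K. (\<forall>f\<in>F. \<bar>(\<integral>x. f x \<partial>\<nu>) - (\<integral>x. f x \<partial>\<mu>)\<bar> < e) \<longrightarrow> \<nu> \<in> W)"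
proof -
  define nb where "nb V F e \<longleftrightarrow> finite F \<and> (\<forall>f\<in>F. continuous_on K f) \<and> e > 0 \<and>
    (\<forall>\<nu>\<in>prob_measures_on K. (\<forall>f\<in>F. \<bar>(\<integral>x. f x \<partial>\<nu>) - (\<integral>x. f x \<partial>\<mu>)\<bar> < e) \<longrightarrow> \<nu> \<in> V)"
    for V and F :: "('a \<Rightarrow> real) set" and e :: real
  have "generate_topology_on {{\<mu> \<in> prob_measures_on K. (\<integral>x. f x \<partial>\<mu>) \<in> U} | (f :: 'a \<Rightarrow> real) U.
       continuous_on K f \<and> bounded (f ` K) \<and> open U} W"
    using assms(1) unfolding weak_topology_on_def openin_topology_generated_by_iff .
  hence "\<mu> \<in> W \<longrightarrow> (\<exists>F e. nb W F e)"
  proof induction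
    case Empty
    then show ?case by simp
  next
    case (Int V V')
    show ?case
    proof
      assume "\<mu> \<in> V \<inter> V'"
      then obtain F e F' e' where "nb V F e" "nb V' F' e'" using Int.IH by blast
      hence "nb (V \<inter> V') (F \<union> F') (min e e')" unfolding nb_def by (auto simp: ball_Un)
      then show "\<exists>F e. nb (V \<inter> V') F e" by blast
    qed
  next
    case (UN \<V>)
    show ?case
    proof
      assume "\<mu> \<in> \<Union>\<V>"
      then obtain V F e where "V \<in> \<V>" "nb V F e" using UN.IH by blast
      hence "nb (\<Union>\<V>) F e" unfolding nb_def by (meson UnionI)
      then show "\<exists>F e. nb (\<Union>\<V>) F e" by blast
    qed
  next
    case (Basis V)
    then obtain f :: "'a \<Rightarrow> real" and U where V: "V = {\<mu> \<in> prob_measures_on K. (\<integral>x. f x \<partial>\<mu>) \<in> U}"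
      "continuous_on K f" "open U" by blast
    show ?case
    proof
      assume "\<mu> \<in> V"
      hence "(\<integral>x. f x \<partial>\<mu>) \<in> U" using V by simp
      then obtain e where "e > 0" "\<And>y. \<bar>y - (\<integral>x. f x \<partial>\<mu>)\<bar> < e \<Longrightarrow> y \<in> U"
        using V(3) unfolding open_dist dist_real_def by blast
      hence "nb V {f} e" unfolding nb_def V(1) using V(2) by auto
      then show "\<exists>F e. nb V F e" by blast
    qed
  qed
  then show ?thesis unfolding nb_def using assms(2) by blast
qed

text \<open>Averaging a measure against a continuous partition of unity subordinate to small balls concentrates it on their centres.
  Any further redistribution of the mass within these balls stays weakly close to the
  original measure, and a small atom can be added at a prescribed point \<open>z\<close>.\<close>

lemma finite_net_refinement:
  fixes K :: "'a::metric_space set"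
  assumes K: "compact K" and W: "openin (weak_topology_on K) W" "\<mu> \<in> W" and z: "z \<in> K"
  shows "\<exists>a \<delta>. finite (set_pmf a) \<and> set_pmf a \<subseteq> K \<and> z \<in> set_pmf a \<and> 0 < \<delta> \<and>
    (\<forall>h. (\<forall>y\<in>set_pmf a. finite (set_pmf (h y)) \<and> set_pmf (h y) \<subseteq> K \<inter> ball y \<delta>) \<longrightarrow>
      discrete_on K (bind_pmf a h) \<in> W)"
proof -
  have \<mu>: "\<mu> \<in> prob_measures_on K"
    using openin_subset[OF W(1)] W(2) by (auto simp: topspace_weak_topology_on)
  obtain F :: "('a \<Rightarrow> real) set" and e :: real where F: "finite F" "\<forall>f\<in>F. continuous_on K f" and e: "e > 0"
    and nb: "\<forall>\<nu>\<in>prob_measures_on K. (\<forall>f\<in>F. \<bar>(\<integral>x. f x \<partial>\<nu>) - (\<integral>x. f x \<partial>\<mu>)\<bar> < e) \<longrightarrow> \<nu> \<in> W"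
    using weak_topology_on_basic_nbhd[OF W] by blast
  have "\<exists>d>0. \<forall>f\<in>F. \<forall>x\<in>K. \<forall>y\<in>K. dist y x < d \<longrightarrow> \<bar>f y - f x\<bar> \<le> e / 4"
    using F
  proof (induction F rule: finite_induct)
    case empty
    then show ?case by (intro exI[of _ 1]) auto
  next
    case (insert f F)
    obtain d where d: "d > 0" "\<forall>f\<in>F. \<forall>x\<in>K. \<forall>y\<in>K. dist y x < d \<longrightarrow> \<bar>f y - f x\<bar> \<le> e / 4"
      using insert by blast
    have "uniformly_continuous_on K f" using insert.prems K by (intro compact_uniformly_continuous) auto
    then obtain d' where d': "d' > 0" "\<And>x y. x \<in> K \<Longrightarrow> y \<in> K \<Longrightarrow> dist y x < d' \<Longrightarrow> dist (f y) (f x) < e / 4"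
      using e unfolding uniformly_continuous_on_def by (metis zero_less_divide_iff zero_less_numeral)
    have "\<forall>g\<in>insert f F. \<forall>x\<in>K. \<forall>y\<in>K. dist y x < min d d' \<longrightarrow> \<bar>g y - g x\<bar> \<le> e / 4"
      using d(2) d'(2) by (auto simp: dist_real_def intro: less_imp_le)
    then show ?case using d(1) d'(1) by (intro exI[of _ "min d d'"]) auto
  qed
  then obtain d where d: "d > 0" "\<And>f x y. f \<in> F \<Longrightarrow> x \<in> K \<Longrightarrow> y \<in> K \<Longrightarrow> dist y x < d \<Longrightarrow> \<bar>f y - f x\<bar> \<le> e / 4"
    by blast
  have "\<exists>M>0. \<forall>f\<in>F. \<forall>x\<in>K. \<bar>f x\<bar> \<le> M"
    using F
  proof (induction F rule: finite_induct)
    case empty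
    then show ?case by (intro exI[of _ 1]) auto
  next
    case (insert f F)
    obtain M where M: "M > 0" "\<forall>f\<in>F. \<forall>x\<in>K. \<bar>f x\<bar> \<le> M" using insert by blast
    obtain M' where M': "\<And>x. x \<in> K \<Longrightarrow> \<bar>f x\<bar> \<le> M'"
      using compact_imp_bounded[OF compact_continuous_image[OF _ K, of f]] insert.prems by (auto simp: bounded_iff)
    have "\<forall>g\<in>insert f F. \<forall>x\<in>K. \<bar>g x\<bar> \<le> max M M'" using M(2) M' by (auto simp: le_max_iff_disj)
    then show ?case using M(1) by (intro exI[of _ "max M M'"]) auto
  qed
  then obtain M where M: "M > 0" "\<And>f x. f \<in> F \<Longrightarrow> x \<in> K \<Longrightarrow> \<bar>f x\<bar> \<le> M" by blast
  \<comment> \<open>The mass of the extra atom; it changes each integral by at most \<open>2 * \<eta> * M\<close>.\<close>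
  define \<eta> where "\<eta> = min (1/2) (e / (8 * M))"
  have \<eta>: "0 < \<eta>" "\<eta> < 1" "2 * \<eta> * M \<le> e / 4" using e M(1) by (auto simp: \<eta>_def min_def field_simps)
  obtain Y0 where Y0: "finite Y0" "Y0 \<subseteq> K" "K \<subseteq> (\<Union>y\<in>Y0. ball y d)"
    using compactE_image[OF K, of K "\<lambda>y. ball y d"] d(1) by (metis UN_I centre_in_ball open_ball subsetI)
  define Y where "Y = insert z Y0"
  have Y: "finite Y" "Y \<subseteq> K" using Y0 z by (auto simp: Y_def)
  define s where "s x = (\<Sum>y\<in>Y. max 0 (d - dist y x))" for x
  have s: "s x > 0" if x: "x \<in> K" for x
  proof -
    from subsetD[OF Y0(3) x] obtain y where y: "y \<in> Y" "dist y x < d" by (auto simp: Y_def)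
    have "0 < max 0 (d - dist y x)" using y by simp
    also have "\<dots> \<le> s x" unfolding s_def using Y(1) y(1) by (intro member_le_sum) auto
    finally show ?thesis .
  qed
  \<comment> \<open>The partition of unity.\<close>
  define \<phi> where "\<phi> y x = max 0 (d - dist y x) / s x" for y x
  have sc: "continuous_on K s" unfolding s_def by (intro continuous_intros)
  have \<phi>c: "continuous_on K (\<phi> y)" for y
    unfolding \<phi>_def using sc s by (intro continuous_intros) (auto simp: less_le)
  have \<phi>int: "integrable \<mu> (\<phi> y)" for y by (rule continuous_on_compact_imp_integrable[OF K \<mu> \<phi>c])
  have \<phi>nn: "0 \<le> \<phi> y x" if "x \<in> K" for x y using s[OF that] by (simp add: \<phi>_def)
  have \<phi>sum: "(\<Sum>y\<in>Y. \<phi> y x) = 1" if "x \<in> K" for x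
    using s[OF that] by (simp add: \<phi>_def sum_divide_distrib[symmetric] s_def[symmetric])
  define w where "w y = (\<integral>x. \<phi> y x \<partial>\<mu>)" for y
  interpret prob_space \<mu> by (rule prob_measures_onD[OF \<mu>])
  have wnn: "0 \<le> w y" for y unfolding w_def
    using \<phi>nn by (intro Bochner_Integration.integral_nonneg_AE AE_I2) (auto simp: prob_measures_onD(3)[OF \<mu>])
  have wsum: "(\<Sum>y\<in>Y. w y) = 1"
  proof -
    have "(\<Sum>y\<in>Y. w y) = (\<integral>x. (\<Sum>y\<in>Y. \<phi> y x) \<partial>\<mu>)" unfolding w_def using \<phi>int by simp
    also have "\<dots> = (\<integral>x. 1 \<partial>\<mu>)"
      using \<phi>sum by (intro Bochner_Integration.integral_cong) (auto simp: prob_measures_onD(3)[OF \<mu>])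
    finally show ?thesis by (simp add: prob_space)
  qed
  have wapprox: "\<bar>(\<Sum>y\<in>Y. w y * f y) - (\<integral>x. f x \<partial>\<mu>)\<bar> \<le> e / 4" if f: "f \<in> F" for f
  proof -
    have fint: "integrable \<mu> f" by (rule continuous_on_compact_imp_integrable[OF K \<mu> F(2)[rule_format, OF f]])
    have sint: "integrable \<mu> (\<lambda>x. \<Sum>y\<in>Y. \<phi> y x * f y)" using \<phi>int by simp
    have "(\<Sum>y\<in>Y. w y * f y) - (\<integral>x. f x \<partial>\<mu>) = (\<integral>x. (\<Sum>y\<in>Y. \<phi> y x * f y) - f x \<partial>\<mu>)"
      unfolding w_def using \<phi>int fint sint by simp
    also have "\<bar>\<dots>\<bar> \<le> (\<integral>x. \<bar>(\<Sum>y\<in>Y. \<phi> y x * f y) - f x\<bar> \<partial>\<mu>)" by (rule integral_abs_bound)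
    also have "\<dots> \<le> (\<integral>x. e / 4 \<partial>\<mu>)"
    proof (intro integral_mono)
      fix x assume "x \<in> space \<mu>"
      hence x: "x \<in> K" by (simp add: prob_measures_onD(3)[OF \<mu>])
      have "(\<Sum>y\<in>Y. \<phi> y x * f y) - f x = (\<Sum>y\<in>Y. \<phi> y x * f y) - (\<Sum>y\<in>Y. \<phi> y x) * f x"
        using \<phi>sum[OF x] by simp
      also have "\<dots> = (\<Sum>y\<in>Y. \<phi> y x * (f y - f x))"
        by (simp add: sum_distrib_right sum_subtractf right_diff_distrib)
      also have "\<bar>\<dots>\<bar> \<le> (\<Sum>y\<in>Y. \<bar>\<phi> y x * (f y - f x)\<bar>)" by (rule sum_abs)
      also have "\<dots> \<le> (\<Sum>y\<in>Y. \<phi> y x * (e / 4))"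
      proof (rule sum_mono)
        fix y assume y: "y \<in> Y"
        show "\<bar>\<phi> y x * (f y - f x)\<bar> \<le> \<phi> y x * (e / 4)"
        proof (cases "dist y x < d")
          case True
          then have "\<bar>f y - f x\<bar> \<le> e / 4" using d(2)[OF f x] y Y(2) by auto
          then show ?thesis using \<phi>nn[OF x, of y] by (simp add: abs_mult mult_left_mono del: times_divide_eq_right)
        qed (simp add: \<phi>_def)
      qed
      also have "\<dots> = e / 4" using \<phi>sum[OF x] unfolding sum_distrib_right[symmetric] by simp
      finally show "\<bar>(\<Sum>y\<in>Y. \<phi> y x * f y) - f x\<bar> \<le> e / 4" .
    qed (use fint sint in auto)
    finally show ?thesis by (simp add: prob_space)
  qed
  define b where "b y = (1 - \<eta>) * w y + (if y = z then \<eta> else 0)" for y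
  have bsum: "(\<Sum>y\<in>Y. b y * g y) = (1 - \<eta>) * (\<Sum>y\<in>Y. w y * g y) + \<eta> * g z" for g
  proof -
    have "(\<Sum>y\<in>Y. (if y = z then \<eta> else 0) * g y) = (\<Sum>y\<in>Y. if y = z then \<eta> * g y else 0)"
      by (intro sum.cong) auto
    also have "\<dots> = \<eta> * g z" using Y(1) by (simp add: Y_def)
    finally show ?thesis unfolding b_def
      by (simp add: distrib_right sum.distrib sum_distrib_left mult.assoc)
  qed
  have "\<exists>a. set_pmf a \<subseteq> Y \<and> (\<forall>y\<in>Y. pmf a y = b y)"
  proof (rule ex_pmf_finite[OF Y(1)])
    show "0 \<le> b y" for y using \<eta> wnn[of y] by (simp add: b_def)
    show "(\<Sum>y\<in>Y. b y) = 1" using bsum[of "\<lambda>_. 1"] wsum by simp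
  qed
  then obtain a where a: "set_pmf a \<subseteq> Y" "\<And>y. y \<in> Y \<Longrightarrow> pmf a y = b y" by blast
  have fina: "finite (set_pmf a)" using a(1) Y(1) by (rule finite_subset)
  show ?thesis
  proof (intro exI conjI allI impI)
    show "finite (set_pmf a)" by (rule fina)
    show "0 < d" by (rule d(1))
    show "set_pmf a \<subseteq> K" using a(1) Y(2) by blast
    have "pmf a z > 0" using a(2)[of z] \<eta> wnn[of z] by (simp add: Y_def b_def add_nonneg_pos)
    then show "z \<in> set_pmf a" by (simp add: set_pmf_iff)
    fix h assume "\<forall>y\<in>set_pmf a. finite (set_pmf (h y)) \<and> set_pmf (h y) \<subseteq> K \<inter> ball y d"
    hence h: "finite (set_pmf (h y))" "set_pmf (h y) \<subseteq> K \<inter> ball y d" if "y \<in> set_pmf a" for y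
      using that by auto
    have sub: "set_pmf (bind_pmf a h) \<subseteq> K" using h(2) by fastforce
    show "discrete_on K (bind_pmf a h) \<in> W"
    proof (rule nb[rule_format, OF discrete_on_in_prob_measures_on[OF sub]])
      fix f assume f: "f \<in> F"
      have "(\<integral>x. f x \<partial>(discrete_on K (bind_pmf a h))) = measure_pmf.expectation (bind_pmf a h) f"
        by (rule integral_discrete_on[OF sub F(2)[rule_format, OF f]])
      also have "\<dots> = (\<Sum>y\<in>set_pmf a. pmf a y *\<^sub>R measure_pmf.expectation (h y) f)"
        using h fina by (intro pmf_expectation_bind) auto
      finally have E: "(\<integral>x. f x \<partial>(discrete_on K (bind_pmf a h))) = (\<Sum>y\<in>set_pmf a. pmf a y * measure_pmf.expectation (h y) f)"
        by simp
      have "\<bar>(\<Sum>y\<in>set_pmf a. pmf a y * measure_pmf.expectation (h y) f) - (\<Sum>y\<in>set_pmf a. pmf a y * f y)\<bar>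
        = \<bar>\<Sum>y\<in>set_pmf a. pmf a y * (measure_pmf.expectation (h y) f - f y)\<bar>"
        by (simp add: sum_subtractf right_diff_distrib)
      also have "\<dots> \<le> (\<Sum>y\<in>set_pmf a. \<bar>pmf a y * (measure_pmf.expectation (h y) f - f y)\<bar>)" by (rule sum_abs)
      also have "\<dots> \<le> (\<Sum>y\<in>set_pmf a. pmf a y * (e / 4))"
      proof (rule sum_mono)
        fix y assume y: "y \<in> set_pmf a"
        have "\<bar>measure_pmf.expectation (h y) f - f y\<bar> \<le> e / 4"
          using h(1)[OF y] subsetD[OF h(2)[OF y]] d(2)[OF f] y a(1) Y(2) by (intro pmf_expectation_near) (auto simp: dist_commute)
        then show "\<bar>pmf a y * (measure_pmf.expectation (h y) f - f y)\<bar> \<le> pmf a y * (e / 4)"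
          by (simp add: abs_mult mult_left_mono del: times_divide_eq_right)
      qed
      also have "\<dots> = e / 4" using sum_pmf_eq_1[OF fina order_refl] unfolding sum_distrib_right[symmetric] by simp
      finally have 1: "\<bar>(\<Sum>y\<in>set_pmf a. pmf a y * measure_pmf.expectation (h y) f) - (\<Sum>y\<in>set_pmf a. pmf a y * f y)\<bar> \<le> e / 4" .
      have 2: "(\<Sum>y\<in>set_pmf a. pmf a y * f y) = (1 - \<eta>) * (\<Sum>y\<in>Y. w y * f y) + \<eta> * f z"
      proof -
        have "(\<Sum>y\<in>set_pmf a. pmf a y * f y) = (\<Sum>y\<in>Y. pmf a y * f y)"
          using Y(1) a(1) by (intro sum.mono_neutral_left) (auto simp: set_pmf_iff)
        also have "\<dots> = (\<Sum>y\<in>Y. b y * f y)" using a(2) by simp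
        finally show ?thesis using bsum[of f] by simp
      qed
      have wM: "\<bar>\<Sum>y\<in>Y. w y * f y\<bar> \<le> M"
      proof -
        have "\<bar>\<Sum>y\<in>Y. w y * f y\<bar> \<le> (\<Sum>y\<in>Y. \<bar>w y * f y\<bar>)" by (rule sum_abs)
        also have "\<dots> \<le> (\<Sum>y\<in>Y. w y * M)"
          using wnn M(2)[OF f] Y(2) by (intro sum_mono) (auto simp: abs_mult intro!: mult_left_mono)
        finally show ?thesis using wsum unfolding sum_distrib_right[symmetric] by simp
      qed
      have "\<bar>\<eta> * (f z - (\<Sum>y\<in>Y. w y * f y))\<bar> \<le> \<eta> * (2 * M)"
        using \<eta>(1) wM M(2)[OF f z] by (auto simp: abs_mult intro!: mult_left_mono)
      hence 3: "\<bar>\<eta> * f z - \<eta> * (\<Sum>y\<in>Y. w y * f y)\<bar> \<le> e / 4" using \<eta>(3) by (simp add: right_diff_distrib)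
      show "\<bar>(\<integral>x. f x \<partial>(discrete_on K (bind_pmf a h))) - (\<integral>x. f x \<partial>\<mu>)\<bar> < e"
        unfolding E using 1[unfolded 2 left_diff_distrib mult_1_left] 3 wapprox[OF f] e by linarith
    qed
  qed
qed

text \<open>An open form of one half of the Prokhorov distance. Lower bounds for the mass near each set of atoms are
  finitely many open conditions. Applied to the atoms whose balls miss \<open>E\<close>, they bound the mass of
  \<open>E\<close> from above.\<close>

lemma discrete_on_open_nbhd:
  fixes K :: "'a::metric_space set"
  assumes K: "compact K" and p: "finite (set_pmf p)" "set_pmf p \<subseteq> K" and pos: "0 < \<rho>" "0 < \<eta>"
  shows "\<exists>W. openin (weak_topology_on K) W \<and> discrete_on K p \<in> W \<and>
    (\<forall>\<mu>\<in>W. \<forall>E\<in>sets \<mu>. measure \<mu> E \<le> measure_pmf.prob p {x. E \<inter> ball x \<rho> \<noteq> {}} + \<eta>)"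
proof -
  define V where "V A = {\<mu> \<in> prob_measures_on K. measure_pmf.prob p A - \<eta> < measure \<mu> ((\<Union>x\<in>A. ball x \<rho>) \<inter> K)}" for A
  define W where "W = (\<Inter>A\<in>Pow (set_pmf p). V A)"
  show ?thesis
  proof (intro exI[of _ W] conjI ballI)
    show "openin (weak_topology_on K) W"
      unfolding W_def V_def using p(1) K
      by (intro openin_INT2 openin_weak_topology_measure_greater) auto
    have P: "discrete_on K p \<in> prob_measures_on K" by (rule discrete_on_in_prob_measures_on[OF p(2)])
    show "discrete_on K p \<in> W"
      unfolding W_def V_def
    proof (intro INT_I CollectI conjI P)
      fix A assume A: "A \<in> Pow (set_pmf p)"
      have S: "(\<Union>x\<in>A. ball x \<rho>) \<inter> K \<in> sets (discrete_on K p)"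
        unfolding sets_prob_measures_on_iff[OF P] by (intro bexI[of _ "\<Union>x\<in>A. ball x \<rho>"]) (auto intro!: borel_open)
      have "measure_pmf.prob p A \<le> measure_pmf.prob p ((\<Union>x\<in>A. ball x \<rho>) \<inter> K)"
        using A p(2) pos by (intro measure_pmf.finite_measure_mono) auto
      then show "measure_pmf.prob p A - \<eta> < measure (discrete_on K p) ((\<Union>x\<in>A. ball x \<rho>) \<inter> K)"
        using measure_discrete_on[OF p(2) S] pos by simp
    qed
    fix \<mu> E assume \<mu>: "\<mu> \<in> W" and E: "E \<in> sets \<mu>"
    hence \<mu>P: "\<mu> \<in> prob_measures_on K" by (auto simp: W_def V_def)
    interpret prob_space \<mu> by (rule prob_measures_onD[OF \<mu>P])
    define A where "A = {x \<in> set_pmf p. E \<inter> ball x \<rho> = {}}"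
    let ?U = "(\<Union>x\<in>A. ball x \<rho>) \<inter> K"
    have S: "?U \<in> sets \<mu>"
      unfolding sets_prob_measures_on_iff[OF \<mu>P] by (intro bexI[of _ "\<Union>x\<in>A. ball x \<rho>"]) (auto intro!: borel_open)
    have "measure_pmf.prob p A - \<eta> < measure \<mu> ?U" using \<mu> by (auto simp: W_def V_def A_def)
    moreover have "measure \<mu> E + measure \<mu> ?U = measure \<mu> (E \<union> ?U)"
      using E S by (intro finite_measure_Union[symmetric]) (auto simp: A_def)
    moreover note prob_le_1[of "E \<union> ?U"]
    moreover have "measure_pmf.prob p A = 1 - measure_pmf.prob p {x. E \<inter> ball x \<rho> \<noteq> {}}"
    proof -
      have "measure_pmf.prob p A = measure_pmf.prob p (UNIV - {x. E \<inter> ball x \<rho> \<noteq> {}})"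
        by (intro measure_pmf.finite_measure_eq_AE) (auto simp: AE_measure_pmf_iff A_def)
      then show ?thesis using measure_pmf.prob_compl[of "{x. E \<inter> ball x \<rho> \<noteq> {}}" p] by simp
    qed
    ultimately show "measure \<mu> E \<le> measure_pmf.prob p {x. E \<inter> ball x \<rho> \<noteq> {}} + \<eta>" by linarith
  qed
qed

section \<open>Doubling measures and separated sets\<close>

locale compact_doubling = prob_space \<pi> for \<pi> :: "'a::{metric_space, second_countable_topology} measure" +
  fixes K :: "'a set"
  assumes sets_eq: "sets \<pi> = sets borel" and K_def: "K = msupp \<pi>" and K: "compact K" "K \<noteq> {}"
    and doubling: "doubling \<pi>"
begin

lemma mass_pos: "x \<in> K \<Longrightarrow> 0 < r \<Longrightarrow> 0 < measure \<pi> (ball x r)"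
  unfolding K_def msupp_def
  by (metis (mono_tags, lifting) centre_in_ball emeasure_eq_measure ennreal_less_zero_iff mem_Collect_eq open_ball)

lemma mass_mono: "ball x r \<subseteq> ball y s \<Longrightarrow> measure \<pi> (ball x r) \<le> measure \<pi> (ball y s)"
  by (rule finite_measure_mono) (simp_all add: sets_eq)

lemma doubling_constant:
  obtains C where "C \<ge> 1" "\<And>x r. x \<in> K \<Longrightarrow> 0 < r \<Longrightarrow> measure \<pi> (ball x (2 * r)) \<le> C * measure \<pi> (ball x r)"
proof -
  obtain C0 where C0: "C0 > 0"
    "(SUP x\<in>msupp \<pi>. SUP r\<in>{0<..}. emeasure \<pi> (ball x (2 * r)) / emeasure \<pi> (ball x r)) \<le> ennreal C0"
    using doubling unfolding doubling_def by blast
  show thesis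
  proof (rule that[of "max 1 C0"])
    fix x r assume x: "x \<in> K" and r: "0 < (r::real)"
    let ?a = "measure \<pi> (ball x (2 * r))" and ?b = "measure \<pi> (ball x r)"
    have b: "?b > 0" by (rule mass_pos[OF x r])
    have "ennreal (?a / ?b) = emeasure \<pi> (ball x (2 * r)) / emeasure \<pi> (ball x r)"
      using b by (simp add: emeasure_eq_measure divide_ennreal)
    also have "\<dots> \<le> (SUP r\<in>{0<..}. emeasure \<pi> (ball x (2 * r)) / emeasure \<pi> (ball x r))"
      using r by (intro SUP_upper) simp
    also have "\<dots> \<le> (SUP x\<in>msupp \<pi>. SUP r\<in>{0<..}. emeasure \<pi> (ball x (2 * r)) / emeasure \<pi> (ball x r))"
      using x unfolding K_def by (rule SUP_upper)
    also note C0(2)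
    finally have "?a / ?b \<le> C0" using C0(1) by simp
    hence "?a \<le> C0 * ?b" using b by (simp add: pos_divide_le_eq)
    also have "\<dots> \<le> max 1 C0 * ?b" using b by (intro mult_right_mono) auto
    finally show "?a \<le> max 1 C0 * ?b" .
  qed simp
qed

text \<open>Some radius \<open>R\<close> makes every ball \<open>ball x R\<close> with \<open>x \<in> K\<close> contain a fixed ball of mass \<open>m\<close>. Halving the radius \<open>k\<close> times
  costs a factor \<open>C ^ k\<close>, which is a power of the radius with exponent \<open>s = log 2 C\<close>.\<close>

lemma mass_lower_bound:
  obtains c s where "c > 0" "\<And>x r. x \<in> K \<Longrightarrow> 0 < r \<Longrightarrow> r < 1 \<Longrightarrow> c * r powr s \<le> measure \<pi> (ball x r)"
proof -
  obtain C where C: "C \<ge> 1" "\<And>x r. x \<in> K \<Longrightarrow> 0 < r \<Longrightarrow> measure \<pi> (ball x (2 * r)) \<le> C * measure \<pi> (ball x r)"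
    using doubling_constant by blast
  obtain x0 where x0: "x0 \<in> K" using K(2) by blast
  obtain B where B: "\<And>x. x \<in> K \<Longrightarrow> dist x0 x \<le> B"
    using compact_imp_bounded[OF K(1)] bounded_any_center[of K x0] by blast
  define R where "R = B + 1"
  have R: "R \<ge> 1" using B[OF x0] by (simp add: R_def)
  define m where "m = measure \<pi> (ball x0 1)"
  have m: "m > 0" unfolding m_def by (rule mass_pos[OF x0]) simp
  have dyadic: "m \<le> C ^ k * measure \<pi> (ball x (R / 2 ^ k))" if x: "x \<in> K" for x k
  proof (induction k)
    case 0
    have "ball x0 1 \<subseteq> ball x R"
    proof
      fix z assume "z \<in> ball x0 1"
      then show "z \<in> ball x R"
        using B[OF x] dist_triangle[of x z x0] by (simp add: R_def dist_commute)
    qed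
    from mass_mono[OF this] show ?case by (simp add: m_def)
  next
    case (Suc k)
    have "measure \<pi> (ball x (2 * (R / 2 ^ Suc k))) \<le> C * measure \<pi> (ball x (R / 2 ^ Suc k))"
      using R by (intro C(2)[OF x]) simp
    hence "measure \<pi> (ball x (R / 2 ^ k)) \<le> C * measure \<pi> (ball x (R / 2 ^ Suc k))" by simp
    hence "C ^ k * measure \<pi> (ball x (R / 2 ^ k)) \<le> C ^ k * (C * measure \<pi> (ball x (R / 2 ^ Suc k)))"
      using C(1) by (intro mult_left_mono) auto
    with Suc show ?case by (simp add: mult_ac)
  qed
  define s where "s = log 2 C"
  have s: "s \<ge> 0" using C(1) by (simp add: s_def)
  have Cpow: "C ^ k = (2 ^ k) powr s" for k
  proof -
    have "(2 ^ k :: real) powr s = (2 powr s) ^ k"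
      by (simp add: powr_realpow[symmetric] powr_powr powr_power mult.commute)
    also have "2 powr s = C" using C(1) by (simp add: s_def)
    finally show ?thesis by simp
  qed
  show thesis
  proof (rule that[of "m * (2 * R) powr - s" s])
    show "m * (2 * R) powr - s > 0" using m R by simp
    fix x r assume x: "x \<in> K" and r: "0 < r" "r < (1::real)"
    define k where "k = (LEAST k::nat. R / 2 ^ k \<le> r)"
    have ex: "\<exists>k::nat. R / 2 ^ k \<le> r"
    proof -
      obtain k :: nat where "R / r < 2 ^ k" using real_arch_pow[of 2 "R / r"] by auto
      then show ?thesis using r by (intro exI[of _ k]) (simp add: field_simps)
    qed
    have k: "R / 2 ^ k \<le> r" unfolding k_def by (rule LeastI_ex[OF ex])
    have "k \<noteq> 0" using k R r by (intro notI) auto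
    then obtain j where j: "k = Suc j" by (cases k) auto
    have "\<not> R / 2 ^ j \<le> r" using not_less_Least[of j "\<lambda>k. R / 2 ^ k \<le> r"] j by (simp add: k_def)
    hence "2 ^ k \<le> 2 * R / r" using r by (simp add: j field_simps)
    hence "C ^ k \<le> (2 * R / r) powr s" unfolding Cpow using s by (intro powr_mono2) auto
    hence "m \<le> (2 * R / r) powr s * measure \<pi> (ball x (R / 2 ^ k))"
      using dyadic[OF x, of k] by (meson measure_nonneg mult_right_mono order_trans)
    also have "\<dots> \<le> (2 * R / r) powr s * measure \<pi> (ball x r)"
      using k by (intro mult_left_mono mass_mono) auto
    finally have "m * (2 * R / r) powr - s \<le> measure \<pi> (ball x r)"
      using R r by (simp add: powr_minus_divide field_simps)
    moreover have "m * (2 * R) powr - s * r powr s = m * (2 * R / r) powr - s"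
      using R r by (simp add: powr_minus powr_divide field_simps)
    ultimately show "m * (2 * R) powr - s * r powr s \<le> measure \<pi> (ball x r)" by (simp only:)
  qed
qed

lemma upper_box_dim_Lipschitz_in_order:
  obtains s where "\<And>q q' E. upper_box_dim \<pi> q' E \<le> upper_box_dim \<pi> q E + ereal (s * \<bar>q' - q\<bar>)"
proof -
  obtain c s where "c > 0" "\<And>x r. x \<in> K \<Longrightarrow> 0 < r \<Longrightarrow> r < 1 \<Longrightarrow> c * r powr s \<le> measure \<pi> (ball x r)"
    using mass_lower_bound by blast
  then show thesis
    using that upper_box_dim_Lipschitz[OF _ prob_space_axioms] unfolding K_def by blast
qed

text \<open>The balls are nested, \<open>ball z r \<subseteq> ball x (3 * r) \<subseteq> ball z (8 * r)\<close>. For \<open>q \<ge> 0\<close> three doublings are needed, for \<open>q < 0\<close>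
  monotonicity alone gives the constant 1.\<close>

lemma mass_comparable:
  obtains c where "c > 0" "\<And>x z r. x \<in> K \<Longrightarrow> z \<in> K \<Longrightarrow> 0 < r \<Longrightarrow> dist z x \<le> 5 / 4 * r \<Longrightarrow>
    c * measure \<pi> (ball x (3 * r)) powr q \<le> measure \<pi> (ball z r) powr q"
proof -
  obtain C where C: "C \<ge> 1" "\<And>x r. x \<in> K \<Longrightarrow> 0 < r \<Longrightarrow> measure \<pi> (ball x (2 * r)) \<le> C * measure \<pi> (ball x r)"
    using doubling_constant by blast
  show thesis
  proof (rule that[of "min 1 ((C ^ 3) powr - q)"])
    show "min 1 ((C ^ 3) powr - q) > 0" using C(1) by simp
    fix x z r assume x: "x \<in> K" and z: "z \<in> K" and r: "0 < r" and d: "dist z x \<le> 5 / 4 * r"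
    let ?x = "measure \<pi> (ball x (3 * r))" and ?z = "measure \<pi> (ball z r)"
    have pos: "?x > 0" "?z > 0" using mass_pos x z r by auto
    show "min 1 ((C ^ 3) powr - q) * ?x powr q \<le> ?z powr q"
    proof (cases "q \<ge> 0")
      case True
      have "ball x (3 * r) \<subseteq> ball z (2 * (2 * (2 * r)))"
      proof
        fix y assume "y \<in> ball x (3 * r)"
        then show "y \<in> ball z (2 * (2 * (2 * r)))" using d r dist_triangle[of z y x] by simp
      qed
      hence "?x \<le> measure \<pi> (ball z (2 * (2 * (2 * r))))" by (rule mass_mono)
      also have "\<dots> \<le> C * measure \<pi> (ball z (2 * (2 * r)))" using r by (intro C(2)[OF z]) simp
      also have "\<dots> \<le> C * (C * measure \<pi> (ball z (2 * r)))"
        using r C(1) by (intro mult_left_mono C(2)[OF z]) simp_all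
      also have "\<dots> \<le> C * (C * (C * ?z))"
        using r C(1) by (intro mult_left_mono C(2)[OF z]) simp_all
      also have "\<dots> = C ^ 3 * ?z" by (simp add: power3_eq_cube mult_ac)
      finally have "?x powr q \<le> (C ^ 3 * ?z) powr q" using True pos by (intro powr_mono2) auto
      also have "\<dots> = (C ^ 3) powr q * ?z powr q" using C(1) pos by (simp add: powr_mult)
      finally have "(C ^ 3) powr - q * ?x powr q \<le> ?z powr q"
        using C(1) by (simp add: powr_minus_divide field_simps)
      moreover have "min 1 ((C ^ 3) powr - q) * ?x powr q \<le> (C ^ 3) powr - q * ?x powr q"
        by (intro mult_right_mono) auto
      ultimately show ?thesis by simp
    next
      case False
      have "ball z r \<subseteq> ball x (3 * r)"
      proof
        fix y assume "y \<in> ball z r"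
        then show "y \<in> ball x (3 * r)" using d r dist_triangle[of x y z] by (simp add: dist_commute)
      qed
      hence "?x powr q \<le> ?z powr q" using mass_mono pos False by (intro powr_mono2') auto
      moreover have "min 1 ((C ^ 3) powr - q) * ?x powr q \<le> 1 * ?x powr q"
        by (intro mult_right_mono) auto
      ultimately show ?thesis by simp
    qed
  qed
qed

text \<open>A ball of radius \<open>r\<close> cannot meet the balls of radius \<open>r / 4\<close> around two distinct points of \<open>S\<close>, whose distance would
  be at most \<open>5 / 2 * r\<close>. So each point that is close to \<open>E\<close> needs a covering ball of its own, and this ball has
  comparable mass.\<close>

lemma covering_sum_ge_separated:
  assumes S: "finite S" "\<And>x y. x \<in> S \<Longrightarrow> y \<in> S \<Longrightarrow> x \<noteq> y \<Longrightarrow> 3 * r \<le> dist x y" "S \<subseteq> K" and r: "0 < r"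
    and c: "c > 0" "\<And>x z. x \<in> K \<Longrightarrow> z \<in> K \<Longrightarrow> dist z x \<le> 5 / 4 * r \<Longrightarrow>
      c * measure \<pi> (ball x (3 * r)) powr q \<le> measure \<pi> (ball z r) powr q"
  shows "ennreal (c * (\<Sum>x | x \<in> S \<and> E \<inter> ball x (r / 4) \<noteq> {}. measure \<pi> (ball x (3 * r)) powr q))
    \<le> covering_sum \<pi> q E r"
  unfolding covering_sum_def
proof (rule Inf_greatest, clarify)
  fix I :: "nat set" and x :: "nat \<Rightarrow> 'a"
  assume x: "x ` I \<subseteq> msupp \<pi>" and cover: "E \<subseteq> (\<Union>i\<in>I. ball (x i) r)"
  define T where "T = {s \<in> S. E \<inter> ball s (r / 4) \<noteq> {}}"
  have T: "finite T" using S(1) by (simp add: T_def)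
  have "\<exists>i e. i \<in> I \<and> e \<in> ball s (r / 4) \<and> e \<in> ball (x i) r" if "s \<in> T" for s
    using that cover unfolding T_def by blast
  then obtain j e where je: "\<And>s. s \<in> T \<Longrightarrow> j s \<in> I" "\<And>s. s \<in> T \<Longrightarrow> e s \<in> ball s (r / 4)"
    "\<And>s. s \<in> T \<Longrightarrow> e s \<in> ball (x (j s)) r" by metis
  have near: "dist (x (j s)) s < 5 / 4 * r" if "s \<in> T" for s
    using je(2,3)[OF that] dist_triangle[of "x (j s)" s "e s"] by (simp add: dist_commute)
  have inj: "inj_on j T"
  proof (rule inj_onI, rule ccontr)
    fix s s' assume s: "s \<in> T" "s' \<in> T" "j s = j s'" "s \<noteq> s'"
    have "dist s s' \<le> dist (x (j s)) s + dist (x (j s)) s'" by (metis dist_commute dist_triangle)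
    also have "\<dots> < 5 / 4 * r + 5 / 4 * r" using near[OF s(1)] near[OF s(2)] s(3) by simp
    finally show False using S(2)[of s s'] s r by (auto simp: T_def)
  qed
  have "c * (\<Sum>s\<in>T. measure \<pi> (ball s (3 * r)) powr q) \<le> (\<Sum>s\<in>T. measure \<pi> (ball (x (j s)) r) powr q)"
    unfolding sum_distrib_left
  proof (intro sum_mono c(2))
    fix s assume s: "s \<in> T"
    show "s \<in> K" using s S(3) by (auto simp: T_def)
    show "x (j s) \<in> K" using je(1)[OF s] x by (auto simp: K_def)
    show "dist (x (j s)) s \<le> 5 / 4 * r" using near[OF s] by simp
  qed
  hence "ennreal (c * (\<Sum>s\<in>T. measure \<pi> (ball s (3 * r)) powr q))
      \<le> ennreal (\<Sum>s\<in>T. measure \<pi> (ball (x (j s)) r) powr q)" by (rule ennreal_leI)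
  also have "\<dots> = (\<Sum>i\<in>j ` T. ennreal (measure \<pi> (ball (x i) r) powr q))"
    by (simp add: sum.reindex[OF inj])
  also have "\<dots> \<le> (\<Sum>\<^sub>\<infinity>i\<in>I. ennreal (measure \<pi> (ball (x i) r) powr q))"
    using T je(1) by (intro sum_le_infsum_ennreal) auto
  finally show "ennreal (c * (\<Sum>x | x \<in> S \<and> E \<inter> ball x (r / 4) \<noteq> {}. measure \<pi> (ball x (3 * r)) powr q))
    \<le> (\<Sum>\<^sub>\<infinity>i\<in>I. ennreal (measure \<pi> (ball (x i) r) powr q))"
    unfolding T_def .
qed

end

text \<open>Separated sets have bounded cardinality, because they inject into a finite \<open>d / 2\<close>-net of \<open>K\<close>; a separated set of
  maximal cardinality is a \<open>d\<close>-net of \<open>V\<close>.\<close>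

lemma ex_maximal_separated:
  fixes K V :: "'a::metric_space set"
  assumes "compact K" "V \<subseteq> K" "0 < d"
  shows "\<exists>S. finite S \<and> S \<subseteq> V \<and> (\<forall>x\<in>S. \<forall>y\<in>S. x \<noteq> y \<longrightarrow> d \<le> dist x y) \<and> V \<subseteq> (\<Union>x\<in>S. ball x d)"
proof -
  obtain N where N: "finite N" "K \<subseteq> (\<Union>x\<in>N. ball x (d / 2))"
    using compactE_image[OF assms(1), of K "\<lambda>x. ball x (d / 2)"] assms(3)
    by (metis UN_I centre_in_ball half_gt_zero open_ball subsetI)
  define P where "P S \<longleftrightarrow> finite S \<and> S \<subseteq> V \<and> (\<forall>x\<in>S. \<forall>y\<in>S. x \<noteq> y \<longrightarrow> d \<le> dist x y)" for S
  have card: "card S \<le> card N" if S: "P S" for S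
  proof -
    have "\<exists>n\<in>N. dist n x < d / 2" if "x \<in> S" for x
    proof -
      have "x \<in> K" using that S assms(2) by (auto simp: P_def)
      from subsetD[OF N(2) this] show ?thesis by auto
    qed
    then obtain f where f: "\<And>x. x \<in> S \<Longrightarrow> f x \<in> N" "\<And>x. x \<in> S \<Longrightarrow> dist (f x) x < d / 2" by metis
    have "inj_on f S"
    proof (rule inj_onI, rule ccontr)
      fix x y assume xy: "x \<in> S" "y \<in> S" "f x = f y" "x \<noteq> y"
      have "dist x y \<le> dist (f x) x + dist (f x) y" by (metis dist_commute dist_triangle)
      also have "\<dots> < d" using f(2)[OF xy(1)] f(2)[OF xy(2)] xy(3) by simp
      finally have "dist x y < d" .
      moreover have "d \<le> dist x y" using S xy unfolding P_def by blast
      ultimately show False by simp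
    qed
    then show ?thesis using f(1) N(1) by (intro card_inj_on_le[of f]) auto
  qed
  have "P {}" by (simp add: P_def)
  moreover have "\<forall>S. P S \<longrightarrow> card S < Suc (card N)" using card by (simp add: less_Suc_eq_le)
  ultimately obtain S where S: "P S" "\<And>S'. P S' \<Longrightarrow> card S' \<le> card S"
    using ex_has_greatest_nat[of P "{}" card "Suc (card N)"] by blast
  show ?thesis
  proof (intro exI[of _ S] conjI)
    show "V \<subseteq> (\<Union>x\<in>S. ball x d)"
    proof (rule ccontr)
      assume "\<not> ?thesis"
      then obtain v where "v \<in> V" "v \<notin> (\<Union>x\<in>S. ball x d)" by blast
      hence v: "v \<in> V" "\<And>x. x \<in> S \<Longrightarrow> d \<le> dist x v" by (auto simp: not_less)
      have "v \<notin> S" using v(2)[of v] assms(3) by auto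
      moreover have "P (insert v S)" using S(1) v by (auto simp: P_def dist_commute)
      ultimately show False using S(2)[of "insert v S"] S(1) by (simp add: P_def)
    qed
  qed (use S(1) in \<open>auto simp: P_def\<close>)
qed

section \<open>Conditions that hold on dense open sets\<close>

lemma weak_topology_denseI:
  assumes "\<And>\<mu> V. openin (weak_topology_on K) V \<Longrightarrow> \<mu> \<in> V \<Longrightarrow> \<exists>\<nu>\<in>V. \<nu> \<in> S"
  shows "weak_topology_on K closure_of S = prob_measures_on K"
  using assms unfolding topspace_weak_topology_on[symmetric] dense_intersects_open by blast

text \<open>The small additional atom of the refinement is placed inside \<open>U\<close>.\<close>

lemma dense_positive_measure:
  fixes K :: "'a::metric_space set"
  assumes K: "compact K" and U: "open U" "U \<inter> K \<noteq> {}"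
  shows "weak_topology_on K closure_of {\<mu> \<in> prob_measures_on K. 0 < measure \<mu> (U \<inter> K)} = prob_measures_on K"
proof (rule weak_topology_denseI)
  fix \<mu> V assume V: "openin (weak_topology_on K) V" "\<mu> \<in> V"
  obtain z where z: "z \<in> U" "z \<in> K" using U(2) by blast
  obtain a \<delta> where a: "finite (set_pmf a)" "set_pmf a \<subseteq> K" "z \<in> set_pmf a" "0 < \<delta>"
    "\<forall>h. (\<forall>y\<in>set_pmf a. finite (set_pmf (h y)) \<and> set_pmf (h y) \<subseteq> K \<inter> ball y \<delta>) \<longrightarrow>
      discrete_on K (bind_pmf a h) \<in> V"
    using finite_net_refinement[OF K V z(2)] by blast
  have "discrete_on K (bind_pmf a return_pmf) \<in> V"
    by (rule a(5)[rule_format]) (use a(2,4) in auto)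
  hence 1: "discrete_on K a \<in> V" by (simp add: bind_return_pmf')
  have P: "discrete_on K a \<in> prob_measures_on K" by (rule discrete_on_in_prob_measures_on[OF a(2)])
  have S: "U \<inter> K \<in> sets (discrete_on K a)"
    unfolding sets_prob_measures_on_iff[OF P] using U(1) by (intro bexI[of _ U]) auto
  have "0 < pmf a z" using a(3) by (simp add: pmf_positive)
  also have "\<dots> = measure_pmf.prob a {z}" by (simp add: measure_pmf_single)
  also have "\<dots> \<le> measure_pmf.prob a (U \<inter> K)" using z by (intro measure_pmf.finite_measure_mono) auto
  finally have "0 < measure (discrete_on K a) (U \<inter> K)" using measure_discrete_on[OF a(2) S] by simp
  with 1 P show "\<exists>\<nu>\<in>V. \<nu> \<in> {\<mu> \<in> prob_measures_on K. 0 < measure \<mu> (U \<inter> K)}" by blast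
qed

text \<open>Every atom of the refinement can be moved to a nearby point of \<open>U\<close>.\<close>

lemma dense_nearly_full_measure:
  fixes K :: "'a::metric_space set"
  assumes K: "compact K" and U: "open U" "\<And>z r. z \<in> K \<Longrightarrow> 0 < r \<Longrightarrow> U \<inter> (K \<inter> ball z r) \<noteq> {}" and c: "c < 1"
  shows "weak_topology_on K closure_of {\<mu> \<in> prob_measures_on K. c < measure \<mu> (U \<inter> K)} = prob_measures_on K"
proof (rule weak_topology_denseI)
  fix \<mu> V assume V: "openin (weak_topology_on K) V" "\<mu> \<in> V"
  hence "\<mu> \<in> prob_measures_on K" using openin_subset[OF V(1)] by (auto simp: topspace_weak_topology_on)
  hence "K \<noteq> {}" using prob_space.not_empty prob_measures_onD(1,3) by metis
  then obtain z where z: "z \<in> K" by blast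
  obtain a \<delta> where a: "finite (set_pmf a)" "set_pmf a \<subseteq> K" "0 < \<delta>"
    "\<forall>h. (\<forall>y\<in>set_pmf a. finite (set_pmf (h y)) \<and> set_pmf (h y) \<subseteq> K \<inter> ball y \<delta>) \<longrightarrow>
      discrete_on K (bind_pmf a h) \<in> V"
    using finite_net_refinement[OF K V z] by blast
  have "\<forall>y\<in>set_pmf a. \<exists>u. u \<in> U \<inter> (K \<inter> ball y \<delta>)" using U(2)[OF _ a(3)] a(2) by blast
  then obtain u where u: "\<And>y. y \<in> set_pmf a \<Longrightarrow> u y \<in> U \<inter> (K \<inter> ball y \<delta>)" by metis
  define p where "p = bind_pmf a (\<lambda>y. return_pmf (u y))"
  have 1: "discrete_on K p \<in> V"
    unfolding p_def by (rule a(4)[rule_format]) (use u in auto)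
  have p: "set_pmf p \<subseteq> U \<inter> K" using u by (auto simp: p_def)
  hence pK: "set_pmf p \<subseteq> K" by blast
  have P: "discrete_on K p \<in> prob_measures_on K" by (rule discrete_on_in_prob_measures_on[OF pK])
  have S: "U \<inter> K \<in> sets (discrete_on K p)"
    unfolding sets_prob_measures_on_iff[OF P] using U(1) by (intro bexI[of _ U]) auto
  have "measure_pmf.prob p (U \<inter> K) = 1"
    using p by (intro measure_pmf.prob_eq_1[THEN iffD2]) (auto simp: AE_measure_pmf_iff)
  hence "c < measure (discrete_on K p) (U \<inter> K)" using measure_discrete_on[OF pK S] c by simp
  with 1 P show "\<exists>\<nu>\<in>V. \<nu> \<in> {\<mu> \<in> prob_measures_on K. c < measure \<mu> (U \<inter> K)}" by blast
qed

lemma prob_bind_pmf_gtE: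
  assumes "e < measure_pmf.prob (bind_pmf a h) A"
  obtains y where "y \<in> set_pmf a" "e < measure_pmf.prob (h y) A"
proof (rule ccontr)
  assume "\<not> thesis"
  hence le: "\<And>y. y \<in> set_pmf a \<Longrightarrow> measure_pmf.prob (h y) A \<le> e" using that by (meson not_le)
  have e: "0 \<le> e" using le set_pmf_not_empty[of a] measure_nonneg order_trans by (metis all_not_in_conv)
  have "emeasure (bind_pmf a h) A = (\<integral>\<^sup>+ y. emeasure (h y) A \<partial>a)" by simp
  also have "\<dots> \<le> (\<integral>\<^sup>+ y. ennreal e \<partial>a)"
    using le e by (intro nn_integral_mono_AE) (auto simp: AE_measure_pmf_iff measure_pmf.emeasure_eq_measure intro!: ennreal_leI)
  also have "\<dots> = ennreal e" by simp
  finally show False using assms e by (simp add: measure_pmf.emeasure_eq_measure)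
qed

context compact_doubling
begin

text \<open>The quantitative form of the lower bound on the dimension of sets with positive mass in \<open>U\<close>. The same \<open>\<epsilon>\<close> bounds
  the mass and the scale, so that a sequence of values \<open>\<epsilon>\<close> tending to 0 recovers the full statement.\<close>

definition spread :: "real \<Rightarrow> real \<Rightarrow> 'a set \<Rightarrow> real \<Rightarrow> 'a measure \<Rightarrow> bool" where
  "spread q t U \<epsilon> \<mu> \<longleftrightarrow> (\<forall>E\<in>sets \<mu>. \<epsilon> < measure \<mu> (E \<inter> U) \<longrightarrow>
    (\<exists>r. 0 < r \<and> r < \<epsilon> \<and> ennreal (r powr - t) < covering_sum \<pi> q E r))"

lemma upper_box_dim_ge_if_spread:
  assumes "\<And>n. spread q t U (1 / real (Suc n)) \<mu>" "E \<in> sets \<mu>" "0 < measure \<mu> (E \<inter> U)"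
  shows "ereal t \<le> upper_box_dim \<pi> q E"
proof (rule upper_box_dim_geI)
  show "\<exists>\<^sub>F r in at_right 0. ennreal (r powr - t) \<le> covering_sum \<pi> q E r"
    unfolding frequently_def
  proof
    assume "\<forall>\<^sub>F r in at_right 0. \<not> ennreal (r powr - t) \<le> covering_sum \<pi> q E r"
    then obtain b where b: "b > 0" "\<And>r. 0 < r \<Longrightarrow> r < b \<Longrightarrow> \<not> ennreal (r powr - t) \<le> covering_sum \<pi> q E r"
      by (auto simp: eventually_at_right_field)
    obtain n where n: "1 / real (Suc n) < min b (measure \<mu> (E \<inter> U))"
      using reals_Archimedean[of "min b (measure \<mu> (E \<inter> U))"] b(1) assms(3) by (auto simp: inverse_eq_divide)
    then obtain r where "0 < r" "r < 1 / real (Suc n)" "ennreal (r powr - t) < covering_sum \<pi> q E r"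
      using assms(1)[of n] assms(2) unfolding spread_def by auto
    with b(2)[of r] n show False by simp
  qed
qed

text \<open>The centres of a maximal separated set, weighted by the \<open>q\<close>-th powers of the masses of their balls. A set that comes close to
  a fixed proportion of these weights cannot be covered more cheaply than the whole piece, up to a constant
  that is beaten by passing from the exponent \<open>t'\<close> to \<open>t < t'\<close>.\<close>

lemma local_spread_pmf:
  assumes y: "y \<in> K" and pos: "0 < \<delta>" "0 < \<epsilon>"
    and H: "\<And>x r. x \<in> U \<inter> K \<Longrightarrow> 0 < r \<Longrightarrow> ereal t < upper_box_dim \<pi> q (K \<inter> ball x r)"
  shows "\<exists>h \<rho>. finite (set_pmf h) \<and> set_pmf h \<subseteq> K \<inter> ball y \<delta> \<and> 0 < \<rho> \<and>
    (\<forall>E \<subseteq> U \<inter> K. \<epsilon> < measure_pmf.prob h {x. E \<inter> ball x \<rho> \<noteq> {}} \<longrightarrow>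
      (\<exists>r. 0 < r \<and> r < \<epsilon> \<and> ennreal (r powr - t) < covering_sum \<pi> q E r))"
proof (cases "U \<inter> K \<inter> ball y \<delta> = {}")
  case True
  have "measure_pmf.prob (return_pmf y) {x. E \<inter> ball x \<delta> \<noteq> {}} = 0" if "E \<subseteq> U \<inter> K" for E
  proof -
    have "E \<inter> ball y \<delta> = {}" using True that by blast
    then show ?thesis by (simp add: measure_return_pmf)
  qed
  then show ?thesis
    using y pos by (intro exI[of _ "return_pmf y"] exI[of _ \<delta>]) auto
next
  case False
  then obtain y' where y': "y' \<in> U \<inter> K" "y' \<in> ball y \<delta>" by blast
  then obtain \<delta>' where \<delta>': "0 < \<delta>'" "ball y' \<delta>' \<subseteq> ball y \<delta>" using open_ball open_contains_ball by blast
  define V where "V = K \<inter> ball y' \<delta>'"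
  obtain t' where t': "ereal t < ereal t'" "ereal t' < upper_box_dim \<pi> q V"
    using H[OF y'(1) \<delta>'(1)] ereal_dense2 unfolding V_def by blast
  obtain c where c: "c > 0" "\<And>x z r. x \<in> K \<Longrightarrow> z \<in> K \<Longrightarrow> 0 < r \<Longrightarrow> dist z x \<le> 5 / 4 * r \<Longrightarrow>
    c * measure \<pi> (ball x (3 * r)) powr q \<le> measure \<pi> (ball z r) powr q"
    using mass_comparable[of q] by blast
  have "\<forall>\<^sub>F R in at_right 0. 3 powr t / (c * \<epsilon>) * R powr - t < R powr - t'"
    using t'(1) by (intro eventually_const_powr_less) simp
  moreover have "\<forall>\<^sub>F R in at_right 0. R < 3 * \<epsilon> \<and> 0 < (R :: real)"
    using pos(2) by (intro eventually_conj order_tendstoD(2)[OF tendsto_ident_at] eventually_at_right_less) auto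
  ultimately have "\<forall>\<^sub>F R in at_right 0. 3 powr t / (c * \<epsilon>) * R powr - t < R powr - t' \<and> R < 3 * \<epsilon> \<and> 0 < R"
    by (rule eventually_conj)
  from frequently_eventually_conj[OF upper_box_dim_greater_imp[OF t'(2)] this]
  obtain R where R: "3 powr t / (c * \<epsilon>) * R powr - t < R powr - t'" "R < 3 * \<epsilon>" "0 < R"
    "ennreal (R powr - t') < covering_sum \<pi> q V R"
    using frequently_ex by blast
  define r where "r = R / 3"
  have r: "0 < r" "r < \<epsilon>" "3 * r = R" using R by (auto simp: r_def)
  have VK: "V \<subseteq> K" by (auto simp: V_def)
  obtain S where S: "finite S" "S \<subseteq> V" "\<forall>x\<in>S. \<forall>y\<in>S. x \<noteq> y \<longrightarrow> R \<le> dist x y" "V \<subseteq> (\<Union>x\<in>S. ball x R)"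
    using ex_maximal_separated[OF K(1) VK R(3)] by blast
  define w where "w x = measure \<pi> (ball x R) powr q" for x
  define W where "W = (\<Sum>x\<in>S. w x)"
  have "ennreal (R powr - t') < ennreal W"
    using R(4) covering_sum_le_finite[OF S(1) _ S(4)] S(2) VK unfolding W_def w_def K_def
    by (meson less_le_trans order_trans)
  hence W: "R powr - t' < W" by (simp add: ennreal_less_iff)
  hence Wpos: "0 < W" by (meson le_less_trans powr_ge_zero)
  have "\<exists>h. set_pmf h \<subseteq> S \<and> (\<forall>x\<in>S. pmf h x = w x / W)"
  proof (rule ex_pmf_finite[OF S(1)])
    show "0 \<le> w x / W" for x using Wpos by (simp add: w_def)
    show "(\<Sum>x\<in>S. w x / W) = 1" using Wpos by (simp add: sum_divide_distrib[symmetric] W_def[symmetric])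
  qed
  then obtain h where h: "set_pmf h \<subseteq> S" "\<And>x. x \<in> S \<Longrightarrow> pmf h x = w x / W" by blast
  show ?thesis
  proof (rule exI[of _ h], rule exI[of _ "r / 4"], intro conjI allI impI)
    show "finite (set_pmf h)" using h(1) S(1) by (rule finite_subset)
    show "set_pmf h \<subseteq> K \<inter> ball y \<delta>" using h(1) S(2) \<delta>'(2) by (auto simp: V_def)
    show "0 < r / 4" using r by simp
    fix E assume E: "\<epsilon> < measure_pmf.prob h {x. E \<inter> ball x (r / 4) \<noteq> {}}"
    define T where "T = {x \<in> S. E \<inter> ball x (r / 4) \<noteq> {}}"
    have T: "finite T" "T \<subseteq> S" using S(1) by (auto simp: T_def)
    have "measure_pmf.prob h {x. E \<inter> ball x (r / 4) \<noteq> {}} = measure_pmf.prob h T"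
      using h(1) by (intro measure_pmf.finite_measure_eq_AE) (auto simp: AE_measure_pmf_iff T_def)
    also have "\<dots> = (\<Sum>x\<in>T. pmf h x)" by (rule measure_measure_pmf_finite[OF T(1)])
    also have "\<dots> = (\<Sum>x\<in>T. w x) / W" using h(2) T(2) by (auto simp: sum_divide_distrib intro!: sum.cong)
    finally have "\<epsilon> * W < (\<Sum>x\<in>T. w x)" using E Wpos by (simp add: pos_less_divide_eq)
    hence "c * (\<epsilon> * W) < c * (\<Sum>x\<in>T. w x)" using c(1) by simp
    moreover have "r powr - t < c * (\<epsilon> * W)"
    proof -
      have "r powr - t = 3 powr t * R powr - t"
        using R(3) by (simp add: r_def powr_divide powr_minus field_simps)
      also have "\<dots> = (c * \<epsilon>) * (3 powr t / (c * \<epsilon>) * R powr - t)" using c(1) pos(2) by simp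
      also have "\<dots> < (c * \<epsilon>) * W" using R(1) W c(1) pos(2) by (intro mult_strict_left_mono) auto
      finally show ?thesis by simp
    qed
    ultimately have "r powr - t < c * (\<Sum>x\<in>T. w x)" by simp
    hence "ennreal (r powr - t) < ennreal (c * (\<Sum>x\<in>T. w x))" by (simp add: ennreal_less_iff)
    also have "\<dots> \<le> covering_sum \<pi> q E r"
      unfolding T_def w_def r(3)[symmetric]
      using S(2,3) VK c(2) r by (intro covering_sum_ge_separated S(1) r(1) c(1)) auto
    finally show "\<exists>r. 0 < r \<and> r < \<epsilon> \<and> ennreal (r powr - t) < covering_sum \<pi> q E r"
      using r by blast
  qed
qed

text \<open>Half of \<open>\<epsilon>\<close> is lost in passing from the finitely supported measure to a neighbourhood, the other half is the
  proportion that some split atom must have near the set. Atoms whose balls miss \<open>U\<close> are left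
  alone and contribute nothing to sets inside \<open>U\<close>.\<close>

lemma dense_interior_spread:
  assumes U: "open U" and \<epsilon>: "0 < \<epsilon>"
    and H: "\<And>x r. x \<in> U \<inter> K \<Longrightarrow> 0 < r \<Longrightarrow> ereal t < upper_box_dim \<pi> q (K \<inter> ball x r)"
  shows "weak_topology_on K closure_of (weak_topology_on K interior_of {\<mu> \<in> prob_measures_on K. spread q t U \<epsilon> \<mu>})
    = prob_measures_on K"
proof (rule weak_topology_denseI)
  let ?X = "weak_topology_on K"
  fix \<mu> V assume V: "openin ?X V" "\<mu> \<in> V"
  obtain z where z: "z \<in> K" using K(2) by blast
  obtain a \<delta> where a: "finite (set_pmf a)" "set_pmf a \<subseteq> K" "0 < \<delta>"
    "\<forall>h. (\<forall>y\<in>set_pmf a. finite (set_pmf (h y)) \<and> set_pmf (h y) \<subseteq> K \<inter> ball y \<delta>) \<longrightarrow>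
      discrete_on K (bind_pmf a h) \<in> V"
    using finite_net_refinement[OF K(1) V z] by blast
  have "\<exists>h \<rho>. finite (set_pmf h) \<and> set_pmf h \<subseteq> K \<inter> ball y \<delta> \<and> 0 < \<rho> \<and>
    (\<forall>E \<subseteq> U \<inter> K. \<epsilon> / 2 < measure_pmf.prob h {x. E \<inter> ball x \<rho> \<noteq> {}} \<longrightarrow>
      (\<exists>r. 0 < r \<and> r < \<epsilon> / 2 \<and> ennreal (r powr - t) < covering_sum \<pi> q E r))" if "y \<in> set_pmf a" for y
    using that a(2,3) \<epsilon> H by (intro local_spread_pmf) auto
  then obtain h \<rho> where h: "\<And>y. y \<in> set_pmf a \<Longrightarrow> finite (set_pmf (h y)) \<and> set_pmf (h y) \<subseteq> K \<inter> ball y \<delta> \<and> 0 < \<rho> y \<and>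
    (\<forall>E \<subseteq> U \<inter> K. \<epsilon> / 2 < measure_pmf.prob (h y) {x. E \<inter> ball x (\<rho> y) \<noteq> {}} \<longrightarrow>
      (\<exists>r. 0 < r \<and> r < \<epsilon> / 2 \<and> ennreal (r powr - t) < covering_sum \<pi> q E r))" by metis
  define \<rho>0 where "\<rho>0 = Min (\<rho> ` set_pmf a)"
  have \<rho>0: "0 < \<rho>0" "\<And>y. y \<in> set_pmf a \<Longrightarrow> \<rho>0 \<le> \<rho> y"
    using a(1) h set_pmf_not_empty[of a] by (auto simp: \<rho>0_def)
  define p where "p = bind_pmf a h"
  have pV: "discrete_on K p \<in> V" unfolding p_def using h by (intro a(4)[rule_format]) auto
  have pK: "finite (set_pmf p)" "set_pmf p \<subseteq> K" using h a(1) by (auto simp: p_def)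
  have \<epsilon>2: "0 < \<epsilon> / 2" using \<epsilon> by simp
  obtain N where N: "openin ?X N" "discrete_on K p \<in> N"
    "\<forall>\<nu>\<in>N. \<forall>E\<in>sets \<nu>. measure \<nu> E \<le> measure_pmf.prob p {x. E \<inter> ball x \<rho>0 \<noteq> {}} + \<epsilon> / 2"
    using discrete_on_open_nbhd[OF K(1) pK \<rho>0(1) \<epsilon>2] by blast
  have NP: "N \<subseteq> prob_measures_on K" using openin_subset[OF N(1)] by (simp add: topspace_weak_topology_on)
  have "spread q t U \<epsilon> \<nu>" if \<nu>: "\<nu> \<in> N" for \<nu>
    unfolding spread_def
  proof (intro ballI impI)
    fix E assume E: "E \<in> sets \<nu>" "\<epsilon> < measure \<nu> (E \<inter> U)"
    have P: "\<nu> \<in> prob_measures_on K" using \<nu> NP by blast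
    have EK: "E \<subseteq> K" using sets.sets_into_space[OF E(1)] prob_measures_onD(3)[OF P] by simp
    have "U \<inter> K \<in> sets \<nu>"
      unfolding sets_prob_measures_on_iff[OF P] using U by (intro bexI[of _ U]) auto
    with E(1) have "E \<inter> (U \<inter> K) \<in> sets \<nu>" by (rule sets.Int)
    moreover have "E \<inter> (U \<inter> K) = E \<inter> U" using EK by blast
    ultimately have "measure \<nu> (E \<inter> U) \<le> measure_pmf.prob p {x. E \<inter> U \<inter> ball x \<rho>0 \<noteq> {}} + \<epsilon> / 2"
      using N(3) \<nu> by simp
    with E(2) have "\<epsilon> / 2 < measure_pmf.prob p {x. E \<inter> U \<inter> ball x \<rho>0 \<noteq> {}}" by simp
    then obtain y where y: "y \<in> set_pmf a" "\<epsilon> / 2 < measure_pmf.prob (h y) {x. E \<inter> U \<inter> ball x \<rho>0 \<noteq> {}}"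
      unfolding p_def by (rule prob_bind_pmf_gtE)
    have "{x. E \<inter> U \<inter> ball x \<rho>0 \<noteq> {}} \<subseteq> {x. E \<inter> U \<inter> ball x (\<rho> y) \<noteq> {}}"
      using subset_ball[OF \<rho>0(2)[OF y(1)]] by blast
    hence "\<epsilon> / 2 < measure_pmf.prob (h y) {x. E \<inter> U \<inter> ball x (\<rho> y) \<noteq> {}}"
      using y(2) measure_pmf.finite_measure_mono[of "{x. E \<inter> U \<inter> ball x \<rho>0 \<noteq> {}}" "{x. E \<inter> U \<inter> ball x (\<rho> y) \<noteq> {}}" "h y"]
      by simp
    moreover have "E \<inter> U \<subseteq> U \<inter> K" using EK by blast
    ultimately obtain r where r: "0 < r" "r < \<epsilon> / 2" "ennreal (r powr - t) < covering_sum \<pi> q (E \<inter> U) r"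
      using h[OF y(1)] by blast
    have "covering_sum \<pi> q (E \<inter> U) r \<le> covering_sum \<pi> q E r" by (intro covering_sum_mono) auto
    with r \<epsilon> show "\<exists>r. 0 < r \<and> r < \<epsilon> \<and> ennreal (r powr - t) < covering_sum \<pi> q E r"
      by (intro exI[of _ r]) auto
  qed
  hence "N \<subseteq> {\<mu> \<in> prob_measures_on K. spread q t U \<epsilon> \<mu>}" using NP by blast
  hence "N \<subseteq> ?X interior_of {\<mu> \<in> prob_measures_on K. spread q t U \<epsilon> \<mu>}"
    using N(1) by (rule interior_of_maximal)
  with N(2) pV show "\<exists>\<nu>\<in>V. \<nu> \<in> ?X interior_of {\<mu> \<in> prob_measures_on K. spread q t U \<epsilon> \<mu>}" by blast
qed

end

section \<open>Lipschitz dependence on the order\<close>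

text \<open>One-sided formulation for extended real values; exchanging the arguments gives the other side.\<close>

definition Lipschitz_ereal :: "real \<Rightarrow> (real \<Rightarrow> ereal) \<Rightarrow> bool" where
  "Lipschitz_ereal s f \<longleftrightarrow> (\<forall>q q'. f q' \<le> f q + ereal (s * \<bar>q' - q\<bar>))"

lemma Lipschitz_ereal_INF:
  assumes "\<And>i. i \<in> I \<Longrightarrow> Lipschitz_ereal s (f i)"
  shows "Lipschitz_ereal s (\<lambda>q. INF i\<in>I. f i q)"
  unfolding Lipschitz_ereal_def
proof (intro allI)
  fix q q'
  let ?c = "s * \<bar>q' - q\<bar>"
  have "(INF i\<in>I. f i q') - ereal ?c \<le> (INF i\<in>I. f i q)"
  proof (rule INF_greatest)
    fix i assume i: "i \<in> I"
    have "(INF i\<in>I. f i q') \<le> f i q'" using i by (rule INF_lower)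
    also have "\<dots> \<le> f i q + ereal ?c" using assms[OF i] unfolding Lipschitz_ereal_def by blast
    finally show "(INF i\<in>I. f i q') - ereal ?c \<le> f i q" by (simp add: ereal_minus_le)
  qed
  then show "(INF i\<in>I. f i q') \<le> (INF i\<in>I. f i q) + ereal ?c" by (simp add: ereal_minus_le)
qed

lemma Lipschitz_ereal_SUP:
  assumes "\<And>i. i \<in> I \<Longrightarrow> Lipschitz_ereal s (f i)"
  shows "Lipschitz_ereal s (\<lambda>q. SUP i\<in>I. f i q)"
  unfolding Lipschitz_ereal_def
proof (intro allI SUP_least)
  fix q q' i assume i: "i \<in> I"
  have "f i q' \<le> f i q + ereal (s * \<bar>q' - q\<bar>)" using assms[OF i] unfolding Lipschitz_ereal_def by blast
  also have "\<dots> \<le> (SUP i\<in>I. f i q) + ereal (s * \<bar>q' - q\<bar>)" using i by (intro add_right_mono SUP_upper)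
  finally show "f i q' \<le> (SUP i\<in>I. f i q) + ereal (s * \<bar>q' - q\<bar>)" .
qed

lemma Lipschitz_ereal_le_if_le_on_Rats:
  assumes f: "Lipschitz_ereal s f" and g: "Lipschitz_ereal s g" and le: "\<And>q. q \<in> \<rat> \<Longrightarrow> f q \<le> g q"
  shows "f q \<le> g q"
proof (rule ereal_le_epsilon2)
  fix e :: real assume e: "0 < e"
  define d where "d = e / (2 * (\<bar>s\<bar> + 1))"
  have d: "0 < d" "(\<bar>s\<bar> + 1) * d = e / 2" using e by (auto simp: d_def field_simps)
  obtain p where p: "p \<in> \<rat>" "q < p" "p < q + d" using Rats_dense_in_real[of q "q + d"] d(1) by auto
  have sd: "s * \<bar>p - q\<bar> \<le> e / 2"
  proof -
    have "s * \<bar>p - q\<bar> \<le> (\<bar>s\<bar> + 1) * \<bar>p - q\<bar>" by (intro mult_right_mono) auto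
    also have "\<dots> \<le> (\<bar>s\<bar> + 1) * d" using p by (intro mult_left_mono) auto
    finally show ?thesis using d(2) by simp
  qed
  have "f q \<le> f p + ereal (s * \<bar>q - p\<bar>)" using f unfolding Lipschitz_ereal_def by blast
  also have "\<dots> \<le> f p + ereal (e / 2)" using sd by (intro add_left_mono) (simp add: abs_minus_commute)
  also have "\<dots> \<le> g p + ereal (e / 2)" by (intro add_right_mono le p(1))
  also have "g p \<le> g q + ereal (s * \<bar>p - q\<bar>)" using g unfolding Lipschitz_ereal_def by blast
  hence "g p + ereal (e / 2) \<le> g q + ereal (s * \<bar>p - q\<bar>) + ereal (e / 2)" by (rule add_right_mono)
  also have "\<dots> \<le> g q + ereal (e / 2) + ereal (e / 2)" using sd by (intro add_right_mono add_left_mono) simp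
  also have "\<dots> = g q + ereal e" by (simp add: add.assoc)
  finally show "f q \<le> g q + ereal e" .
qed

lemma Lipschitz_ereal_eqI:
  assumes "Lipschitz_ereal s f" "Lipschitz_ereal s g" "\<And>q. q \<in> \<rat> \<Longrightarrow> f q = g q"
  shows "f q = g q"
  using Lipschitz_ereal_le_if_le_on_Rats[OF assms(1,2), of q] Lipschitz_ereal_le_if_le_on_Rats[OF assms(2,1), of q]
    assms(3) by (intro antisym) auto

lemma ereal_leI_Rats:
  assumes "\<And>t. t \<in> \<rat> \<Longrightarrow> ereal t < x \<Longrightarrow> ereal t \<le> y"
  shows "x \<le> y"
proof (rule ccontr)
  assume "\<not> ?thesis"
  then obtain r :: rat where "y < ereal (real_of_rat r)" "ereal (real_of_rat r) < x"
    using ereal_dense3[of y x] by (auto simp: not_le)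
  with assms[of "real_of_rat r"] show False by (simp add: not_le[symmetric])
qed

lemma ereal_geI_Rats:
  assumes "\<And>t. t \<in> \<rat> \<Longrightarrow> y < ereal t \<Longrightarrow> x \<le> ereal t"
  shows "x \<le> y"
proof (rule ccontr)
  assume "\<not> ?thesis"
  then obtain r :: rat where "y < ereal (real_of_rat r)" "ereal (real_of_rat r) < x"
    using ereal_dense3[of y x] by (auto simp: not_le)
  with assms[of "real_of_rat r"] show False by (simp add: not_le[symmetric])
qed

section \<open>Dimensions of a typical measure\<close>

text \<open>The infimum increases as \<open>\<epsilon>\<close> decreases, so its limit is a supremum.\<close>

lemma big_upper_dim_eq_SUP:
  "big_upper_dim \<pi> q \<mu> =
    (SUP \<epsilon>\<in>{0<..}. INF E\<in>{E \<in> sets \<mu>. measure \<mu> E > 1 - \<epsilon>}. upper_box_dim \<pi> q E)"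
proof -
  define g where "g \<epsilon> = (INF E\<in>{E \<in> sets \<mu>. measure \<mu> E > 1 - \<epsilon>}. upper_box_dim \<pi> q E)" for \<epsilon>
  have mono: "g \<epsilon>' \<le> g \<epsilon>" if "\<epsilon> \<le> \<epsilon>'" for \<epsilon> \<epsilon>'
    unfolding g_def using that by (intro INF_superset_mono) auto
  have "(g \<longlongrightarrow> (SUP \<epsilon>\<in>{0<..}. g \<epsilon>)) (at_right 0)"
  proof (rule order_tendstoI)
    fix a assume "a < (SUP \<epsilon>\<in>{0<..}. g \<epsilon>)"
    then obtain \<epsilon>0 where \<epsilon>0: "0 < \<epsilon>0" "a < g \<epsilon>0" by (auto simp: less_SUP_iff)
    have "\<forall>\<^sub>F \<epsilon> in at_right 0. \<epsilon> < \<epsilon>0"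
      using \<epsilon>0(1) by (intro order_tendstoD(2)[OF tendsto_ident_at])
    then show "\<forall>\<^sub>F \<epsilon> in at_right 0. a < g \<epsilon>"
    proof eventually_elim
      case (elim \<epsilon>)
      then show ?case using mono[of \<epsilon> \<epsilon>0] \<epsilon>0(2) by simp
    qed
  next
    fix a assume a: "(SUP \<epsilon>\<in>{0<..}. g \<epsilon>) < a"
    show "\<forall>\<^sub>F \<epsilon> in at_right 0. g \<epsilon> < a"
      using eventually_at_right_less[of 0]
    proof eventually_elim
      case (elim \<epsilon>)
      have "g \<epsilon> \<le> (SUP \<epsilon>\<in>{0<..}. g \<epsilon>)" using elim by (intro SUP_upper) simp
      with a show ?case by simp
    qed
  qed
  then show ?thesis unfolding big_upper_dim_def g_def[symmetric] by (intro tendsto_Lim) auto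
qed

context compact_doubling
begin

lemma dims_Lipschitz:
  obtains s where "Lipschitz_ereal s (\<lambda>q. small_upper_dim \<pi> q \<mu>)" "Lipschitz_ereal s (\<lambda>q. big_upper_dim \<pi> q \<mu>)"
    "Lipschitz_ereal s (\<lambda>q. tau_loc \<pi> q)" "Lipschitz_ereal s (\<lambda>q. tau_loc_max \<pi> q)"
proof -
  obtain s where "\<And>q q' E. upper_box_dim \<pi> q' E \<le> upper_box_dim \<pi> q E + ereal (s * \<bar>q' - q\<bar>)"
    using upper_box_dim_Lipschitz_in_order by blast
  hence L: "Lipschitz_ereal s (\<lambda>q. upper_box_dim \<pi> q E)" for E by (simp add: Lipschitz_ereal_def)
  show thesis
    by (rule that[of s])
       (unfold small_upper_dim_def big_upper_dim_eq_SUP tau_loc_def tau_loc_max_def local_upper_box_dim_def;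
        intro Lipschitz_ereal_INF Lipschitz_ereal_SUP L)+
qed

text \<open>Only basic neighbourhoods are used, so that the region is exhausted by countably many pieces of low dimension.\<close>

definition low_region :: "'a set set \<Rightarrow> real \<Rightarrow> real \<Rightarrow> 'a set" where
  "low_region B q t = \<Union>{V \<in> B. upper_box_dim \<pi> q (K \<inter> V) < ereal t}"

text \<open>In this context \<open>\<mu>\<close> satisfies the countably many generic conditions that belong to one rational order \<open>q\<close>.\<close>

context
  fixes B :: "'a set set" and \<mu> :: "'a measure" and q :: real
  assumes B: "countable B" "topological_basis B" and \<mu>: "\<mu> \<in> prob_measures_on K" and q: "q \<in> \<rat>"
    and full: "\<And>U. U \<in> B \<Longrightarrow> U \<inter> K \<noteq> {} \<Longrightarrow> 0 < measure \<mu> (U \<inter> K)"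
    and low: "\<And>t n. t \<in> \<rat> \<Longrightarrow> (\<forall>z\<in>K. \<forall>r>0. low_region B q t \<inter> (K \<inter> ball z r) \<noteq> {}) \<Longrightarrow>
      1 - 1 / real (Suc n) < measure \<mu> (low_region B q t \<inter> K)"
    and spread: "\<And>t U n. t \<in> \<rat> \<Longrightarrow> U \<in> insert UNIV B \<Longrightarrow>
      (\<forall>x\<in>U \<inter> K. \<forall>r>0. ereal t < upper_box_dim \<pi> q (K \<inter> ball x r)) \<Longrightarrow> spread q t U (1 / real (Suc n)) \<mu>"
begin

interpretation mu: prob_space \<mu> by (rule prob_measures_onD[OF \<mu>])

lemma basis_open: "U \<in> B \<Longrightarrow> open U"
  using B(2) by (rule topological_basis_open)

lemma basis_inside_ball:
  assumes "x \<in> ball y \<rho>" obtains U where "U \<in> B" "x \<in> U" "U \<subseteq> ball y \<rho>"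
  using topological_basisE[OF B(2) open_ball assms] by blast

lemma open_Int_in_sets: "open U \<Longrightarrow> K \<inter> U \<in> sets \<mu>"
  unfolding sets_prob_measures_on_iff[OF \<mu>] by (intro bexI[of _ U]) auto

lemma ball_pos:
  assumes "x \<in> K" "0 < r" shows "0 < measure \<mu> (K \<inter> ball x r)"
proof -
  obtain U where U: "U \<in> B" "x \<in> U" "U \<subseteq> ball x r" using basis_inside_ball[of x x r] assms(2) by auto
  have "0 < measure \<mu> (U \<inter> K)" using U assms by (intro full) auto
  also have "\<dots> \<le> measure \<mu> (K \<inter> ball x r)" using U by (intro mu.finite_measure_mono open_Int_in_sets) auto
  finally show ?thesis .
qed

lemma small_upper_dim_le: "small_upper_dim \<pi> q \<mu> \<le> tau_loc \<pi> q"
  unfolding tau_loc_def local_upper_box_dim_def K_def[symmetric]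
proof (intro INF_greatest)
  fix x and r :: real assume "x \<in> K" "r \<in> {0<..}"
  then show "small_upper_dim \<pi> q \<mu> \<le> upper_box_dim \<pi> q (K \<inter> ball x r)"
    unfolding small_upper_dim_def using ball_pos open_Int_in_sets by (intro INF_lower) auto
qed

text \<open>The whole space is an admissible \<open>U\<close> for every \<open>t\<close> below \<open>tau_loc\<close>.\<close>

lemma small_upper_dim_ge: "tau_loc \<pi> q \<le> small_upper_dim \<pi> q \<mu>"
proof (rule ereal_leI_Rats)
  fix t assume t: "t \<in> \<rat>" "ereal t < tau_loc \<pi> q"
  have "ereal t < upper_box_dim \<pi> q (K \<inter> ball x r)" if "x \<in> K" "0 < r" for x r
  proof -
    note t(2)
    also have "tau_loc \<pi> q \<le> upper_box_dim \<pi> q (K \<inter> ball x r)"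
      unfolding tau_loc_def local_upper_box_dim_def K_def[symmetric] using that by (intro INF_lower2[of x] INF_lower) auto
    finally show ?thesis .
  qed
  hence "spread q t UNIV (1 / real (Suc n)) \<mu>" for n using t(1) by (intro spread) auto
  from upper_box_dim_ge_if_spread[OF this] show "ereal t \<le> small_upper_dim \<pi> q \<mu>"
    unfolding small_upper_dim_def by (intro INF_greatest) auto
qed

text \<open>For \<open>t\<close> above \<open>tau_loc_max\<close> the low region is dense, hence has full measure, and finitely many of its basic sets
  have almost full measure; their union still has dimension at most \<open>t\<close>.\<close>

lemma big_upper_dim_le: "big_upper_dim \<pi> q \<mu> \<le> tau_loc_max \<pi> q"
proof (rule ereal_geI_Rats)
  fix t assume t: "t \<in> \<rat>" "tau_loc_max \<pi> q < ereal t"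
  have dense: "low_region B q t \<inter> (K \<inter> ball z \<rho>) \<noteq> {}" if z: "z \<in> K" "0 < \<rho>" for z \<rho>
  proof -
    have "local_upper_box_dim \<pi> q (K \<inter> ball z \<rho>) \<le> tau_loc_max \<pi> q"
      unfolding tau_loc_max_def K_def[symmetric] using z by (intro SUP_upper2[of z] SUP_upper) auto
    hence "local_upper_box_dim \<pi> q (K \<inter> ball z \<rho>) < ereal t" using t(2) by (rule le_less_trans)
    then obtain x r where x: "x \<in> K \<inter> ball z \<rho>" "0 < r" "upper_box_dim \<pi> q (K \<inter> ball z \<rho> \<inter> ball x r) < ereal t"
      unfolding local_upper_box_dim_def INF_less_iff by auto
    have "x \<in> ball z \<rho> \<inter> ball x r" using x by auto
    then obtain V where V: "V \<in> B" "x \<in> V" "V \<subseteq> ball z \<rho> \<inter> ball x r"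
      using topological_basisE[OF B(2), of "ball z \<rho> \<inter> ball x r" x] by auto
    have "upper_box_dim \<pi> q (K \<inter> V) \<le> upper_box_dim \<pi> q (K \<inter> ball z \<rho> \<inter> ball x r)"
      using V by (intro upper_box_dim_mono) auto
    also note x(3)
    finally have "x \<in> low_region B q t" using V unfolding low_region_def by blast
    with x(1) show ?thesis by blast
  qed
  have full_low: "1 - \<epsilon> < measure \<mu> (low_region B q t \<inter> K)" if \<epsilon>: "0 < \<epsilon>" for \<epsilon>
  proof -
    obtain n where "1 / real (Suc n) < \<epsilon>" using reals_Archimedean[OF \<epsilon>] by (auto simp: inverse_eq_divide)
    moreover have "1 - 1 / real (Suc n) < measure \<mu> (low_region B q t \<inter> K)"
      using dense by (intro low[OF t(1)]) blast
    ultimately show ?thesis by simp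
  qed
  define C where "C = {V \<in> B. upper_box_dim \<pi> q (K \<inter> V) < ereal t}"
  have "countable C" using B(1) by (simp add: C_def)
  have "C \<noteq> {}"
  proof
    assume "C = {}"
    hence "low_region B q t = {}" unfolding low_region_def C_def[symmetric] by simp
    with full_low[of 1] show False by simp
  qed
  define V where "V = from_nat_into C"
  have V: "range V = C" unfolding V_def by (rule range_from_nat_into) fact+
  define E where "E k = K \<inter> (\<Union>i<k. V i)" for k :: nat
  have VC: "V i \<in> C" for i using V by blast
  have Esets: "E k \<in> sets \<mu>" for k
    unfolding E_def using VC basis_open by (intro open_Int_in_sets open_UN) (auto simp: C_def)
  have Elim: "(\<lambda>k. measure \<mu> (E k)) \<longlonglongrightarrow> measure \<mu> (low_region B q t \<inter> K)"
  proof -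
    have "incseq E"
      unfolding incseq_def E_def by (intro allI impI Int_mono UN_mono order_refl) auto
    hence "(\<lambda>k. measure \<mu> (E k)) \<longlonglongrightarrow> measure \<mu> (\<Union>k. E k)"
      using Esets by (intro mu.finite_Lim_measure_incseq) auto
    moreover have "(\<Union>k. E k) = low_region B q t \<inter> K"
      unfolding low_region_def C_def[symmetric] V[symmetric] E_def by blast
    ultimately show ?thesis by simp
  qed
  have Edim: "upper_box_dim \<pi> q (E k) \<le> ereal t" for k
  proof -
    have "E k = (\<Union>i<k. K \<inter> V i)" by (auto simp: E_def)
    then show ?thesis using upper_box_dim_UN_le[of "{..<k}" \<pi> q "\<lambda>i. K \<inter> V i" t] VC by (simp add: C_def)
  qed
  show "big_upper_dim \<pi> q \<mu> \<le> ereal t"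
    unfolding big_upper_dim_eq_SUP
  proof (rule SUP_least)
    fix \<epsilon> :: real assume "\<epsilon> \<in> {0<..}"
    hence "\<forall>\<^sub>F k in sequentially. 1 - \<epsilon> < measure \<mu> (E k)"
      by (intro order_tendstoD(1)[OF Elim] full_low) simp
    then obtain k where "1 - \<epsilon> < measure \<mu> (E k)" by (auto simp: eventually_sequentially)
    then show "(INF E\<in>{E \<in> sets \<mu>. 1 - \<epsilon> < measure \<mu> E}. upper_box_dim \<pi> q E) \<le> ereal t"
      using Esets Edim by (intro INF_lower2[of "E k"]) auto
  qed
qed

text \<open>A basic set \<open>U\<close> around \<open>y\<close>, inside a ball whose local dimension exceeds \<open>t\<close>, has positive mass. Sets of measure more than
  \<open>1 - measure \<mu> (U \<inter> K)\<close> meet it in positive mass.\<close>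

lemma big_upper_dim_ge: "tau_loc_max \<pi> q \<le> big_upper_dim \<pi> q \<mu>"
proof (rule ereal_leI_Rats)
  fix t assume t: "t \<in> \<rat>" "ereal t < tau_loc_max \<pi> q"
  then obtain y \<rho> where y: "y \<in> K" "0 < \<rho>" "ereal t < local_upper_box_dim \<pi> q (K \<inter> ball y \<rho>)"
    unfolding tau_loc_max_def K_def[symmetric] less_SUP_iff by auto
  obtain U where U: "U \<in> B" "y \<in> U" "U \<subseteq> ball y \<rho>" using basis_inside_ball[of y y \<rho>] y(2) by auto
  have "ereal t < upper_box_dim \<pi> q (K \<inter> ball x r)" if "x \<in> U \<inter> K" "0 < r" for x r
  proof -
    note y(3)
    also have "local_upper_box_dim \<pi> q (K \<inter> ball y \<rho>) \<le> upper_box_dim \<pi> q (K \<inter> ball y \<rho> \<inter> ball x r)"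
      unfolding local_upper_box_dim_def using that U(3) by (intro INF_lower2[of x] INF_lower) auto
    also have "\<dots> \<le> upper_box_dim \<pi> q (K \<inter> ball x r)" by (intro upper_box_dim_mono) auto
    finally show ?thesis .
  qed
  hence "spread q t U (1 / real (Suc n)) \<mu>" for n using t(1) U(1) by (intro spread) auto
  note ge = upper_box_dim_ge_if_spread[OF this]
  have pos: "0 < measure \<mu> (U \<inter> K)" using U y(1) by (intro full) auto
  have UK: "U \<inter> K \<in> sets \<mu>" using open_Int_in_sets[OF basis_open[OF U(1)]] by (simp add: Int_commute)
  have "ereal t \<le> (INF E\<in>{E \<in> sets \<mu>. 1 - measure \<mu> (U \<inter> K) < measure \<mu> E}. upper_box_dim \<pi> q E)"
  proof (rule INF_greatest)
    fix E assume "E \<in> {E \<in> sets \<mu>. 1 - measure \<mu> (U \<inter> K) < measure \<mu> E}"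
    hence E: "E \<in> sets \<mu>" "1 - measure \<mu> (U \<inter> K) < measure \<mu> E" by auto
    have EK: "E \<subseteq> K" using sets.sets_into_space[OF E(1)] prob_measures_onD(3)[OF \<mu>] by simp
    have "measure \<mu> E \<le> measure \<mu> (E \<inter> (U \<inter> K)) + measure \<mu> (space \<mu> - U \<inter> K)"
    proof -
      have "measure \<mu> E \<le> measure \<mu> (E \<inter> (U \<inter> K) \<union> (space \<mu> - U \<inter> K))"
        using EK by (intro mu.finite_measure_mono sets.Un sets.Int sets.compl_sets E(1) UK)
          (auto simp: prob_measures_onD(3)[OF \<mu>])
      also have "\<dots> \<le> measure \<mu> (E \<inter> (U \<inter> K)) + measure \<mu> (space \<mu> - U \<inter> K)"
        using E(1) UK by (intro measure_Un_le) auto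
      finally show ?thesis .
    qed
    moreover have "measure \<mu> (space \<mu> - U \<inter> K) = 1 - measure \<mu> (U \<inter> K)" by (rule mu.prob_compl[OF UK])
    moreover have "E \<inter> (U \<inter> K) = E \<inter> U" using EK by blast
    ultimately have "0 < measure \<mu> (E \<inter> U)" using E(2) by simp
    then show "ereal t \<le> upper_box_dim \<pi> q E" by (rule ge[OF E(1)])
  qed
  also have "\<dots> \<le> big_upper_dim \<pi> q \<mu>"
    unfolding big_upper_dim_eq_SUP using pos by (intro SUP_upper) simp
  finally show "ereal t \<le> big_upper_dim \<pi> q \<mu>" .
qed

end

text \<open>The conditions are indexed by basic sets, rational orders, rational levels and naturals. They give the
  equalities for rational \<open>q\<close>, and Lipschitz continuity extends them to all \<open>q\<close>.\<close>

lemma typical_dims: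
  "typical (weak_topology_on K)
    (\<lambda>\<mu>. \<forall>q. small_upper_dim \<pi> q \<mu> = tau_loc \<pi> q \<and> big_upper_dim \<pi> q \<mu> = tau_loc_max \<pi> q)"
proof -
  let ?X = "weak_topology_on K"
  obtain B :: "'a set set" where B: "countable B" "topological_basis B" using ex_countable_basis by blast
  have Bopen: "open U" if "U \<in> B" for U using B(2) that by (rule topological_basis_open)
  have low_open: "open (low_region B q t)" for q t
    unfolding low_region_def using Bopen by (intro open_Union) auto
  define I1 where "I1 = {U \<in> B. U \<inter> K \<noteq> {}}"
  define I2 where "I2 = {(q, t, n :: nat) \<in> \<rat> \<times> \<rat> \<times> UNIV. \<forall>z\<in>K. \<forall>r>0. low_region B q t \<inter> (K \<inter> ball z r) \<noteq> {}}"
  define I3 where "I3 = {(q, t, U, n :: nat) \<in> \<rat> \<times> \<rat> \<times> insert UNIV B \<times> UNIV.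
    \<forall>x\<in>U \<inter> K. \<forall>r>0. ereal t < upper_box_dim \<pi> q (K \<inter> ball x r)}"
  define W1 where "W1 U = {\<mu> \<in> prob_measures_on K. 0 < measure \<mu> (U \<inter> K)}" for U
  define W2 where "W2 = (\<lambda>(q, t, n :: nat). {\<mu> \<in> prob_measures_on K. 1 - 1 / real (Suc n) < measure \<mu> (low_region B q t \<inter> K)})"
  define W3 where "W3 = (\<lambda>(q, t, U, n :: nat). ?X interior_of {\<mu> \<in> prob_measures_on K. spread q t U (1 / real (Suc n)) \<mu>})"
  have "countable I1" using B(1) by (simp add: I1_def)
  moreover have "countable I2" unfolding I2_def
    by (rule countable_subset[of _ "\<rat> \<times> \<rat> \<times> UNIV"]) (auto simp: countable_rat)
  moreover have "countable I3" unfolding I3_def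
    by (rule countable_subset[of _ "\<rat> \<times> \<rat> \<times> insert UNIV B \<times> UNIV"]) (auto simp: countable_rat B(1))
  ultimately have count: "countable (W1 ` I1 \<union> W2 ` I2 \<union> W3 ` I3)" by simp
  show ?thesis
  proof (rule typical_countable_INT[OF K count, where W = "\<lambda>S. S"])
    fix S assume "S \<in> W1 ` I1 \<union> W2 ` I2 \<union> W3 ` I3"
    then consider U where "U \<in> I1" "S = W1 U" | q t n where "(q, t, n) \<in> I2" "S = W2 (q, t, n)"
      | q t U n where "(q, t, U, n) \<in> I3" "S = W3 (q, t, U, n)" by auto
    then have "openin ?X S \<and> ?X closure_of S = prob_measures_on K"
    proof cases
      case 1
      then show ?thesis
        using dense_positive_measure[OF K(1) Bopen] openin_weak_topology_measure_greater[OF K(1) Bopen]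
        by (simp add: W1_def I1_def)
    next
      case 2
      have "?X closure_of {\<mu> \<in> prob_measures_on K. 1 - 1 / real (Suc n) < measure \<mu> (low_region B q t \<inter> K)}
          = prob_measures_on K"
        using 2(1) by (intro dense_nearly_full_measure[OF K(1) low_open]) (auto simp: I2_def)
      then show ?thesis
        using openin_weak_topology_measure_greater[OF K(1) low_open] by (simp add: 2(2) W2_def)
    next
      case 3
      have "open U" using 3(1) Bopen by (auto simp: I3_def)
      then show ?thesis
        using 3(1) dense_interior_spread[of U "1 / real (Suc n)" t q]
        by (auto simp: 3(2) W3_def I3_def)
    qed
    then show "openin ?X S" "?X closure_of S = prob_measures_on K" by auto
  next
    fix \<mu> assume \<mu>: "\<mu> \<in> prob_measures_on K" and mem: "\<And>S. S \<in> W1 ` I1 \<union> W2 ` I2 \<union> W3 ` I3 \<Longrightarrow> \<mu> \<in> S"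
    have full: "0 < measure \<mu> (U \<inter> K)" if "U \<in> B" "U \<inter> K \<noteq> {}" for U
      using mem[of "W1 U"] that by (auto simp: W1_def I1_def)
    have low: "1 - 1 / real (Suc n) < measure \<mu> (low_region B q t \<inter> K)"
      if "q \<in> \<rat>" "t \<in> \<rat>" "\<forall>z\<in>K. \<forall>r>0. low_region B q t \<inter> (K \<inter> ball z r) \<noteq> {}" for q t n
    proof -
      have "(q, t, n) \<in> I2" using that by (simp add: I2_def)
      hence "\<mu> \<in> W2 (q, t, n)" by (intro mem) blast
      then show ?thesis by (simp add: W2_def)
    qed
    have spr: "spread q t U (1 / real (Suc n)) \<mu>"
      if "q \<in> \<rat>" "t \<in> \<rat>" "U \<in> insert UNIV B" "\<forall>x\<in>U \<inter> K. \<forall>r>0. ereal t < upper_box_dim \<pi> q (K \<inter> ball x r)" for q t U n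
    proof -
      have "(q, t, U, n) \<in> I3" using that unfolding I3_def by blast
      hence "\<mu> \<in> W3 (q, t, U, n)" by (intro mem) blast
      then show ?thesis using interior_of_subset unfolding W3_def by fastforce
    qed
    have rat: "small_upper_dim \<pi> q \<mu> = tau_loc \<pi> q" "big_upper_dim \<pi> q \<mu> = tau_loc_max \<pi> q" if q: "q \<in> \<rat>" for q
    proof -
      note facts = B \<mu> q full low[OF q] spr[OF q]
      show "small_upper_dim \<pi> q \<mu> = tau_loc \<pi> q"
        by (rule antisym[OF small_upper_dim_le small_upper_dim_ge]; (rule facts; assumption)+)
      show "big_upper_dim \<pi> q \<mu> = tau_loc_max \<pi> q"
        by (rule antisym[OF big_upper_dim_le big_upper_dim_ge]; (rule facts; assumption)+)
    qed
    obtain s where s: "Lipschitz_ereal s (\<lambda>q. small_upper_dim \<pi> q \<mu>)" "Lipschitz_ereal s (\<lambda>q. big_upper_dim \<pi> q \<mu>)"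
      "Lipschitz_ereal s (\<lambda>q. tau_loc \<pi> q)" "Lipschitz_ereal s (\<lambda>q. tau_loc_max \<pi> q)"
      by (rule dims_Lipschitz)
    show "\<forall>q. small_upper_dim \<pi> q \<mu> = tau_loc \<pi> q \<and> big_upper_dim \<pi> q \<mu> = tau_loc_max \<pi> q"
      using Lipschitz_ereal_eqI[OF s(1,3) rat(1)] Lipschitz_ereal_eqI[OF s(2,4) rat(2)] by blast
  qed
qed

end

theorem theorem1p2:
  fixes \<pi> :: "'a::euclidean_space measure" and K :: "'a set"
  assumes "sets \<pi> = sets borel" and "prob_space \<pi>"
    and "K = msupp \<pi>" and "compact K"
    and "doubling \<pi>"
  shows "typical (weak_topology_on K)
    (\<lambda>\<mu>. \<forall>q::real. small_upper_dim \<pi> q \<mu> = tau_loc \<pi> q \<and>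
                    big_upper_dim \<pi> q \<mu> = tau_loc_max \<pi> q)"
proof (cases "K = {}")
  case True
  \<comment> \<open>There is no probability measure on the empty set, so the space is empty.\<close>
  have "prob_measures_on K = {}"
    using True prob_space.not_empty prob_measures_onD(1,3) by blast
  then show ?thesis
    unfolding typical_def by (intro exI[of _ "{}"]) (simp add: topspace_weak_topology_on)
next
  case False
  interpret compact_doubling \<pi> K
    using assms False by (intro compact_doubling.intro compact_doubling_axioms.intro)
  show ?thesis by (rule typical_dims)
qed

end
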